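(* Let $d\ge 2$ and $g\ge 1$ be integers and let $\Delta\subseteq\mathbb{Q}^d$ be a $d$-dimensional Fano simplex of Gorenstein index $g$. \begin{enumerate} \item If $(d,g)=(2,1)$, then $\mathrm{Vol}(\Delta)\le 9$, with equality if and only if $\Delta\cong\Delta(P)$ for $P=\begin{pmatrix}1&1&-2\\0&3&-3\end{pmatrix}$. \item If $(d,g)\neq(2,1)$, then $\mathrm{Vol}(\Delta)\le \dfrac{2t_{g,d}^2}{g^2}$. Equality holds if and only if either $(d,g)=(3,1)$ and $\Delta\cong\Delta(P_1)$ with $P_1=\begin{pmatrix}1&1&1&-5\\0&2&2&-4\\0&0&6&-6\end{pmatrix}$, or $\Delta\cong\Delta(P_2)$, where $P_2$ is the $d\times(d+1)$ integer matrix whose first $d-1$ columns are the standard basis vectors $e_1,\dots,e_{d-1}$, whose $d$-th column is $\big(c_1,\dots,c_{d-1},\tfrac{t_{g,d}}{g}\big)^T$ with $c_k=\frac{s_{g,k}-g}{s_{g,k}}\cdot\frac{t_{g,d}}{g}$, and whose last column is $\big(-b_1,\dots,-b_{d-1},-\tfrac{t_{g,d}}{g}\big)^T$ with $b_k=\frac{s_{g,k}+g}{s_{g,k}}\cdot\frac{t_{g,d}}{g}$ ($k=1,\dots,d-1$). \end{enumerate}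
   Context: A lattice simplex in $\mathbb{Q}^d$ is a full-dimensional simplex with vertices in $\mathbb{Z}^d$. A Fano simplex is a lattice simplex containing the origin in its interior whose vertices are primitive lattice vectors. Two simplices are isomorphic ($\cong$) if some $\varphi\in\mathrm{GL}(d,\mathbb{Z})$ maps one onto the other. For a $d\times(d+1)$ matrix $P$, $\Delta(P)$ denotes the convex hull of its columns. The normalized volume is $\mathrm{Vol}(\Delta)=d!\cdot\mathrm{vol}(\Delta)$ (Euclidean volume). For a simplex $\Delta$ containing the origin in its interior (an IP simplex), its dual is $\Delta^*=\{u\in\mathbb{Q}^d:\langle u,v\rangle\ge -1\ \forall v\in\Delta\}$; $g_{\mathbb{Q}}(\Delta)$ is the smallest positive integer $k$ such that $k\Delta$ is a lattice simplex, and the Gorenstein index is $g(\Delta)=g_{\mathbb{Q}}(\Delta)\,g_{\mathbb{Q}}(\Delta^* )$ (for a lattice simplex, the smallest $g\ge1$ with $g\Delta^*$ a lattice simplex). The $g$-Sylvester sequence is $s_{g,1}=g+1$, $s_{g,k+1}=s_{g,k}(s_{g,k}-1)+1$, and the truncated $g$-Sylvester sequence is $t_{g,k}=s_{g,k}-1$. *)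

theory Defs
  imports "Jordan_Normal_Form.Determinant"
begin

text \<open>Points of Q^d are rational vectors of dimension d; a matrix P with d rows and
  d+1 columns lists the vertices of a simplex as its columns.\<close>

definition conv_cols :: "rat mat \<Rightarrow> rat vec set" where
  "conv_cols P = {P *\<^sub>v l | l. dim_vec l = dim_col P \<and> (\<forall>j<dim_col P. l $ j \<ge> 0)
                     \<and> (\<Sum>j<dim_col P. l $ j) = 1}"

definition ratm :: "int mat \<Rightarrow> rat mat" where
  "ratm P = map_mat rat_of_int P"

definition Delta :: "int mat \<Rightarrow> rat vec set" where
  "Delta P = conv_cols (ratm P)"

definition aff_indep_cols :: "rat mat \<Rightarrow> bool" where
  "aff_indep_cols P \<longleftrightarrow> (\<forall>l. dim_vec l = dim_col P \<and> (\<Sum>j<dim_col P. l $ j) = 0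
        \<and> P *\<^sub>v l = 0\<^sub>v (dim_row P) \<longrightarrow> l = 0\<^sub>v (dim_col P))"

definition is_simplex_mat :: "nat \<Rightarrow> rat mat \<Rightarrow> bool" where
  "is_simplex_mat d P \<longleftrightarrow> P \<in> carrier_mat d (d+1) \<and> aff_indep_cols P"

definition lattice_simplex :: "nat \<Rightarrow> rat vec set \<Rightarrow> bool" where
  "lattice_simplex d S \<longleftrightarrow> (\<exists>P :: int mat. is_simplex_mat d (ratm P) \<and> S = conv_cols (ratm P))"

definition in_interior :: "nat \<Rightarrow> rat vec \<Rightarrow> rat vec set \<Rightarrow> bool" where
  "in_interior d x S \<longleftrightarrow> dim_vec x = d \<and> (\<exists>e>0. \<forall>y. dim_vec y = d \<and>
        (\<Sum>k<d. (y $ k - x $ k)^2) < e \<longrightarrow> y \<in> S)"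

definition primitive :: "int vec \<Rightarrow> bool" where
  "primitive v \<longleftrightarrow> v \<noteq> 0\<^sub>v (dim_vec v) \<and>
     (\<forall>(k::int) w. dim_vec w = dim_vec v \<and> v = k \<cdot>\<^sub>v w \<longrightarrow> k = 1 \<or> k = -1)"

definition fano_simplex :: "nat \<Rightarrow> int mat \<Rightarrow> bool" where
  "fano_simplex d P \<longleftrightarrow> is_simplex_mat d (ratm P) \<and> in_interior d (0\<^sub>v d) (Delta P)
      \<and> (\<forall>j<d+1. primitive (col P j))"

definition scale_set :: "rat \<Rightarrow> rat vec set \<Rightarrow> rat vec set" where
  "scale_set k S = (\<lambda>x. k \<cdot>\<^sub>v x) ` S"

definition dual :: "nat \<Rightarrow> rat vec set \<Rightarrow> rat vec set" where
  "dual d S = {u. dim_vec u = d \<and> (\<forall>v\<in>S. u \<bullet> v \<ge> -1)}"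

definition gQ :: "nat \<Rightarrow> rat vec set \<Rightarrow> nat" where
  "gQ d S = (LEAST k::nat. k > 0 \<and> lattice_simplex d (scale_set (of_nat k) S))"

definition gorenstein_index :: "nat \<Rightarrow> rat vec set \<Rightarrow> nat" where
  "gorenstein_index d S = gQ d S * gQ d (dual d S)"

text \<open>Normalized volume d! vol of the simplex with vertex columns of P:
  absolute value of the determinant of the edge vectors from the 0th vertex.\<close>
definition norm_vol :: "rat mat \<Rightarrow> rat" where
  "norm_vol P = \<bar>det (mat (dim_row P) (dim_row P) (\<lambda>(i,j). P $$ (i, j+1) - P $$ (i, 0)))\<bar>"

definition iso :: "nat \<Rightarrow> rat vec set \<Rightarrow> rat vec set \<Rightarrow> bool" where
  "iso d S T \<longleftrightarrow> (\<exists>U :: int mat. U \<in> carrier_mat d d \<and> (det U = 1 \<or> det U = -1)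
        \<and> (\<lambda>x. ratm U *\<^sub>v x) ` S = T)"

fun sylv :: "nat \<Rightarrow> nat \<Rightarrow> nat" where
  "sylv g 0 = 0"
| "sylv g (Suc 0) = g + 1"
| "sylv g (Suc (Suc k)) = sylv g (Suc k) * (sylv g (Suc k) - 1) + 1"

definition tsylv :: "nat \<Rightarrow> nat \<Rightarrow> nat" where
  "tsylv g k = sylv g k - 1"

definition P_two :: "int mat" where
  "P_two = mat_of_rows_list 3 [[1,1,-2],[0,3,-3]]"

definition P_one :: "int mat" where
  "P_one = mat_of_rows_list 4 [[1,1,1,-5],[0,2,2,-4],[0,0,6,-6]]"

text \<open>The matrix P_2 (entries as rationals; they are in fact integers).\<close>
definition P_gen :: "nat \<Rightarrow> nat \<Rightarrow> rat mat" where
  "P_gen d g = mat d (d+1) (\<lambda>(i,j).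
     (let T = rat_of_nat (tsylv g d) / rat_of_nat g;
          s = rat_of_nat (sylv g (i+1)) in
      if j < d - 1 then (if i = j then 1 else 0)
      else if j = d - 1 then (if i < d - 1 then (s - of_nat g) / s * T else T)
      else (if i < d - 1 then - ((s + of_nat g) / s * T) else - T)))"

end

theory Submission
  imports Defs Complex_Main
begin

text \<open>Let the columns v_j of P be the vertices of a Fano simplex of index g with barycentric
  coordinates \<open>\<beta>_j\<close> of the origin. The vertices u_i of the dual simplex satisfy
  \<open>\<langle>u_i, v_j\<rangle> = \<delta>_ij / \<beta>_i - 1\<close>, so \<open>a_i = g / \<beta>_i\<close> are positive integers with
  \<open>\<Sum> 1 / a_i = 1 / g\<close>, and comparing determinants gives
  \<open>Vol(\<Delta>) \<cdot> N = (\<Prod> a_i) / g\<close>, where N is the normalized volume of g times the dual simplex.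
  Since v_j is primitive, a_j divides N; taking the largest a_j, the volume is at most
  \<open>a_0 \<cdots> a_(d-1) / g\<close> for \<open>a_0 \<le> \<dots> \<le> a_d\<close>.

  This product is maximal, up to small exceptions, for \<open>s_1, \<dots>, s_(d-1), 2 t_d, 2 t_d\<close>: in terms of
  \<open>x_i = 1 / a_i\<close>, integrality bounds every tail sum of the x_i from below by \<open>x_0 \<cdots> x_(k-1) / g\<close>.
  After the last index where the partial products of x dominate those of the extremal sequence,
  a majorization argument (partial products below imply sums below, for decreasing x)
  contradicts this tail bound.

  In the equality case the \<open>a_i\<close> are those of the target simplex Q, and
  \<open>Q diag(1/a) G\<^sup>T\<close>, with G the matrix of the \<open>g u_i\<close>, is an integer matrix mapping P to Q;
  its determinant is a unit because the volumes agree.\<close>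

text \<open>Only d of the d+1 weights enter the product bound, while the sum condition involves all
  of them. The last term can only be estimated by its predecessor, so the sum to be compared carries
  one copy more than the product, and plain majorization does not fit the end of the sequence. That
  end is therefore averaged into a block of equal terms, and what remains is to compare M+2 equal
  parts of 1/Q with the Sylvester partition of 1/Q. For M = 1 this comparison fails at Q = 1, where
  3, 3, 3 has product 9 against 8: the case (d,g) = (2,1). It is a tie at Q = 2, which arises from
  (3,1), giving 2, 6, 6, 6, and from (2,2), giving 6, 6, 6; the latter weights are realizable
  numerically but not by primitive vertices with the required volume. Equality of weights alone does
  not determine the lattice: that the map onto the target simplex is integral must be extracted from
  the extremal volume and from the coprimality of g and the Sylvester numbers. Logarithms and roots
  put the partition problem over the reals; the geometry stays rational.\<close>

section \<open>Partitions into unit fractions\<close>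

text \<open>Summation by parts: the weighted sum is a combination of the partial sums of D with the
  nonnegative coefficients c_i - c_(i+1) and c_(n-1).\<close>

lemma sum_weighted_nonneg:
  fixes c D :: "nat \<Rightarrow> real"
  assumes nonneg: "\<And>i. i < n \<Longrightarrow> 0 \<le> c i"
    and decr: "\<And>i. Suc i < n \<Longrightarrow> c (Suc i) \<le> c i"
    and partial: "\<And>k. k \<le> n \<Longrightarrow> 0 \<le> (\<Sum>i<k. D i)"
  shows "0 \<le> (\<Sum>i<n. c i * D i)"
proof -
  have claim: "c k * (\<Sum>i<Suc k. D i) \<le> (\<Sum>i<Suc k. c i * D i)" if "k < n" for k
    using that
  proof (induction k)
    case (Suc k)
    have "c (Suc k) * (\<Sum>i<Suc k. D i) \<le> c k * (\<Sum>i<Suc k. D i)"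
      using decr[OF Suc.prems] partial[of "Suc k"] Suc.prems by (intro mult_right_mono) auto
    also have "\<dots> \<le> (\<Sum>i<Suc k. c i * D i)"
      using Suc by simp
    finally show ?case
      by (simp add: algebra_simps)
  qed simp
  show ?thesis
  proof (cases n)
    case (Suc k)
    have "0 \<le> c k * (\<Sum>i<Suc k. D i)"
      using nonneg[of k] partial[of "Suc k"] Suc by auto
    then show ?thesis
      using claim[of k] Suc by simp
  qed simp
qed

text \<open>The numbers D = ln (y / x) have nonnegative partial sums, so summation by parts with the
  decreasing weights x gives a nonnegative sum of x D; and x D \<le> y - x because ln u \<le> u - 1.
  Equality of the sums forces ln u = u - 1, hence u = 1, at every index.\<close>

lemma sum_le_sum_of_prod_le_prod:
  fixes x y :: "nat \<Rightarrow> real"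
  assumes x: "\<And>i. i < n \<Longrightarrow> 0 < x i" and y: "\<And>i. i < n \<Longrightarrow> 0 < y i"
    and decr: "\<And>i. Suc i < n \<Longrightarrow> x (Suc i) \<le> x i"
    and partial: "\<And>k. k \<le> n \<Longrightarrow> (\<Prod>i<k. x i) \<le> (\<Prod>i<k. y i)"
  shows "(\<Sum>i<n. x i) \<le> (\<Sum>i<n. y i)"
    and "(\<Sum>i<n. x i) = (\<Sum>i<n. y i) \<Longrightarrow> i < n \<Longrightarrow> x i = y i"
proof -
  define D where "D i = ln (y i / x i)" for i
  define e where "e i = y i - x i - x i * D i" for i
  have partial_D: "0 \<le> (\<Sum>i<k. D i)" if "k \<le> n" for k
  proof -
    have pos: "0 < x i" "0 < y i" if "i < k" for i
      using that \<open>k \<le> n\<close> x y by auto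
    have "(\<Sum>i<k. D i) = (\<Sum>i<k. ln (y i)) - (\<Sum>i<k. ln (x i))"
      unfolding D_def sum_subtractf[symmetric] using pos by (intro sum.cong refl ln_divide_pos) auto
    also have "\<dots> = ln (\<Prod>i<k. y i) - ln (\<Prod>i<k. x i)"
      using ln_prod[of "{..<k}" y] ln_prod[of "{..<k}" x] pos by fastforce
    also have "0 \<le> \<dots>"
      using ln_mono[OF partial[OF that]] prod_pos[of "{..<k}" x] pos by simp
    finally show ?thesis .
  qed
  have xD: "0 \<le> (\<Sum>i<n. x i * D i)"
    using x decr partial_D by (intro sum_weighted_nonneg) (auto simp: less_imp_le)
  have e_nonneg: "0 \<le> e i" if "i < n" for i
  proof -
    have "D i \<le> y i / x i - 1"
      unfolding D_def using x[OF that] y[OF that] by (intro ln_le_minus_one) simp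
    then have "x i * D i \<le> x i * (y i / x i - 1)"
      using x[OF that] by (intro mult_left_mono) auto
    also have "\<dots> = y i - x i"
      using x[OF that] by (simp add: right_diff_distrib)
    finally show ?thesis
      unfolding e_def by simp
  qed
  have eq: "(\<Sum>i<n. y i) - (\<Sum>i<n. x i) = (\<Sum>i<n. e i) + (\<Sum>i<n. x i * D i)"
    unfolding e_def by (simp add: sum_subtractf)
  have "0 \<le> (\<Sum>i<n. e i)"
    using e_nonneg by (intro sum_nonneg) auto
  then show "(\<Sum>i<n. x i) \<le> (\<Sum>i<n. y i)"
    using eq xD by linarith
  assume "(\<Sum>i<n. x i) = (\<Sum>i<n. y i)" and i: "i < n"
  then have "(\<Sum>i<n. e i) = 0"
    using eq xD \<open>0 \<le> (\<Sum>i<n. e i)\<close> by linarith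
  then have "e i = 0"
    using e_nonneg i by (subst (asm) sum_nonneg_eq_0_iff) auto
  then have "x i * D i = x i * (y i / x i - 1)"
    unfolding e_def using x[OF i] by (simp add: right_diff_distrib)
  then have "ln (y i / x i) = y i / x i - 1"
    unfolding D_def using x[OF i] by simp
  then have "y i / x i = 1"
    using x[OF i] y[OF i] by (intro ln_eq_minus_one) auto
  then show "x i = y i"
    using x[OF i] by simp
qed

section \<open>The Sylvester recursion from a real starting value\<close>

text \<open>The index is shifted: for \<open>Q = g\<close> this is the truncated Sylvester sequence starting with
  \<open>sylv_iter g 0 = t_(g,1)\<close>.\<close>

fun sylv_iter :: "real \<Rightarrow> nat \<Rightarrow> real" where
  "sylv_iter Q 0 = Q"
| "sylv_iter Q (Suc k) = sylv_iter Q k * (sylv_iter Q k + 1)"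

lemma sylv_iter_add: "sylv_iter (sylv_iter Q j) k = sylv_iter Q (j + k)"
  by (induction k) auto

lemma sylv_iter_ge: "1 \<le> Q \<Longrightarrow> Q \<le> sylv_iter Q k"
proof (induction k)
  case (Suc k)
  then have "sylv_iter Q k * 1 \<le> sylv_iter Q k * (sylv_iter Q k + 1)"
    by (intro mult_left_mono) auto
  then have "sylv_iter Q k \<le> sylv_iter Q (Suc k)"
    by simp
  then show ?case
    using Suc by linarith
qed simp

lemma sylv_iter_ge_two: "1 \<le> Q \<Longrightarrow> 0 < k \<Longrightarrow> 2 \<le> sylv_iter Q k"
proof (cases k)
  case (Suc l)
  assume "1 \<le> Q"
  then have "1 * (1 + 1) \<le> sylv_iter Q l * (sylv_iter Q l + 1)"
    using sylv_iter_ge[of Q l] by (intro mult_mono) auto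
  then show ?thesis
    using Suc by simp
qed simp

lemma prod_sylv_iter: "0 < Q \<Longrightarrow> (\<Prod>i<k. sylv_iter Q i + 1) * Q = sylv_iter Q k"
  by (induction k) (auto simp: algebra_simps)

lemma sylv_iter_pos: "0 < Q \<Longrightarrow> 0 < sylv_iter Q k"
  by (induction k) auto

text \<open>Telescopes, since 1 / (t + 1) = 1 / t - 1 / (t (t + 1)) and t (t + 1) is the next
  value.\<close>

lemma sum_sylv_iter: "0 < Q \<Longrightarrow> (\<Sum>i<k. 1 / (sylv_iter Q i + 1)) = 1 / Q - 1 / sylv_iter Q k"
proof (induction k)
  case (Suc k)
  have "1 / (sylv_iter Q k + 1) = 1 / sylv_iter Q k - 1 / sylv_iter Q (Suc k)"
    using sylv_iter_pos[OF Suc.prems, of k]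
    by (simp add: divide_simps) (simp add: algebra_simps)?
  then show ?case
    using Suc by simp
qed simp

section \<open>Equal parts against the Sylvester partition\<close>

text \<open>The first inequality drives the induction for the second: raising m by one multiplies
  the left side by at most 2^(m+3) (m+5) Q and the right side by (t + 1)^2. The offset m + 2 leaves
  out the two smallest cases, where strictness can fail.\<close>

lemma equal_parts_le_aux:
  assumes Q: "(1::real) \<le> Q"
  shows "2 ^ (m + 3) * (real m + 5) * Q \<le> (sylv_iter Q (m + 2) + 1) ^ 2"
    and "(real (m + 4) * Q) ^ (m + 3) * Q < 2 * (sylv_iter Q (m + 2)) ^ 2"
proof -
  have t2: "sylv_iter Q 2 = Q * (Q + 1) * (Q * (Q + 1) + 1)"
    by (simp add: numeral_2_eq_2)
  have t2_ge: "6 * Q \<le> sylv_iter Q 2"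
  proof -
    have "1 * 1 \<le> Q * Q" using Q by (intro mult_mono) auto
    then have "2 * 3 \<le> (Q + 1) * (Q * (Q + 1) + 1)"
      using Q by (intro mult_mono) (auto simp: algebra_simps)
    then have "Q * (2 * 3) \<le> Q * ((Q + 1) * (Q * (Q + 1) + 1))"
      using Q by (intro mult_left_mono) auto
    then show ?thesis unfolding t2 by (simp add: algebra_simps)
  qed
  have *: "2 ^ (m + 3) * (real m + 5) * Q \<le> (sylv_iter Q (m + 2) + 1) ^ 2" for m
  proof (induction m)
    case 0
    have "(6 * Q + 1) ^ 2 \<le> (sylv_iter Q 2 + 1) ^ 2"
      using t2_ge Q by (intro power_mono) auto
    moreover have "40 * Q \<le> (6 * Q + 1) ^ 2"
    proof -
      have "Q * 1 \<le> Q * Q" using Q by (intro mult_left_mono) auto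
      moreover have "(6 * Q + 1) ^ 2 = 36 * (Q * Q) + 12 * Q + 1" by (simp add: power2_eq_square algebra_simps)
      ultimately show ?thesis using Q by linarith
    qed
    ultimately have "40 * Q \<le> (sylv_iter Q (0 + 2) + 1) ^ 2" by (simp only: add_0)
    then show ?case by simp
  next
    case (Suc m)
    let ?t = "sylv_iter Q (m + 2)"
    have t6: "6 \<le> ?t"
    proof -
      have "6 \<le> sylv_iter Q 2" using t2_ge Q by simp
      also have "\<dots> \<le> sylv_iter (sylv_iter Q 2) m"
        using \<open>6 \<le> sylv_iter Q 2\<close> by (intro sylv_iter_ge) simp
      also have "\<dots> = ?t" by (simp only: sylv_iter_add add.commute)
      finally show ?thesis .
    qed
    have "2 ^ (Suc m + 3) * (real (Suc m) + 5) * Q \<le> 4 * (2 ^ (m + 3) * (real m + 5) * Q)"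
    proof -
      define p :: real where "p = 2 ^ (m + 3)"
      have "(2::real) ^ (Suc m + 3) = 2 * p" "0 \<le> p * real m * Q" "0 \<le> p * Q"
        using Q unfolding p_def by (auto simp: power_add)
      then show ?thesis
        unfolding p_def[symmetric] by (simp add: algebra_simps)
    qed
    also have "\<dots> \<le> 4 * (?t + 1) ^ 2" using Suc by simp
    also have "\<dots> \<le> ?t ^ 2 * (?t + 1) ^ 2"
    proof -
      have "(2::real) ^ 2 \<le> ?t ^ 2" using t6 by (intro power_mono) auto
      then show ?thesis by (intro mult_right_mono) auto
    qed
    also have "\<dots> = (?t * (?t + 1)) ^ 2" by (simp add: power_mult_distrib)
    also have "\<dots> \<le> (?t * (?t + 1) + 1) ^ 2" using t6 by (intro power_mono) auto
    finally show ?case by simp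
  qed
  then show "2 ^ (m + 3) * (real m + 5) * Q \<le> (sylv_iter Q (m + 2) + 1) ^ 2" .
  show "(real (m + 4) * Q) ^ (m + 3) * Q < 2 * (sylv_iter Q (m + 2)) ^ 2"
  proof (induction m)
    case 0
    \<comment> \<open>Four equal parts: (4 Q)^3 Q against 2 t^2 with t = Q (Q + 1) (Q (Q + 1) + 1).
      The factors of t are bounded by 4 Q \<le> (Q + 1)^2 and 3 Q \<le> Q (Q + 1) + 1.\<close>
    have "32 * Q ^ 4 < (Q * (Q + 1) * (Q * (Q + 1) + 1)) ^ 2"
    proof -
      have a: "4 * Q \<le> (Q + 1) ^ 2"
        using sum_squares_bound[of Q 1] by (simp add: power2_eq_square algebra_simps)
      have "3 * Q \<le> Q * (Q + 1) + 1"
        using sum_squares_bound[of Q 1] by (simp add: power2_eq_square algebra_simps)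
      then have b: "(3 * Q) ^ 2 \<le> (Q * (Q + 1) + 1) ^ 2"
        using Q by (intro power_mono) auto
      have "Q ^ 4 * 1 \<le> Q ^ 4 * Q" using Q by (intro mult_left_mono) auto
      then have "32 * Q ^ 4 < Q ^ 2 * (4 * Q * (3 * Q) ^ 2)"
        using Q by (simp add: power_mult_distrib power_numeral_reduce algebra_simps)
      also have "\<dots> \<le> Q ^ 2 * ((Q + 1) ^ 2 * (Q * (Q + 1) + 1) ^ 2)"
        using a b Q by (intro mult_left_mono mult_mono) auto
      finally show ?thesis by (simp only: power_mult_distrib mult.assoc)
    qed
    then have "2 * (32 * Q ^ 4) < 2 * (sylv_iter Q 2) ^ 2" unfolding t2 by simp
    moreover have "(real (0 + 4) * Q) ^ (0 + 3) * Q = 2 * (32 * Q ^ 4)"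
      by (simp add: power_mult_distrib power3_eq_cube power4_eq_xxxx)
    ultimately show ?case by (simp only: add_0)
  next
    case (Suc m)
    let ?t = "sylv_iter Q (m + 2)"
    let ?r = "real (m + 4)"
    define n where "n = m + 3"
    have n: "m + 4 = Suc n" unfolding n_def by simp
    have "((?r + 1) * Q) ^ (m + 4) * Q = (?r + 1) ^ n * (Q ^ n * ((?r + 1) * Q) * Q)"
      unfolding n power_Suc power_mult_distrib by (simp only: mult_ac)
    also have "\<dots> \<le> (2 * ?r) ^ n * (Q ^ n * ((?r + 1) * Q) * Q)"
      using Q by (intro mult_right_mono power_mono) auto
    finally have "((?r + 1) * Q) ^ (m + 4) * Q \<le> ((2 * ?r) ^ (m + 3) * Q ^ (m + 3)) * ((?r + 1) * Q) * Q"
      unfolding n_def by (simp only: mult.assoc)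
    also have "\<dots> = ((?r * Q) ^ (m + 3) * Q) * (2 ^ (m + 3) * (real m + 5) * Q)"
    proof -
      have "real m + 5 = ?r + 1" by simp
      then show ?thesis by (simp only: power_mult_distrib mult_ac)
    qed
    also have "\<dots> \<le> ((?r * Q) ^ (m + 3) * Q) * (?t + 1) ^ 2"
      using *[of m] Q by (intro mult_left_mono) auto
    also have "\<dots> < (2 * ?t ^ 2) * (?t + 1) ^ 2"
    proof (intro mult_strict_right_mono)
      show "0 < (?t + 1) ^ 2" using sylv_iter_pos[of Q "m+2"] Q by simp
    qed (use Suc in auto)
    also have "\<dots> = 2 * (sylv_iter Q (Suc m + 2)) ^ 2"
    proof -
      have "sylv_iter Q (Suc m + 2) = ?t * (?t + 1)" by simp
      then show ?thesis by (simp only: power_mult_distrib mult.assoc)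
    qed
    finally have "((?r + 1) * Q) ^ (m + 4) * Q < 2 * (sylv_iter Q (Suc m + 2)) ^ 2" .
    moreover have "?r + 1 = real (Suc m + 4)" "m + 4 = Suc m + 3" by simp_all
    ultimately show ?case by metis
  qed
qed

text \<open>For M = 0 both sides are 2 Q^2. For M = 1 the difference is Q^2 (2 Q - 1) (Q - 2), which
  is negative at Q = 1 and zero at Q = 2; this is where both exceptional simplices come
  from.\<close>

lemma equal_parts_le:
  assumes Q: "(1::real) \<le> Q" and Q2: "M = 1 \<Longrightarrow> 2 \<le> Q"
  shows "(real (M + 2) * Q) ^ (M + 1) * Q \<le> 2 * (sylv_iter Q M) ^ 2"
    and "(real (M + 2) * Q) ^ (M + 1) * Q = 2 * (sylv_iter Q M) ^ 2 \<Longrightarrow> M = 0 \<or> M = 1 \<and> Q = 2"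
proof -
  consider "M = 0" | "M = 1" | m where "M = m + 2"
    by (metis One_nat_def add_2_eq_Suc' not0_implies_Suc)
  then have "(real (M + 2) * Q) ^ (M + 1) * Q \<le> 2 * (sylv_iter Q M) ^ 2 \<and>
    ((real (M + 2) * Q) ^ (M + 1) * Q = 2 * (sylv_iter Q M) ^ 2 \<longrightarrow> M = 0 \<or> M = 1 \<and> Q = 2)"
  proof cases
    case 1
    then show ?thesis by (simp add: power2_eq_square)
  next
    case 2
    have eq: "2 * (sylv_iter Q M) ^ 2 - (real (M + 2) * Q) ^ (M + 1) * Q = Q ^ 2 * ((2 * Q - 1) * (Q - 2))"
      using 2 by (simp add: power2_eq_square algebra_simps)
    have "0 \<le> Q ^ 2 * ((2 * Q - 1) * (Q - 2))" using Q2[OF 2] by simp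
    moreover have "Q = 2" if "Q ^ 2 * ((2 * Q - 1) * (Q - 2)) = 0"
      using that Q2[OF 2] by auto
    ultimately show ?thesis using eq 2 by (metis diff_ge_0_iff_ge right_minus_eq)
  next
    case 3
    have "m + 2 + 2 = m + 4" "m + 2 + 1 = m + 3" by simp_all
    then show ?thesis using equal_parts_le_aux(2)[OF Q, of m] unfolding 3 by (metis less_imp_le less_irrefl)
  qed
  then show "(real (M + 2) * Q) ^ (M + 1) * Q \<le> 2 * (sylv_iter Q M) ^ 2"
    and "(real (M + 2) * Q) ^ (M + 1) * Q = 2 * (sylv_iter Q M) ^ 2 \<Longrightarrow> M = 0 \<or> M = 1 \<and> Q = 2"
    by auto
qed

text \<open>The product has r factors but the sum r + 1 terms, so averaging raises the sum as long
  as x is not much larger than \<zeta>. With s = \<zeta>' / \<zeta> one has x = s^r \<zeta>, and the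
  claim s^r + r \<le> (r + 1) s says, after division by s - 1, that 1 + s + ... + s^(r-1) is at most
  r + 1. Hypothesis \<open>le\<close> reads s^r (r - 1) \<le> r, which is enough.\<close>

lemma merge_step:
  fixes x \<zeta> \<zeta>' :: real
  assumes r: "2 \<le> r" and pos: "0 < \<zeta>" "0 < \<zeta>'" and ge: "\<zeta> \<le> x" and le: "x * (real r - 1) \<le> real r * \<zeta>"
    and root: "\<zeta>' ^ r = x * \<zeta> ^ (r - 1)"
  shows "x + real r * \<zeta> \<le> (real r + 1) * \<zeta>'"
proof -
  define s where "s = \<zeta>' / \<zeta>"
  have \<zeta>': "\<zeta>' = s * \<zeta>" unfolding s_def using pos by simp
  have "s ^ r * \<zeta> ^ r = x * \<zeta> ^ (r - 1)" using root unfolding \<zeta>' by (simp add: power_mult_distrib)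
  moreover have "\<zeta> ^ r = \<zeta> * \<zeta> ^ (r - 1)" using r by (cases r) auto
  ultimately have x: "x = s ^ r * \<zeta>" using pos by simp
  have s_pow: "1 \<le> s ^ r" using ge pos unfolding x by simp
  have "0 < s" unfolding s_def using pos by simp
  then have s: "1 \<le> s" using s_pow r by (metis not_le power_less_one_iff less_imp_le zero_less_iff_neq_zero not_numeral_le_zero)
  have s_le: "s ^ r * (real r - 1) \<le> real r" using le pos unfolding x by simp
  have "(\<Sum>k<r. s ^ k) \<le> 1 + (real r - 1) * s ^ r"
  proof -
    obtain q where q: "r = Suc q" using r by (cases r) auto
    have "(\<Sum>k<r. s ^ k) = 1 + (\<Sum>k<q. s ^ Suc k)" unfolding q by (subst sum.lessThan_Suc_shift) simp
    also have "\<dots> \<le> 1 + (\<Sum>k<q. s ^ r)" using s q by (intro add_left_mono sum_mono power_increasing) auto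
    finally show ?thesis using q by simp
  qed
  then have "(\<Sum>k<r. s ^ k) \<le> real r + 1" using s_le by (simp add: mult.commute)
  then have "(s - 1) * (\<Sum>k<r. s ^ k) \<le> (s - 1) * (real r + 1)" using s by (intro mult_left_mono) auto
  moreover have "s ^ r - 1 = (s - 1) * (\<Sum>k<r. s ^ k)" by (rule power_diff_1_eq)
  ultimately have "s ^ r + real r \<le> (real r + 1) * s" by (simp add: algebra_simps)
  then have "(s ^ r + real r) * \<zeta> \<le> (real r + 1) * s * \<zeta>" using pos by (intro mult_right_mono) auto
  then show ?thesis unfolding x \<zeta>' by (simp add: algebra_simps)
qed

text \<open>The extremal partition 1/s_1, ..., 1/s_(n-1), 1/(2 t_n), 1/(2 t_n) of 1/Q without its
  final term, because the products to be compared have n factors.\<close>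

definition sylv_part :: "real \<Rightarrow> nat \<Rightarrow> nat \<Rightarrow> real" where
  "sylv_part Q n i = (if Suc i < n then 1 / (sylv_iter Q i + 1) else 1 / (2 * sylv_iter Q i))"

lemma sylv_part_pos: "0 < Q \<Longrightarrow> 0 < sylv_part Q n i"
  using sylv_iter_pos[of Q i] by (auto simp: sylv_part_def add_pos_pos)

lemma prod_sylv_part: "0 < Q \<Longrightarrow> k < n \<Longrightarrow> (\<Prod>i<k. sylv_part Q n i) = Q / sylv_iter Q k"
proof -
  assume Q: "0 < Q" and k: "k < n"
  have "(\<Prod>i<k. sylv_part Q n i) = (\<Prod>i<k. 1 / (sylv_iter Q i + 1))"
    using k by (intro prod.cong) (auto simp: sylv_part_def)
  also have "\<dots> = 1 / (\<Prod>i<k. sylv_iter Q i + 1)"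
    by (simp add: prod_dividef)
  also have "\<dots> = Q / sylv_iter Q k"
    unfolding prod_sylv_iter[OF Q, of k, symmetric] using Q by simp
  finally show ?thesis .
qed

lemma prod_sylv_part_full: "0 < Q \<Longrightarrow> (\<Prod>i<Suc n. sylv_part Q (Suc n) i) = Q / (2 * sylv_iter Q n ^ 2)"
  using prod_sylv_part[of Q n "Suc n"] by (simp add: sylv_part_def power2_eq_square)

lemma sum_sylv_part: "0 < Q \<Longrightarrow> k < n \<Longrightarrow> (\<Sum>i<k. sylv_part Q n i) = 1 / Q - 1 / sylv_iter Q k"
proof -
  assume Q: "0 < Q" and k: "k < n"
  have "(\<Sum>i<k. sylv_part Q n i) = (\<Sum>i<k. 1 / (sylv_iter Q i + 1))"
    using k by (intro sum.cong) (auto simp: sylv_part_def)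
  then show ?thesis
    using sum_sylv_iter[OF Q] by simp
qed

lemma prod_if_less: "p \<le> k \<Longrightarrow> (\<Prod>i<k. if i < p then f i else C) = (\<Prod>i<p. f i) * (C::real) ^ (k - p)"
proof (induction k rule: dec_induct)
  case base
  have "(\<Prod>i<p. if i < p then f i else C) = (\<Prod>i<p. f i)"
    by (intro prod.cong) auto
  then show ?case by simp
next
  case (step k)
  then show ?case by (simp add: Suc_diff_le mult_ac)
qed

lemma sum_if_less: "p \<le> k \<Longrightarrow> (\<Sum>i<k. if i < p then f i else C) = (\<Sum>i<p. f i) + real (k - p) * C"
proof (induction k rule: dec_induct)
  case base
  have "(\<Sum>i<p. if i < p then f i else C) = (\<Sum>i<p. f i)"
    by (intro sum.cong) auto
  then show ?case by simp
next
  case (step k)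
  then show ?case by (simp add: Suc_diff_le algebra_simps)
qed

text \<open>In logarithms both sides are linear in the exponent, so the inequality at exponents 0
  and M carries over to everything between.\<close>

lemma mult_power_le_interpolate:
  fixes A B x y :: real
  assumes "0 < A" "A \<le> B" "0 < x" "0 < y" and le: "A * x ^ M \<le> B * y ^ M" and k: "k \<le> M"
  shows "A * x ^ k \<le> B * y ^ k"
proof (cases "x \<le> y")
  case True
  then show ?thesis using assms by (intro mult_mono power_mono) auto
next
  case False
  have "A * x ^ k * x ^ (M - k) \<le> B * y ^ k * y ^ (M - k)"
    using le k by (simp add: mult.assoc flip: power_add)
  also have "\<dots> \<le> B * y ^ k * x ^ (M - k)"
    using assms False by (intro mult_left_mono power_mono) auto
  finally show ?thesis
    using assms by simp
qed

text \<open>The last \<open>r - 1\<close> terms of x are replaced by their geometric mean \<open>\<zeta>\<close>, counted r times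
  (the extra copy bounds the last term of the partition, which is not among the N terms). If
  \<open>r / (r - 1) \<cdot> \<zeta>\<close> does not exceed the preceding term, then giving each of the \<open>r - 1\<close> copies this
  weight keeps the sequence decreasing, so the majorization lemma applies. Otherwise
  \<open>merge_step\<close> shows that absorbing the preceding term into the block only increases the sum.\<close>

lemma sum_block_le_final:
  fixes x :: "nat \<Rightarrow> real"
  assumes Q: "1 \<le> Q" and Q2: "N = 2 \<Longrightarrow> 2 \<le> Q"
    and pos: "\<And>i. i < N \<Longrightarrow> 0 < x i" and decr: "\<And>i. Suc i < N \<Longrightarrow> x (Suc i) \<le> x i"
    and partial: "\<And>k. k \<le> N \<Longrightarrow> (\<Prod>i<k. x i) \<le> (\<Prod>i<k. sylv_part Q N i)"
    and p: "p < N" and \<zeta>: "0 < \<zeta>" and \<zeta>_pow: "\<zeta> ^ (N - p) = (\<Prod>i\<in>{p..<N}. x i)"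
    and stop: "0 < p \<Longrightarrow> real (N + 1 - p) * \<zeta> \<le> x (p - 1) * real (N - p)"
  shows "(\<Sum>i<p. x i) + real (N + 1 - p) * \<zeta> \<le> 1 / Q"
    and "(\<Sum>i<p. x i) + real (N + 1 - p) * \<zeta> = 1 / Q \<Longrightarrow>
      (\<And>k. 0 < k \<Longrightarrow> k < N \<Longrightarrow> (\<Prod>i<k. x i) < (\<Prod>i<k. sylv_part Q N i)) \<Longrightarrow>
      N = 1 \<or> N = 2 \<and> Q = 2"
proof -
  define M where "M = N - p - 1"
  have N: "N = p + Suc M" and Nn: "N = Suc (p + M)"
    using p unfolding M_def by auto
  have Qpos: "0 < Q" using Q by simp
  define t where "t = sylv_iter Q p"
  define s where "s = sylv_iter t M"
  have s: "s = sylv_iter Q (p + M)"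
    unfolding s_def t_def by (rule sylv_iter_add)
  have t: "1 \<le> t" "0 < t" and s0: "0 < s"
    using sylv_iter_ge[OF Q, of p] Q sylv_iter_pos[OF Qpos] unfolding t_def s by auto
  \<comment> \<open>At p = 0 this is the hypothesis on N = 2; at p > 0 every value of the recursion
    is at least 2 anyway.\<close>
  have t2: "2 \<le> t" if "M = 1"
    using that Q2 N sylv_iter_ge_two[OF Q, of p] unfolding t_def by (cases p) auto
  \<comment> \<open>The last M + 1 entries of \<open>sylv_part Q N\<close> have product (Q / (2
    s^2)) / (Q / t), so \<omega> is their geometric mean.\<close>
  define \<omega> where "\<omega> = root (Suc M) (t / (2 * s ^ 2))"
  have \<omega>: "0 < \<omega>"
    unfolding \<omega>_def using t s0 by simp
  have \<omega>_pow: "\<omega> ^ Suc M = t / (2 * s ^ 2)"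
    unfolding \<omega>_def using t s0 by (intro real_root_pow_pos) auto
  \<comment> \<open>Turns the wanted bound (M + 2) \<omega> \<le> 1 / t into the equal-parts
    inequality with starting value t.\<close>
  have block: "(real (M + 2) * \<omega>) ^ Suc M = (real (M + 2) * t) ^ (M + 1) * t / (2 * s ^ 2) * (1 / t) ^ Suc M"
  proof -
    have one: "t ^ Suc M * (1 / t) ^ Suc M = 1"
      using t unfolding power_mult_distrib[symmetric] by simp
    have "(real (M + 2) * t) ^ (M + 1) * t / (2 * s ^ 2) * (1 / t) ^ Suc M
      = real (M + 2) ^ Suc M * (t / (2 * s ^ 2)) * (t ^ Suc M * (1 / t) ^ Suc M)"
      by (simp only: Suc_eq_plus1 power_mult_distrib times_divide_eq_left times_divide_eq_right mult_ac)
    then show ?thesis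
      unfolding power_mult_distrib[of _ \<omega>] \<omega>_pow one by simp
  qed
  have "(real (M + 2) * t) ^ (M + 1) * t / (2 * s ^ 2) \<le> 1"
    using equal_parts_le(1)[OF t(1), of M, OF t2] s0 unfolding s_def[symmetric] by simp
  then have "(real (M + 2) * \<omega>) ^ Suc M \<le> 1 * (1 / t) ^ Suc M"
    unfolding block using t by (intro mult_right_mono) auto
  then have \<omega>_le: "real (M + 2) * \<omega> \<le> 1 / t"
    using t by (simp only: mult_1_left) (rule power_le_imp_le_base, auto)
  have \<omega>_eq: "M = 0 \<or> M = 1 \<and> t = 2" if "real (M + 2) * \<omega> = 1 / t"
  proof -
    define u where "u = (1 / t) ^ Suc M"
    have "u \<noteq> 0" unfolding u_def using t by simp
    moreover have "(real (M + 2) * t) ^ (M + 1) * t / (2 * s ^ 2) * u = u"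
      using block[unfolded that] unfolding u_def by (rule sym)
    ultimately have "(real (M + 2) * t) ^ (M + 1) * t / (2 * s ^ 2) = 1"
      by (metis mult_cancel_right1)
    then have "(real (M + 2) * t) ^ (M + 1) * t = 2 * s ^ 2"
      using s0 by (metis divide_eq_1_iff)
    then show ?thesis
      using equal_parts_le(2)[OF t(1), of M, OF t2] unfolding s_def by blast
  qed
  \<comment> \<open>Spreads M + 2 copies of the mean over the M + 1 positions of the block, so that
    sequences of length N have the sums in question.\<close>
  define c where "c = real (M + 2) / real (M + 1)"
  have c: "0 < c" unfolding c_def by simp
  define \<theta> where "\<theta> i = (if i < p then x i else c * \<zeta>)" for i
  define \<eta> where "\<eta> i = (if i < p then sylv_part Q N i else c * \<omega>)" for i
  have W: "(\<Prod>i<p. sylv_part Q N i) = Q / t"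
    unfolding t_def using prod_sylv_part[OF Qpos] p by simp
  have Xpos: "0 < (\<Prod>i<p. x i)" using pos p by (intro prod_pos) auto
  have XN: "(\<Prod>i<N. x i) = (\<Prod>i<p. x i) * \<zeta> ^ Suc M"
  proof -
    have "Suc M = N - p" using N by simp
    then show ?thesis
      using prod.atLeastLessThan_concat[of 0 p N x] p \<zeta>_pow by (simp only: lessThan_atLeast0 less_imp_le)
  qed
  have WN: "(\<Prod>i<N. sylv_part Q N i) = Q / t * \<omega> ^ Suc M"
    unfolding \<omega>_pow Nn prod_sylv_part_full[OF Qpos] s[symmetric] using t by simp
  have partial': "(\<Prod>i<k. \<theta> i) \<le> (\<Prod>i<k. \<eta> i)" if k: "k \<le> N" for k
  proof (cases "k \<le> p")
    case True
    have "(\<Prod>i<k. \<theta> i) = (\<Prod>i<k. x i)" "(\<Prod>i<k. \<eta> i) = (\<Prod>i<k. sylv_part Q N i)"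
      unfolding \<theta>_def \<eta>_def using True by (auto intro!: prod.cong)
    then show ?thesis using partial[OF k] by simp
  next
    case False
    then have pk: "p \<le> k" by simp
    \<comment> \<open>Inside the block both products are geometric, so the comparisons at k = p and
      k = N suffice.\<close>
    have "(\<Prod>i<p. x i) * \<zeta> ^ (k - p) \<le> Q / t * \<omega> ^ (k - p)"
    proof (rule mult_power_le_interpolate[OF Xpos _ \<zeta> \<omega>])
      show "(\<Prod>i<p. x i) \<le> Q / t"
        using partial[of p] p unfolding W by simp
      show "(\<Prod>i<p. x i) * \<zeta> ^ Suc M \<le> Q / t * \<omega> ^ Suc M"
        using partial[of N] unfolding XN WN by simp
      show "k - p \<le> Suc M"
        using k N by simp
    qed
    then have "c ^ (k - p) * ((\<Prod>i<p. x i) * \<zeta> ^ (k - p)) \<le> c ^ (k - p) * (Q / t * \<omega> ^ (k - p))"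
      using c by (intro mult_left_mono) auto
    then show ?thesis
      unfolding \<theta>_def \<eta>_def prod_if_less[OF pk] W by (simp add: power_mult_distrib mult_ac)
  qed
  have \<theta>_pos: "0 < \<theta> i" "0 < \<eta> i" if "i < N" for i
    unfolding \<theta>_def \<eta>_def using that pos c \<zeta> \<omega> sylv_part_pos[OF Qpos] by auto
  have \<theta>_decr: "\<theta> (Suc i) \<le> \<theta> i" if i: "Suc i < N" for i
  proof (cases "Suc i = p")
    case True
    have "c * \<zeta> \<le> x i"
      using stop True unfolding c_def N by (auto simp: field_simps)
    then show ?thesis unfolding \<theta>_def using True by auto
  next
    case False
    then show ?thesis unfolding \<theta>_def using decr[OF i] by auto
  qed
  have "(\<Sum>i<N. \<theta> i) = (\<Sum>i<p. x i) + real (M + 2) * \<zeta>"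
    unfolding \<theta>_def sum_if_less[OF less_imp_le[OF p]] c_def by (simp add: N)
  then have sum\<theta>: "(\<Sum>i<N. \<theta> i) = (\<Sum>i<p. x i) + real (N + 1 - p) * \<zeta>" by (simp add: N)
  have sum\<eta>: "(\<Sum>i<N. \<eta> i) = 1 / Q - 1 / t + real (M + 2) * \<omega>"
    unfolding \<eta>_def sum_if_less[OF less_imp_le[OF p]] c_def sum_sylv_part[OF Qpos p] t_def by (simp add: N)
  have major: "(\<Sum>i<N. \<theta> i) \<le> (\<Sum>i<N. \<eta> i)"
    using sum_le_sum_of_prod_le_prod(1)[of N \<theta> \<eta>] \<theta>_pos \<theta>_decr partial' by blast
  have major_eq: "\<theta> i = \<eta> i" if "(\<Sum>i<N. \<theta> i) = (\<Sum>i<N. \<eta> i)" "i < N" for i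
    using sum_le_sum_of_prod_le_prod(2)[of N \<theta> \<eta> i] \<theta>_pos \<theta>_decr partial' that by blast
  show "(\<Sum>i<p. x i) + real (N + 1 - p) * \<zeta> \<le> 1 / Q"
    using major \<omega>_le unfolding sum\<theta> sum\<eta> by linarith
  assume eq: "(\<Sum>i<p. x i) + real (N + 1 - p) * \<zeta> = 1 / Q"
    and strict: "\<And>k. 0 < k \<Longrightarrow> k < N \<Longrightarrow> (\<Prod>i<k. x i) < (\<Prod>i<k. sylv_part Q N i)"
  have eqs: "(\<Sum>i<N. \<theta> i) = (\<Sum>i<N. \<eta> i)" "real (M + 2) * \<omega> = 1 / t"
    using major \<omega>_le eq unfolding sum\<theta> sum\<eta> by linarith+
  \<comment> \<open>For p > 0 the first entries would agree, contradicting strictness at k =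
    1.\<close>
  have p0: "p = 0"
  proof (rule ccontr)
    assume "p \<noteq> 0"
    then have "\<theta> 0 = \<eta> 0" using major_eq[OF eqs(1)] p by simp
    then show False using strict[of 1] \<open>p \<noteq> 0\<close> p unfolding \<theta>_def \<eta>_def by simp
  qed
  then show "N = 1 \<or> N = 2 \<and> Q = 2"
    using \<omega>_eq[OF eqs(2)] N unfolding t_def by auto
qed

text \<open>Each merge extends the block by one position to the left. The process ends at p = 0 at
  the latest, where the stopping condition is vacuous; no merge lowers the sum, so the bound and its
  equality case pass back to the original block.\<close>

lemma sum_block_le:
  fixes x :: "nat \<Rightarrow> real"
  assumes Q: "1 \<le> Q" and Q2: "N = 2 \<Longrightarrow> 2 \<le> Q"
    and pos: "\<And>i. i < N \<Longrightarrow> 0 < x i" and decr: "\<And>i. Suc i < N \<Longrightarrow> x (Suc i) \<le> x i"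
    and partial: "\<And>k. k \<le> N \<Longrightarrow> (\<Prod>i<k. x i) \<le> (\<Prod>i<k. sylv_part Q N i)"
    and p: "p < N" and \<zeta>: "0 < \<zeta>" and \<zeta>_pow: "\<zeta> ^ (N - p) = (\<Prod>i\<in>{p..<N}. x i)"
    and \<zeta>_le: "0 < p \<Longrightarrow> \<zeta> \<le> x (p - 1)"
  shows "(\<Sum>i<p. x i) + real (N + 1 - p) * \<zeta> \<le> 1 / Q \<and>
    ((\<Sum>i<p. x i) + real (N + 1 - p) * \<zeta> = 1 / Q \<longrightarrow>
      (\<forall>k. 0 < k \<longrightarrow> k < N \<longrightarrow> (\<Prod>i<k. x i) < (\<Prod>i<k. sylv_part Q N i)) \<longrightarrow>
      N = 1 \<or> N = 2 \<and> Q = 2)"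
  using p \<zeta> \<zeta>_pow \<zeta>_le
proof (induction p arbitrary: \<zeta>)
  case 0
  show ?case
    using sum_block_le_final[OF Q Q2 pos decr partial 0(1-3)] by auto
next
  case (Suc p)
  show ?case
  proof (cases "real (N + 1 - Suc p) * \<zeta> \<le> x p * real (N - Suc p)")
    case True
    show ?thesis
      using sum_block_le_final[OF Q Q2 pos decr partial Suc.prems(1-3)] True by auto
  next
    case False
    define r where "r = N - p"
    have r: "2 \<le> r" "N - Suc p = r - 1" "N + 1 - Suc p = r" "N + 1 - p = r + 1"
      unfolding r_def using Suc.prems by auto
    have xp: "0 < x p" "\<zeta> \<le> x p" using pos Suc.prems by auto
    define \<zeta>' where "\<zeta>' = root r (x p * \<zeta> ^ (r - 1))"
    have \<zeta>': "0 < \<zeta>'" and \<zeta>'_pow: "\<zeta>' ^ r = x p * \<zeta> ^ (r - 1)"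
    proof -
      have "0 < x p * \<zeta> ^ (r - 1)" "0 < r"
        using xp(1) \<open>0 < \<zeta>\<close> r by auto
      then show "0 < \<zeta>'" "\<zeta>' ^ r = x p * \<zeta> ^ (r - 1)"
        unfolding \<zeta>'_def by (auto intro!: real_root_pow_pos)
    qed
    have "\<zeta>' ^ (N - p) = (\<Prod>i\<in>{p..<N}. x i)"
    proof -
      have "(\<Prod>i\<in>{p..<N}. x i) = x p * (\<Prod>i\<in>{Suc p..<N}. x i)"
        using Suc.prems(1) by (intro prod.atLeast_Suc_lessThan) simp
      also have "\<dots> = x p * \<zeta> ^ (r - 1)"
        using Suc.prems(3) unfolding r by simp
      finally show ?thesis
        using \<zeta>'_pow unfolding r_def by simp
    qed
    \<comment> \<open>The new mean averages x_p with copies of \<zeta> \<le> x_p, so it stays below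
      x_p and the invariant survives the merge.\<close>
    moreover have "\<zeta>' \<le> x (p - 1)" if "0 < p"
    proof -
      have "\<zeta>' ^ r \<le> x p * x p ^ (r - 1)"
        unfolding \<zeta>'_pow using xp Suc.prems by (intro mult_left_mono power_mono) auto
      also have "\<dots> = x p ^ r" using r by (cases r) auto
      finally have "\<zeta>' \<le> x p" using xp r power_mono_iff[of \<zeta>' "x p" r] \<zeta>' by simp
      also have "x p \<le> x (p - 1)" using decr[of "p - 1"] that Suc.prems by simp
      finally show ?thesis .
    qed
    ultimately have IH: "(\<Sum>i<p. x i) + real (N + 1 - p) * \<zeta>' \<le> 1 / Q \<and>
      ((\<Sum>i<p. x i) + real (N + 1 - p) * \<zeta>' = 1 / Q \<longrightarrow>
      (\<forall>k. 0 < k \<longrightarrow> k < N \<longrightarrow> (\<Prod>i<k. x i) < (\<Prod>i<k. sylv_part Q N i)) \<longrightarrow>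
      N = 1 \<or> N = 2 \<and> Q = 2)"
      using Suc.IH[of \<zeta>'] \<zeta>' Suc.prems(1) by simp
    have "x p + real r * \<zeta> \<le> (real r + 1) * \<zeta>'"
    proof (rule merge_step[OF r(1) Suc.prems(2) \<zeta>' xp(2) _ \<zeta>'_pow])
      have "real (r - 1) = real r - 1" using r(1) by simp
      then show "x p * (real r - 1) \<le> real r * \<zeta>" using False unfolding r by simp
    qed
    then have le: "(\<Sum>i<Suc p. x i) + real (N + 1 - Suc p) * \<zeta> \<le> (\<Sum>i<p. x i) + real (N + 1 - p) * \<zeta>'"
      unfolding r by (simp add: algebra_simps)
    show ?thesis
    proof (intro conjI impI)
      show "(\<Sum>i<Suc p. x i) + real (N + 1 - Suc p) * \<zeta> \<le> 1 / Q"
        using le IH by (meson order_trans)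
      assume "(\<Sum>i<Suc p. x i) + real (N + 1 - Suc p) * \<zeta> = 1 / Q"
        and strict: "\<forall>k. 0 < k \<longrightarrow> k < N \<longrightarrow> (\<Prod>i<k. x i) < (\<Prod>i<k. sylv_part Q N i)"
      then have "(\<Sum>i<p. x i) + real (N + 1 - p) * \<zeta>' = 1 / Q"
        using le IH by (metis order_antisym)
      then show "N = 1 \<or> N = 2 \<and> Q = 2"
        using IH strict by blast
    qed
  qed
qed

section \<open>Cutting at the last dominating index\<close>

lemma last_index_le:
  "P 0 \<Longrightarrow> \<exists>l\<le>n. P l \<and> (\<forall>k. l < k \<longrightarrow> k \<le> n \<longrightarrow> \<not> P k)" for n :: nat
proof (induction n)
  case (Suc n)
  show ?case
  proof (cases "P (Suc n)")
    case False
    obtain l where l: "l \<le> n" "P l" "\<forall>k. l < k \<longrightarrow> k \<le> n \<longrightarrow> \<not> P k"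
      using Suc by blast
    then have "\<forall>k. l < k \<longrightarrow> k \<le> Suc n \<longrightarrow> \<not> P k"
      using False by (metis le_Suc_eq)
    then show ?thesis using l by (intro exI[of _ l]) simp
  qed auto
qed simp

text \<open>After a cut at j the rest of the extremal sequence is again extremal, which allows the
  block estimate to be applied to the rest alone with a new starting value.\<close>

lemma sylv_part_shift: "sylv_part (sylv_iter Q j) n i = sylv_part Q (j + n) (j + i)"
  by (simp add: sylv_part_def sylv_iter_add)

lemma prod_lessThan_add: "(\<Prod>i<j + k. f i) = (\<Prod>i<j. f i) * (\<Prod>i<k. f (j + i :: nat))"
  by (induction k) (auto simp: mult.assoc)

lemma sum_lessThan_add: "(\<Sum>i<j + k. f i) = (\<Sum>i<j. f i) + (\<Sum>i<k. f (j + i :: nat))"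
  by (induction k) (auto simp: add.assoc)

lemma partial_prod_shift_le:
  fixes x y :: "nat \<Rightarrow> real"
  assumes "\<And>i. i < l \<Longrightarrow> 0 < y i" and "\<And>i. i < k \<Longrightarrow> 0 < x (l + i)"
    and ge: "(\<Prod>i<l. y i) \<le> (\<Prod>i<l. x i)"
  shows "(\<Prod>i<l + k. x i) \<le> (\<Prod>i<l + k. y i) \<Longrightarrow> (\<Prod>i<k. x (l + i)) \<le> (\<Prod>i<k. y (l + i))"
    and "(\<Prod>i<l + k. x i) < (\<Prod>i<l + k. y i) \<Longrightarrow> (\<Prod>i<k. x (l + i)) < (\<Prod>i<k. y (l + i))"
proof -
  have Y: "0 < (\<Prod>i<l. y i)" and x: "0 \<le> (\<Prod>i<k. x (l + i))"
    using assms by (auto intro!: prod_pos prod_nonneg less_imp_le)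
  have le: "(\<Prod>i<l. y i) * (\<Prod>i<k. x (l + i)) \<le> (\<Prod>i<l + k. x i)"
    unfolding prod_lessThan_add using ge x by (rule mult_right_mono)
  show "(\<Prod>i<k. x (l + i)) \<le> (\<Prod>i<k. y (l + i))" if "(\<Prod>i<l + k. x i) \<le> (\<Prod>i<l + k. y i)"
    using order_trans[OF le that] Y unfolding prod_lessThan_add[of y] by simp
  show "(\<Prod>i<k. x (l + i)) < (\<Prod>i<k. y (l + i))" if "(\<Prod>i<l + k. x i) < (\<Prod>i<l + k. y i)"
    using order_le_less_trans[OF le that] Y unfolding prod_lessThan_add[of y] by simp
qed

text \<open>Serves to recognize a prefix from its sum. If the product of the first j terms exceeds
  the extremal one, the tail bound, which the extremal sequence meets with equality, makes the sum
  strictly smaller. Otherwise cut at the last l < j where x dominates: induction handles the terms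
  before l, majorization those after.\<close>

lemma sum_prefix_le:
  fixes x :: "nat \<Rightarrow> real"
  assumes Q: "0 < Q" and pos: "\<And>i. i < n \<Longrightarrow> 0 < x i" and decr: "\<And>i. Suc i < n \<Longrightarrow> x (Suc i) \<le> x i"
    and tail: "\<And>k. k < n \<Longrightarrow> (\<Sum>i<k. x i) \<le> 1 / Q - (\<Prod>i<k. x i) / Q"
  shows "j < n \<Longrightarrow> (\<Sum>i<j. x i) \<le> (\<Sum>i<j. sylv_part Q n i) \<and>
    ((\<Sum>i<j. x i) = (\<Sum>i<j. sylv_part Q n i) \<longrightarrow> (\<forall>i<j. x i = sylv_part Q n i))"
proof (induction j rule: less_induct)
  case (less j)
  let ?y = "sylv_part Q n"
  have sum_y: "(\<Sum>i<j. ?y i) = 1 / Q - (\<Prod>i<j. ?y i) / Q"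
    using Q less.prems by (simp add: sum_sylv_part prod_sylv_part)
  show ?case
  proof (cases "(\<Prod>i<j. ?y i) < (\<Prod>i<j. x i)")
    case True
    then have "(\<Prod>i<j. ?y i) / Q < (\<Prod>i<j. x i) / Q" using Q by (simp add: divide_strict_right_mono)
    then show ?thesis using tail[OF less.prems] sum_y by linarith
  next
    case False
    show ?thesis
    proof (cases "j = 0")
      case True
      then show ?thesis by simp
    next
      case False': False
      obtain l where l: "l \<le> j - 1" "(\<Prod>i<l. ?y i) \<le> (\<Prod>i<l. x i)"
        and after: "\<And>k. l < k \<Longrightarrow> k \<le> j - 1 \<Longrightarrow> (\<Prod>i<k. x i) < (\<Prod>i<k. ?y i)"
        using last_index_le[of "\<lambda>l. (\<Prod>i<l. ?y i) \<le> (\<Prod>i<l. x i)" "j - 1"] by (auto simp: not_le)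
      define m where "m = j - l"
      have j: "j = l + m" and lj: "l < j" unfolding m_def using l(1) False' by auto
      have pos_part: "\<And>i. 0 < ?y i" using sylv_part_pos[OF Q] .
      have partial: "(\<Prod>i<k. x (l + i)) \<le> (\<Prod>i<k. ?y (l + i))" if "k \<le> m" for k
      proof (cases "k = 0")
        case k: False
        have "(\<Prod>i<l + k. x i) \<le> (\<Prod>i<l + k. ?y i)"
        proof (cases "k = m")
          case km: False
          have "l < l + k" "l + k \<le> j - 1" using k km that j by arith+
          then show ?thesis using after less_imp_le by blast
        qed (use False j in simp)
        then show ?thesis
          using partial_prod_shift_le(1)[of l ?y k x] l(2) pos_part pos that j less.prems by auto
      qed simp
      have block: "(\<Sum>i<m. x (l + i)) \<le> (\<Sum>i<m. ?y (l + i))"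
        using partial pos decr pos_part j less.prems
        by (intro sum_le_sum_of_prod_le_prod(1)) auto
      have block_eq: "x (l + i) = ?y (l + i)" if "(\<Sum>i<m. x (l + i)) = (\<Sum>i<m. ?y (l + i))" "i < m" for i
        using sum_le_sum_of_prod_le_prod(2)[of m "\<lambda>i. x (l + i)" "\<lambda>i. ?y (l + i)" i]
          partial pos decr pos_part j less.prems that by auto
      have IH: "(\<Sum>i<l. x i) \<le> (\<Sum>i<l. ?y i)"
        "(\<Sum>i<l. x i) = (\<Sum>i<l. ?y i) \<Longrightarrow> i < l \<Longrightarrow> x i = ?y i" for i
        using less.IH[OF lj] lj less.prems by auto
      have le: "(\<Sum>i<j. x i) \<le> (\<Sum>i<j. ?y i)"
        unfolding j sum_lessThan_add using IH(1) block by linarith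
      have "x i = ?y i" if "(\<Sum>i<j. x i) = (\<Sum>i<j. ?y i)" "i < j" for i
      proof -
        have eqs: "(\<Sum>i<l. x i) = (\<Sum>i<l. ?y i)" "(\<Sum>i<m. x (l + i)) = (\<Sum>i<m. ?y (l + i))"
          using that(1) IH(1) block unfolding j sum_lessThan_add by linarith+
        show ?thesis
          using IH(2)[OF eqs(1), of i] block_eq[OF eqs(2), of "i - l"] that(2) j
          by (cases "i < l") auto
      qed
      then show ?thesis using le by blast
    qed
  qed
qed

text \<open>The terms before the cut j sum to at most 1/Q - 1/T by the tail bound, the others to at
  most 1/T by the block estimate. As the total is 1/Q, everything is tight and only the equality
  cases of the block remain. For m = 2, T = 2 the real data do not fix the last terms; the recorded
  inequalities are what the integer argument needs later.\<close>

lemma extremal_partition_real: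
  fixes x :: "nat \<Rightarrow> real"
  assumes Q: "1 \<le> Q" and n: "0 < n" and Q2: "n = 2 \<Longrightarrow> 2 \<le> Q"
    and pos: "\<And>i. i \<le> n \<Longrightarrow> 0 < x i" and decr: "\<And>i. i < n \<Longrightarrow> x (Suc i) \<le> x i"
    and sum: "(\<Sum>i\<le>n. x i) = 1 / Q"
    and tail: "\<And>k. k \<le> n \<Longrightarrow> (\<Sum>i<k. x i) \<le> 1 / Q - (\<Prod>i<k. x i) / Q"
    and small: "(\<Prod>i<n. x i) \<le> Q / (2 * sylv_iter Q (n - 1) ^ 2)"
  shows "x n = x (n - 1) \<and>
    ((\<forall>i<n - 1. x i = 1 / (sylv_iter Q i + 1)) \<and> x n = 1 / (2 * sylv_iter Q (n - 1)) \<or>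
     2 \<le> n \<and> sylv_iter Q (n - 2) = 2 \<and> (\<forall>i<n - 2. x i = 1 / (sylv_iter Q i + 1)) \<and>
       x (n - 2) + 2 * x n = 1 / 2 \<and> x (n - 2) < 1 / 3 \<and> x (n - 2) * x n \<le> 1 / 36)"
proof -
  have Q0: "0 < Q" using Q by simp
  let ?y = "sylv_part Q n"
  have y_pos: "\<And>i. 0 < ?y i" using sylv_part_pos[OF Q0] .
  obtain j where j: "j \<le> n - 1" "(\<Prod>i<j. ?y i) \<le> (\<Prod>i<j. x i)"
    and after: "\<And>k. j < k \<Longrightarrow> k \<le> n - 1 \<Longrightarrow> (\<Prod>i<k. x i) < (\<Prod>i<k. ?y i)"
    using last_index_le[of "\<lambda>l. (\<Prod>i<l. ?y i) \<le> (\<Prod>i<l. x i)" "n - 1"] by (auto simp: not_le)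
  define m where "m = n - j"
  have nm: "n = j + m" and m: "0 < m" unfolding m_def using j n by auto
  define T where "T = sylv_iter Q j"
  have T: "1 \<le> T" "0 < T" unfolding T_def using sylv_iter_ge[OF Q, of j] Q by auto
  have T2: "2 \<le> T" if "m = 2"
  proof (cases "j = 0")
    case True
    then show ?thesis using Q2 that nm unfolding T_def by simp
  next
    case False
    then show ?thesis using sylv_iter_ge_two[OF Q, of j] unfolding T_def by simp
  qed
  have part: "sylv_part T m i = ?y (j + i)" for i
    unfolding T_def nm by (rule sylv_part_shift)
  have prod_n: "(\<Prod>i<n. x i) \<le> (\<Prod>i<n. ?y i)"
    using small prod_sylv_part_full[OF Q0, of "n - 1"] n by simp
  have partial: "(\<Prod>i<k. x (j + i)) \<le> (\<Prod>i<k. sylv_part T m i)" if "k \<le> m" for k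
  proof (cases "k = 0")
    case k: False
    have "(\<Prod>i<j + k. x i) \<le> (\<Prod>i<j + k. ?y i)"
    proof (cases "k = m")
      case km: False
      have "j < j + k" "j + k \<le> n - 1" using k km that nm by arith+
      then show ?thesis using after less_imp_le by blast
    qed (use prod_n nm in simp)
    then show ?thesis
      using partial_prod_shift_le(1)[of j ?y k x] j(2) y_pos pos that nm unfolding part by auto
  qed simp
  have partial_strict: "(\<Prod>i<k. x (j + i)) < (\<Prod>i<k. sylv_part T m i)" if "0 < k" "k < m" for k
  proof -
    have "j < j + k" "j + k \<le> n - 1" using that nm by arith+
    from after[OF this] show ?thesis
    using partial_prod_shift_le(2)[of j ?y k x] j(2) y_pos pos that nm unfolding part by auto
  qed
  have jn: "j < n" using nm m by simp
  have Yj: "(\<Prod>i<j. ?y i) / Q = 1 / T"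
    using prod_sylv_part[OF Q0 jn] Q0 unfolding T_def by simp
  define z where "z = x (n - 1)"
  have block: "(\<Sum>i<m - 1. x (j + i)) + 2 * z \<le> 1 / T \<and>
    ((\<Sum>i<m - 1. x (j + i)) + 2 * z = 1 / T \<longrightarrow> m = 1 \<or> m = 2 \<and> T = 2)"
  proof -
    have "{m - 1..<m} = {m - 1}" "m - (m - 1) = 1" "m + 1 - (m - 1) = 2" using m by auto
    moreover have "n - 1 = j + (m - 1)" using nm m by simp
    moreover have "0 < x (j + (m - 1))" using pos[of "j + (m - 1)"] nm by simp
    moreover have "x (j + (m - 1)) \<le> x (j + (m - 1 - 1))" if "0 < m - 1"
    proof -
      have "Suc (j + (m - 1 - 1)) = j + (m - 1)" "j + (m - 1 - 1) < n" using that nm by arith+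
      then show ?thesis using decr[of "j + (m - 1 - 1)"] by (simp only:)
    qed
    \<comment> \<open>The initial block is the single term z, counted a second time as an upper
      bound for x_n.\<close>
    ultimately show ?thesis
      using sum_block_le[of T m "\<lambda>i. x (j + i)" "m - 1" z, OF T(1) T2] pos decr partial partial_strict m nm
      unfolding z_def by auto
  qed
  have "(\<Sum>i\<le>n. x i) = (\<Sum>i<j + m. x i) + x n"
    unfolding nm lessThan_Suc_atMost[symmetric] by simp
  also have "(\<Sum>i<j + m. x i) = (\<Sum>i<j. x i) + (\<Sum>i<m. x (j + i))"
    by (rule sum_lessThan_add)
  also have "(\<Sum>i<m. x (j + i)) = (\<Sum>i<m - 1. x (j + i)) + z"
    unfolding z_def nm using m by (cases m) auto
  finally have split: "(\<Sum>i<j. x i) + ((\<Sum>i<m - 1. x (j + i)) + z) + x n = 1 / Q"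
    using sum by simp
  have "x n \<le> z" unfolding z_def using decr[of "n - 1"] n by simp
  moreover have "1 / T \<le> (\<Prod>i<j. x i) / Q"
    unfolding Yj[symmetric] using j(2) Q0 by (simp add: divide_right_mono)
  moreover have "(\<Sum>i<j. x i) \<le> 1 / Q - (\<Prod>i<j. x i) / Q"
    using tail[of j] nm by simp
  \<comment> \<open>The upper bounds for the three pieces add up to exactly 1/Q, so each is
    attained.\<close>
  ultimately have eqs: "x n = z" "(\<Sum>i<m - 1. x (j + i)) + 2 * z = 1 / T" "(\<Sum>i<j. x i) = 1 / Q - 1 / T"
    using block split by linarith+
  have prefix: "x i = ?y i" if "i < j" for i
  proof -
    have "(\<Sum>i<j. x i) = (\<Sum>i<j. ?y i)"
      using eqs(3) sum_sylv_part[OF Q0 jn] unfolding T_def by simp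
    moreover have "(\<Sum>i<j. x i) \<le> (\<Sum>i<j. ?y i) \<and> ((\<Sum>i<j. x i) = (\<Sum>i<j. ?y i) \<longrightarrow> (\<forall>i<j. x i = ?y i))"
      by (rule sum_prefix_le[OF Q0 pos decr tail jn]) auto
    ultimately show ?thesis using that by blast
  qed
  from block eqs(2) consider "m = 1" | "m = 2" "T = 2" by blast
  then show ?thesis
  proof cases
    case 1
    have "x i = 1 / (sylv_iter Q i + 1)" if "i < n - 1" for i
      using prefix[of i] that nm 1 unfolding sylv_part_def by simp
    moreover have "2 * z = 1 / T" using eqs(2) 1 by simp
    ultimately show ?thesis
      using eqs(1) nm 1 unfolding T_def z_def by auto
  next
    case 2
    have "x i = 1 / (sylv_iter Q i + 1)" if "i < n - 2" for i
      using prefix[of i] that nm 2 unfolding sylv_part_def by simp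
    moreover have "x j + 2 * z = 1 / 2" using eqs(2) 2 by simp
    moreover have "x j < 1 / 3"
      using partial_strict[of 1] 2 unfolding sylv_part_def by simp
    moreover have "x j * z \<le> 1 / 36"
    proof -
      have "n - 1 = j + 1" using nm 2 by simp
      then show ?thesis using partial[of 2] 2 unfolding sylv_part_def z_def by (simp add: numeral_2_eq_2)
    qed
    ultimately show ?thesis
      using eqs(1) nm 2 unfolding T_def z_def by auto
  qed
qed

section \<open>Integrality of the denominators\<close>

lemma sum_inverse_times_prod_int:
  fixes a :: "nat \<Rightarrow> nat"
  assumes "\<And>i. i < k \<Longrightarrow> 0 < a i"
  shows "\<exists>z :: int. (\<Prod>i<k. real (a i)) * (\<Sum>i<k. 1 / real (a i)) = of_int z"
  using assms
proof (induction k)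
  case (Suc k)
  then obtain z :: int where z: "(\<Prod>i<k. real (a i)) * (\<Sum>i<k. 1 / real (a i)) = of_int z"
    by auto
  have "(\<Prod>i<Suc k. real (a i)) * (\<Sum>i<Suc k. 1 / real (a i))
    = real (a k) * ((\<Prod>i<k. real (a i)) * (\<Sum>i<k. 1 / real (a i))) + (\<Prod>i<k. real (a i))"
    using Suc.prems[of k] by (simp add: algebra_simps)
  also have "\<dots> = of_int (int (a k) * z + int (\<Prod>i<k. a i))"
    unfolding z by simp
  finally show ?case by blast
qed (intro exI[of _ 0], simp)

text \<open>The remainder is positive, and multiplied by g and all the a_i it becomes an integer,
  hence at least 1.\<close>

lemma unit_fraction_remainder_ge:
  fixes a :: "nat \<Rightarrow> nat"
  assumes g: "0 < g" and a: "\<And>i. i < k \<Longrightarrow> 0 < a i" and lt: "(\<Sum>i<k. 1 / real (a i)) < 1 / real g"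
  shows "(\<Prod>i<k. 1 / real (a i)) / real g \<le> 1 / real g - (\<Sum>i<k. 1 / real (a i))"
proof -
  define P where "P = (\<Prod>i<k. real (a i))"
  have P: "0 < P" unfolding P_def using a by (intro prod_pos) auto
  obtain z :: int where z: "P * (\<Sum>i<k. 1 / real (a i)) = of_int z"
    using sum_inverse_times_prod_int[of k a] a unfolding P_def by blast
  have "P = of_int (int (\<Prod>i<k. a i))" unfolding P_def by simp
  then have eq: "real g * P * (1 / real g - (\<Sum>i<k. 1 / real (a i))) = of_int (int (\<Prod>i<k. a i) - int g * z)"
    using g z by (simp add: algebra_simps)
  have "0 < real g * P * (1 / real g - (\<Sum>i<k. 1 / real (a i)))"
    using g P lt by simp
  then have "1 \<le> real g * P * (1 / real g - (\<Sum>i<k. 1 / real (a i)))"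
    unfolding eq of_int_0_less_iff of_int_1_le_iff by simp
  then have "1 / (real g * P) \<le> 1 / real g - (\<Sum>i<k. 1 / real (a i))"
    using g P by (simp add: divide_le_eq mult.commute)
  moreover have "(\<Prod>i<k. 1 / real (a i)) / real g = 1 / (real g * P)"
    unfolding P_def by (simp add: prod_dividef)
  ultimately show ?thesis by simp
qed

lemma extremal_unit_fraction_partition:
  fixes a :: "nat \<Rightarrow> nat"
  assumes g: "1 \<le> g" and d: "2 \<le> d" and dg: "(d, g) \<noteq> (2, 1)"
    and pos: "\<And>i. i \<le> d \<Longrightarrow> 0 < a i" and incr: "\<And>i. i < d \<Longrightarrow> a i \<le> a (Suc i)"
    and sum: "(\<Sum>i\<le>d. 1 / real (a i)) = 1 / real g"
    and large: "2 * sylv_iter (real g) (d - 1) ^ 2 / real g \<le> real (\<Prod>i<d. a i)"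
  shows "(\<forall>i<d - 1. real (a i) = sylv_iter (real g) i + 1) \<and> real (a (d - 1)) = 2 * sylv_iter (real g) (d - 1)
      \<and> a d = a (d - 1)
    \<or> d = 3 \<and> g = 1 \<and> a 0 = 2 \<and> a 1 = 6 \<and> a 2 = 6 \<and> a 3 = 6
    \<or> d = 2 \<and> g = 2 \<and> a 0 = 6 \<and> a 1 = 6 \<and> a 2 = 6"
proof -
  define Q where "Q = real g"
  define x where "x i = 1 / real (a i)" for i
  have Q: "1 \<le> Q" unfolding Q_def using g by simp
  have x_pos: "0 < x i" if "i \<le> d" for i unfolding x_def using pos[OF that] by simp
  have x_decr: "x (Suc i) \<le> x i" if "i < d" for i
    unfolding x_def using incr[OF that] pos[of i] that by (simp add: frac_le)
  have x_sum: "(\<Sum>i\<le>d. x i) = 1 / Q" unfolding x_def Q_def by (rule sum)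
  have tail: "(\<Sum>i<k. x i) \<le> 1 / Q - (\<Prod>i<k. x i) / Q" if "k \<le> d" for k
  proof -
    have "(\<Sum>i<k. x i) < (\<Sum>i\<le>d. x i)"
      using that x_pos by (intro sum_strict_mono2[of _ _ k]) (auto simp: less_imp_le)
    then show ?thesis
      using unit_fraction_remainder_ge[of g k a] g pos that unfolding x_sum unfolding x_def Q_def by simp
  qed
  have small: "(\<Prod>i<d. x i) \<le> Q / (2 * sylv_iter Q (d - 1) ^ 2)"
  proof -
    have "0 < sylv_iter Q (d - 1)" using sylv_iter_pos[of Q] Q by simp
    moreover have "0 < real (\<Prod>i<d. a i)"
      unfolding of_nat_0_less_iff using pos by (intro prod_pos) auto
    ultimately have "1 / real (\<Prod>i<d. a i) \<le> 1 / (2 * sylv_iter Q (d - 1) ^ 2 / Q)"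
      using large Q unfolding Q_def[symmetric] by (intro divide_left_mono mult_pos_pos) auto
    then show ?thesis unfolding x_def by (simp add: prod_dividef)
  qed
  have Q2: "2 \<le> Q" if "d = 2" using dg that g unfolding Q_def by auto
  have iff: "x i = 1 / c \<longleftrightarrow> real (a i) = c" if "i \<le> d" "0 < c" for i c
    unfolding x_def using pos[of i] that by (auto simp: field_simps)
  have T: "0 < sylv_iter Q i" for i using sylv_iter_pos[of Q] Q by simp
  have main: "x d = x (d - 1) \<and>
    ((\<forall>i<d - 1. x i = 1 / (sylv_iter Q i + 1)) \<and> x d = 1 / (2 * sylv_iter Q (d - 1)) \<or>
     2 \<le> d \<and> sylv_iter Q (d - 2) = 2 \<and> (\<forall>i<d - 2. x i = 1 / (sylv_iter Q i + 1)) \<and>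
       x (d - 2) + 2 * x d = 1 / 2 \<and> x (d - 2) < 1 / 3 \<and> x (d - 2) * x d \<le> 1 / 36)"
    by (rule extremal_partition_real[OF Q _ Q2 x_pos x_decr x_sum tail small]) (use d in auto)
  have last: "a d = a (d - 1)"
    using main pos[of d] pos[of "d - 1"] unfolding x_def by auto
  from main consider
    (general) "\<forall>i<d - 1. x i = 1 / (sylv_iter Q i + 1)" "x (d - 1) = 1 / (2 * sylv_iter Q (d - 1))"
    | (special) "sylv_iter Q (d - 2) = 2" "\<forall>i<d - 2. x i = 1 / (sylv_iter Q i + 1)"
       "x (d - 2) + 2 * x d = 1 / 2" "x (d - 2) < 1 / 3" "x (d - 2) * x d \<le> 1 / 36"
    by metis
  then show ?thesis
  proof cases
    case general
    have "real (a i) = sylv_iter Q i + 1" if "i < d - 1" for i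
      using general(1) that iff[of i "sylv_iter Q i + 1"] T[of i] by simp
    moreover have "real (a (d - 1)) = 2 * sylv_iter Q (d - 1)"
      using general(2) iff[of "d - 1" "2 * sylv_iter Q (d - 1)"] T[of "d - 1"] by simp
    ultimately show ?thesis using last unfolding Q_def by simp
  next
    case special
    define p q where "p = a (d - 2)" and "q = a d"
    have p: "0 < p" "p \<le> q" and q: "0 < q"
      using pos[of "d - 2"] pos[of d] incr[of "d - 2"] d last unfolding p_def q_def
      by (auto simp: numeral_2_eq_2 Suc_diff_Suc)
    have "1 / real p + 2 / real q = 1 / 2" "1 / real p < 1 / 3" "1 / (real p * real q) \<le> 1 / 36"
      using special unfolding x_def p_def q_def by auto
    then have "2 * q + 4 * p = p * q" "3 < p" "36 \<le> p * q"
      using p q by (auto simp: field_simps simp flip: of_nat_add of_nat_mult of_nat_eq_iff)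
    then have pq: "2 * int q + 4 * int p = int p * int q" by (metis of_nat_add of_nat_mult of_nat_numeral)
    have "p = 6 \<and> q = 6"
    proof -
      \<comment> \<open>With 3 < p \<le> q only (4, 8) and (6, 6) are left, and 36 \<le> p q removes
        (4, 8).\<close>
      have "(int p - 2) * (int q - 4) = 8" using pq by (simp add: algebra_simps)
      moreover have "2 \<le> int p - 2" using \<open>3 < p\<close> by simp
      moreover have "2 * 5 \<le> (int p - 2) * (int q - 4)" if "2 \<le> int p - 2" "5 \<le> int q - 4"
        using that by (intro mult_mono) auto
      ultimately have "int q - 4 \<le> 4" by linarith
      then have "q \<le> 8" by simp
      then have "p \<in> {4,5,6,7,8}" "q \<in> {4,5,6,7,8}" using p \<open>3 < p\<close> by auto
      then show ?thesis using pq p \<open>36 \<le> p * q\<close> by auto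
    qed
    \<comment> \<open>The value 2 occurs either as the start itself, for g = 2, or as 1 (1 + 1) in
      the first step from g = 1.\<close>
    moreover have "d = 2 \<and> g = 2 \<or> d = 3 \<and> g = 1 \<and> a 0 = 2"
    proof (cases "d - 2")
      case 0
      then show ?thesis using special(1) d unfolding Q_def by simp
    next
      case (Suc k)
      define t where "t = sylv_iter Q k"
      have "Q \<le> t" "1 \<le> t" using sylv_iter_ge[OF Q, of k] Q unfolding t_def by auto
      moreover have "t * (t + 1) = 2" using special(1) Suc unfolding t_def by simp
      then have "(t - 1) * (t + 2) = 0" by (simp add: algebra_simps)
      ultimately have "t = 1" "Q = 1" using Q by auto
      then have "k = 0" using sylv_iter_ge_two[OF Q, of k] unfolding t_def by (cases "k = 0") auto
      then have "d = 3" using Suc by simp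
      moreover have "g = 1" using \<open>Q = 1\<close> unfolding Q_def by simp
      moreover have "real (a 0) = 2"
        using special(2) iff[of 0 2] Suc \<open>Q = 1\<close> by simp
      ultimately show ?thesis by simp
    qed
    moreover have "d - 1 = 2 - 1 \<or> d - 1 = 3 - 1" using calculation by auto
    ultimately show ?thesis using last unfolding p_def q_def by auto
  qed
qed

section \<open>Simplices and normalized volume\<close>

lemma mult_mat_vec_index:
  "A \<in> carrier_mat m n \<Longrightarrow> dim_vec v = n \<Longrightarrow> i < m \<Longrightarrow> (A *\<^sub>v v) $ i = (\<Sum>j<n. A $$ (i, j) * v $ j)"
  by (auto simp: scalar_prod_def lessThan_atLeast0 intro!: sum.cong)

lemma mult_mat_index:
  "A \<in> carrier_mat m k \<Longrightarrow> B \<in> carrier_mat k n \<Longrightarrow> i < m \<Longrightarrow> j < n \<Longrightarrow>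
    (A * B) $$ (i, j) = (\<Sum>l<k. A $$ (i, l) * B $$ (l, j))"
  by (auto simp: times_mat_def scalar_prod_def lessThan_atLeast0 intro!: sum.cong)

lemma conv_cols_iff:
  assumes P: "P \<in> carrier_mat d n"
  shows "x \<in> conv_cols P \<longleftrightarrow> dim_vec x = d \<and> (\<exists>l. (\<forall>j<n. 0 \<le> l j) \<and> (\<Sum>j<n. l j) = 1 \<and>
    (\<forall>i<d. x $ i = (\<Sum>j<n. P $$ (i, j) * l j)))"
proof
  assume "x \<in> conv_cols P"
  then obtain l where l: "x = P *\<^sub>v l" "dim_vec l = n" "\<forall>j<n. l $ j \<ge> 0" "(\<Sum>j<n. l $ j) = 1"
    unfolding conv_cols_def using P by auto
  then show "dim_vec x = d \<and> (\<exists>l. (\<forall>j<n. 0 \<le> l j) \<and> (\<Sum>j<n. l j) = 1 \<and>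
    (\<forall>i<d. x $ i = (\<Sum>j<n. P $$ (i, j) * l j)))"
    using P mult_mat_vec_index[OF P l(2)] by (intro conjI exI[of _ "\<lambda>j. l $ j"]) auto
next
  assume "dim_vec x = d \<and> (\<exists>l. (\<forall>j<n. 0 \<le> l j) \<and> (\<Sum>j<n. l j) = 1 \<and>
    (\<forall>i<d. x $ i = (\<Sum>j<n. P $$ (i, j) * l j)))"
  then obtain l where d: "dim_vec x = d" and l: "\<forall>j<n. 0 \<le> l j" "(\<Sum>j<n. l j) = 1"
    "\<forall>i<d. x $ i = (\<Sum>j<n. P $$ (i, j) * l j)" by auto
  have "x = P *\<^sub>v vec n l"
    using d l(3) P mult_mat_vec_index[OF P, of "vec n l"] by (intro eq_vecI) auto
  then show "x \<in> conv_cols P"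
    unfolding conv_cols_def using l P by (intro CollectI exI[of _ "vec n l"]) auto
qed

lemma aff_indep_colsD:
  assumes P: "P \<in> carrier_mat d n" and indep: "aff_indep_cols P"
    and l: "(\<Sum>j<n. l j) = 0" "\<And>i. i < d \<Longrightarrow> (\<Sum>j<n. P $$ (i, j) * l j) = 0" and j: "j < n"
  shows "l j = 0"
proof -
  have "P *\<^sub>v vec n l = 0\<^sub>v d"
    using l(2) P mult_mat_vec_index[OF P, of "vec n l"] by (intro eq_vecI) auto
  then have "vec n l = 0\<^sub>v n"
    using indep l(1) P unfolding aff_indep_cols_def by auto
  then show ?thesis using j by (metis index_vec index_zero_vec(1))
qed

lemma aff_indep_colsI:
  assumes P: "P \<in> carrier_mat d n"
    and *: "\<And>l j. (\<Sum>j<n. l j) = 0 \<Longrightarrow> (\<And>i. i < d \<Longrightarrow> (\<Sum>j<n. P $$ (i, j) * l j) = 0) \<Longrightarrow> j < n \<Longrightarrow> l j = 0"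
  shows "aff_indep_cols P"
  unfolding aff_indep_cols_def
proof (intro allI impI)
  fix l :: "rat vec"
  assume l: "dim_vec l = dim_col P \<and> (\<Sum>j<dim_col P. l $ j) = 0 \<and> P *\<^sub>v l = 0\<^sub>v (dim_row P)"
  have "l $ j = 0" if "j < n" for j
  proof (rule *[of "\<lambda>j. l $ j", OF _ _ that])
    show "(\<Sum>j<n. P $$ (i, j) * l $ j) = 0" if "i < d" for i
      using l P mult_mat_vec_index[OF P, of l i] that by auto
  qed (use l P in auto)
  then show "l = 0\<^sub>v (dim_col P)"
    using l P by (intro eq_vecI) auto
qed

lemma sum_mult_delta: "(j :: nat) < n \<Longrightarrow> (\<Sum>k<n. f k * (if k = j then 1 else 0)) = (f j :: 'a :: comm_semiring_1)"
proof -
  assume j: "j < n"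
  have "(\<Sum>k<n. f k * (if k = j then 1 else 0)) = (\<Sum>k<n. if k = j then f k else 0)"
    by (intro sum.cong) auto
  then show ?thesis using j by simp
qed

lemma col_mem_conv_cols:
  assumes P: "P \<in> carrier_mat d n" and j: "j < n"
  shows "col P j \<in> conv_cols P"
  unfolding conv_cols_iff[OF P]
  using P j by (intro conjI exI[of _ "\<lambda>k. if k = j then 1 else 0"]) (auto simp: sum_mult_delta)

text \<open>Vertices are extreme points. Write column j of P through the columns of R and those
  through the columns of P again; affine independence makes the composed coefficients the j-th unit
  vector. A column of R used with positive coefficient can then involve no column of P except the
  j-th.\<close>

lemma vertex_mem_cols:
  assumes P: "P \<in> carrier_mat d n" and R: "R \<in> carrier_mat d n" and indep: "aff_indep_cols P"
    and eq: "conv_cols P = conv_cols R" and j: "j < n"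
  shows "\<exists>i<n. col P j = col R i"
proof -
  have "col P j \<in> conv_cols R" using col_mem_conv_cols[OF P j] eq by simp
  then obtain l where l: "\<forall>i<n. 0 \<le> l i" "(\<Sum>i<n. l i) = 1"
    "\<forall>r<d. P $$ (r, j) = (\<Sum>i<n. R $$ (r, i) * l i)"
    unfolding conv_cols_iff[OF R] using P j by auto
  have "\<exists>m. (\<forall>k<n. 0 \<le> m k) \<and> (\<Sum>k<n. m k) = 1 \<and> (\<forall>r<d. R $$ (r, i) = (\<Sum>k<n. P $$ (r, k) * m k))"
    if "i < n" for i
    using col_mem_conv_cols[OF R that] R that unfolding eq[symmetric] conv_cols_iff[OF P] by auto
  then obtain m where m: "\<And>i k. i < n \<Longrightarrow> k < n \<Longrightarrow> 0 \<le> m i k" "\<And>i. i < n \<Longrightarrow> (\<Sum>k<n. m i k) = 1"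
    "\<And>i r. i < n \<Longrightarrow> r < d \<Longrightarrow> R $$ (r, i) = (\<Sum>k<n. P $$ (r, k) * m i k)"
    by metis
  let ?v = "\<lambda>k. (\<Sum>i<n. l i * m i k) - (if k = j then 1 else 0)"
  have zero: "?v k = 0" if "k < n" for k
  proof (rule aff_indep_colsD[OF P indep _ _ that])
    have "(\<Sum>k<n. \<Sum>i<n. l i * m i k) = (\<Sum>i<n. l i * (\<Sum>k<n. m i k))"
      unfolding sum_distrib_left by (rule sum.swap)
    also have "\<dots> = 1" using m(2) l(2) by simp
    finally show "(\<Sum>k<n. ?v k) = 0" using j by (simp add: sum_subtractf)
  next
    fix r assume r: "r < d"
    have "(\<Sum>k<n. P $$ (r, k) * ?v k) = (\<Sum>k<n. P $$ (r, k) * (\<Sum>i<n. l i * m i k)) - P $$ (r, j)"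
      using sum_mult_delta[OF j, of "\<lambda>k. P $$ (r, k)"] by (simp add: right_diff_distrib sum_subtractf)
    also have "(\<Sum>k<n. P $$ (r, k) * (\<Sum>i<n. l i * m i k)) = (\<Sum>i<n. (\<Sum>k<n. P $$ (r, k) * m i k) * l i)"
      unfolding sum_distrib_left sum_distrib_right by (subst sum.swap) (simp add: mult_ac)
    also have "\<dots> = P $$ (r, j)"
      using l(3) m(3) r by simp
    finally show "(\<Sum>k<n. P $$ (r, k) * ?v k) = 0" by simp
  qed
  obtain i where i: "i < n" "0 < l i"
    using l by (metis (no_types, lifting) lessThan_iff less_eq_rat_def sum.neutral zero_neq_one)
  have mik: "m i k = 0" if k: "k < n" "k \<noteq> j" for k
  proof -
    have "(\<Sum>i<n. l i * m i k) = 0" using zero[OF k(1)] k by simp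
    then have "\<forall>i\<in>{..<n}. l i * m i k = 0"
      using k l(1) m(1) by (subst (asm) sum_nonneg_eq_0_iff) auto
    then have "l i * m i k = 0" using i(1) by blast
    then show ?thesis using i(2) by simp
  qed
  have mij: "m i k = (if k = j then 1 else 0)" if "k < n" for k
  proof -
    have "(\<Sum>k<n. m i k) = (\<Sum>k<n. m i j * (if k = j then 1 else 0))"
      using mik by (intro sum.cong) auto
    then have "m i j = 1" using m(2)[OF i(1)] j by (simp add: sum_mult_delta)
    then show ?thesis using mik[OF that] by auto
  qed
  have "R $$ (r, i) = P $$ (r, j)" if "r < d" for r
    using m(3)[OF i(1) that] mij j by (simp add: sum_mult_delta)
  then have "col P j = col R i" using P R i j by (intro eq_vecI) auto
  then show ?thesis using i by blast
qed

section \<open>Volume as a homogenized determinant\<close>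

text \<open>Homogenization of the columns. With c = 1 the determinant is that of the edge vectors; c
  = g is needed for G, since the pairings of G and P are off by -g from a diagonal matrix.\<close>

definition aug :: "'a :: comm_ring_1 \<Rightarrow> 'a mat \<Rightarrow> 'a mat" where
  "aug c P = mat (Suc (dim_row P)) (dim_col P) (\<lambda>(i, j). if i = 0 then c else P $$ (i - 1, j))"

lemma aug_carrier: "P \<in> carrier_mat d n \<Longrightarrow> aug c P \<in> carrier_mat (Suc d) n"
  unfolding aug_def by auto

lemma aug_index:
  "P \<in> carrier_mat d n \<Longrightarrow> j < n \<Longrightarrow> aug c P $$ (0, j) = c"
  "P \<in> carrier_mat d n \<Longrightarrow> i < d \<Longrightarrow> j < n \<Longrightarrow> aug c P $$ (Suc i, j) = P $$ (i, j)"
  unfolding aug_def by auto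

text \<open>Multiplication by T subtracts column 0 from the others and leaves the top row (1, 0,
  ..., 0), along which the determinant is expanded.\<close>

lemma det_aug:
  fixes P :: "'a :: idom mat"
  assumes P: "P \<in> carrier_mat d (Suc d)"
  shows "det (aug 1 P) = det (mat d d (\<lambda>(i, j). P $$ (i, j + 1) - P $$ (i, 0)))"
proof -
  define T :: "'a mat" where "T = mat (Suc d) (Suc d) (\<lambda>(i, j). if i = j then 1 else if i = 0 then - 1 else 0)"
  have T: "T \<in> carrier_mat (Suc d) (Suc d)" unfolding T_def by simp
  have A: "aug 1 P \<in> carrier_mat (Suc d) (Suc d)" by (rule aug_carrier[OF P])
  have "det T = prod_list (diag_mat T)"
    by (rule det_upper_triangular[OF _ T]) (auto simp: T_def)
  also have "diag_mat T = map (\<lambda>i. 1) [0..<Suc d]"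
    unfolding diag_mat_def T_def by (intro map_cong) auto
  also have "prod_list \<dots> = 1" by (simp add: map_replicate_const del: upt_Suc)
  finally have detT: "det T = 1" .
  define M where "M = aug 1 P * T"
  have M: "M \<in> carrier_mat (Suc d) (Suc d)" unfolding M_def using A T by simp
  have M_index: "M $$ (i, j) = (if j = 0 then aug 1 P $$ (i, 0) else aug 1 P $$ (i, j) - aug 1 P $$ (i, 0))"
    if "i < Suc d" "j < Suc d" for i j
  proof -
    have "M $$ (i, j) = (\<Sum>k<Suc d. aug 1 P $$ (i, k) * T $$ (k, j))"
      unfolding M_def by (rule mult_mat_index[OF A T that])
    also have "\<dots> = (\<Sum>k<Suc d. aug 1 P $$ (i, k) * (if k = j then 1 else 0)
        + aug 1 P $$ (i, k) * (if k = 0 then 1 else 0) * (if j = 0 then 0 else - 1))"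
      using that by (intro sum.cong) (auto simp: T_def)
    also have "\<dots> = (if j = 0 then aug 1 P $$ (i, 0) else aug 1 P $$ (i, j) - aug 1 P $$ (i, 0))"
      unfolding sum.distrib sum_distrib_right[symmetric] using that sum_mult_delta[of j "Suc d" "\<lambda>k. aug 1 P $$ (i, k)"]
        sum_mult_delta[of 0 "Suc d" "\<lambda>k. aug 1 P $$ (i, k)"] by (auto simp del: sum.lessThan_Suc)
    finally show ?thesis .
  qed
  have "det (aug 1 P) = det M" unfolding M_def det_mult[OF A T] detT by simp
  also have "\<dots> = (\<Sum>j<Suc d. M $$ (0, j) * cofactor M 0 j)"
    by (rule laplace_expansion_row[OF M]) simp
  also have "\<dots> = (\<Sum>j<Suc d. cofactor M 0 j * (if j = 0 then 1 else 0))"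
    using M_index[of 0] aug_index(1)[OF P] by (intro sum.cong) auto
  also have "\<dots> = cofactor M 0 0" by (rule sum_mult_delta) simp
  also have "\<dots> = det (mat_delete M 0 0)" unfolding cofactor_def by simp
  also have "mat_delete M 0 0 = mat d d (\<lambda>(i, j). P $$ (i, j + 1) - P $$ (i, 0))"
    using M by (intro eq_matI) (auto simp: mat_delete_def M_index aug_index[OF P])
  finally show ?thesis .
qed

lemma norm_vol_eq_det_aug:
  "P \<in> carrier_mat d (Suc d) \<Longrightarrow> norm_vol P = \<bar>det (aug 1 P)\<bar>"
  unfolding norm_vol_def by (subst det_aug) auto

lemma aug_mult_vec_index:
  assumes P: "P \<in> carrier_mat d n" and v: "dim_vec v = n"
  shows "(aug c P *\<^sub>v v) $ 0 = c * (\<Sum>j<n. v $ j)"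
    and "i < d \<Longrightarrow> (aug c P *\<^sub>v v) $ Suc i = (\<Sum>j<n. P $$ (i, j) * v $ j)"
proof -
  have "(aug c P *\<^sub>v v) $ 0 = (\<Sum>j<n. aug c P $$ (0, j) * v $ j)"
    by (rule mult_mat_vec_index[OF aug_carrier[OF P] v]) simp
  also have "\<dots> = (\<Sum>j<n. c * v $ j)"
    using aug_index(1)[OF P] by (intro sum.cong) auto
  finally show "(aug c P *\<^sub>v v) $ 0 = c * (\<Sum>j<n. v $ j)"
    by (simp add: sum_distrib_left)
next
  assume i: "i < d"
  have "(aug c P *\<^sub>v v) $ Suc i = (\<Sum>j<n. aug c P $$ (Suc i, j) * v $ j)"
    by (rule mult_mat_vec_index[OF aug_carrier[OF P] v]) (use i in simp)
  also have "\<dots> = (\<Sum>j<n. P $$ (i, j) * v $ j)"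
    using aug_index(2)[OF P i] by (intro sum.cong) auto
  finally show "(aug c P *\<^sub>v v) $ Suc i = (\<Sum>j<n. P $$ (i, j) * v $ j)" .
qed

lemma aff_indep_cols_iff_det:
  assumes P: "P \<in> carrier_mat d (Suc d)"
  shows "aff_indep_cols P \<longleftrightarrow> det (aug 1 P) \<noteq> 0"
proof
  assume indep: "aff_indep_cols P"
  show "det (aug 1 P) \<noteq> 0"
  proof
    assume "det (aug 1 P) = 0"
    then obtain v where v: "v \<in> carrier_vec (Suc d)" "v \<noteq> 0\<^sub>v (Suc d)" "aug 1 P *\<^sub>v v = 0\<^sub>v (Suc d)"
      using det_0_iff_vec_prod_zero_field[OF aug_carrier[OF P]] by auto
    have dim: "dim_vec v = Suc d" using v by simp
    have "v $ j = 0" if "j < Suc d" for j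
    proof (rule aff_indep_colsD[OF P indep _ _ that, of "\<lambda>j. v $ j"])
      show "(\<Sum>j<Suc d. v $ j) = 0"
        using aug_mult_vec_index(1)[OF P dim, of 1] v(3) by simp
      show "(\<Sum>j<Suc d. P $$ (i, j) * v $ j) = 0" if "i < d" for i
        using aug_mult_vec_index(2)[OF P dim that, of 1] v(3) that by simp
    qed
    then show False using v by (metis dim eq_vecI index_zero_vec)
  qed
next
  assume det: "det (aug 1 P) \<noteq> 0"
  show "aff_indep_cols P"
  proof (rule aff_indep_colsI[OF P])
    fix l j
    assume l: "(\<Sum>j<Suc d. l j) = 0" "\<And>i. i < d \<Longrightarrow> (\<Sum>j<Suc d. P $$ (i, j) * l j) = 0" and j: "j < Suc d"
    let ?v = "vec (Suc d) l"
    have "(aug 1 P *\<^sub>v ?v) $ i = 0" if "i < Suc d" for i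
      using aug_mult_vec_index[OF P, where v = ?v and c = 1] l that by (cases i) auto
    then have "aug 1 P *\<^sub>v ?v = 0\<^sub>v (Suc d)"
      using aug_carrier[OF P, of 1] by (intro eq_vecI) auto
    moreover have "?v \<in> carrier_vec (Suc d)" by simp
    ultimately have "?v = 0\<^sub>v (Suc d)"
      using det det_0_iff_vec_prod_zero_field[OF aug_carrier[OF P], of 1] by blast
    then show "l j = 0" using j by (metis index_vec index_zero_vec(1))
  qed
qed

lemma abs_det_permute_cols:
  fixes A :: "'a :: linordered_idom mat"
  assumes A: "A \<in> carrier_mat n n" and p: "p permutes {0..<n}"
  shows "\<bar>det (mat n n (\<lambda>(i, j). A $$ (i, p j)))\<bar> = \<bar>det A\<bar>"
proof -
  have "mat n n (\<lambda>(i, j). A $$ (i, p j)) = (mat n n (\<lambda>(i, j). A\<^sup>T $$ (p i, j)))\<^sup>T"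
    using A permutes_in_image[OF p] by (intro eq_matI) auto
  then have "det (mat n n (\<lambda>(i, j). A $$ (i, p j))) = det (mat n n (\<lambda>(i, j). A\<^sup>T $$ (p i, j)))"
    by (metis det_transpose mat_carrier)
  also have "\<dots> = signof p * det A"
    using A p by (subst det_permute_rows) (auto simp: det_transpose)
  finally show ?thesis by (simp add: abs_mult sign_def)
qed

lemma norm_vol_permute_cols:
  assumes P: "P \<in> carrier_mat d (Suc d)" and p: "p permutes {0..<Suc d}"
  shows "norm_vol (mat d (Suc d) (\<lambda>(i, j). P $$ (i, p j))) = norm_vol P"
proof -
  have "aug 1 (mat d (Suc d) (\<lambda>(i, j). P $$ (i, p j))) = mat (Suc d) (Suc d) (\<lambda>(i, j). aug 1 P $$ (i, p j))"
    using P permutes_in_image[OF p] by (intro eq_matI) (auto simp: aug_def)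
  then show ?thesis
    using abs_det_permute_cols[OF aug_carrier[OF P] p] P by (simp add: norm_vol_eq_det_aug[of _ d])
qed

text \<open>\<open>norm_vol\<close> depends on a matrix whereas \<open>iso\<close> speaks of point
  sets; matching the vertices shows that two matrices with the same hull differ by a column
  permutation.\<close>

lemma norm_vol_cong_conv_cols:
  assumes P: "P \<in> carrier_mat d (Suc d)" and R: "R \<in> carrier_mat d (Suc d)" and indep: "aff_indep_cols P"
    and eq: "conv_cols P = conv_cols R"
  shows "norm_vol P = norm_vol R"
proof -
  let ?n = "Suc d"
  obtain f where f: "\<And>j. j < ?n \<Longrightarrow> f j < ?n" "\<And>j. j < ?n \<Longrightarrow> col P j = col R (f j)"
    using vertex_mem_cols[OF P R indep eq] by metis
  have "inj_on f {0..<?n}"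
  proof (rule inj_onI)
    fix i j assume ij: "i \<in> {0..<?n}" "j \<in> {0..<?n}" and "f i = f j"
    then have "col P i = col P j" using f by simp
    then have same: "P $$ (r, i) = P $$ (r, j)" if "r < d" for r
      using P ij that by (metis atLeastLessThan_iff carrier_matD index_col)
    show "i = j"
    proof (rule ccontr)
      assume "i \<noteq> j"
      have "(if i = i then 1 else 0) - (if i = j then 1 else 0) = (0 :: rat)"
        by (rule aff_indep_colsD[OF P indep, of "\<lambda>k. (if k = i then 1 else 0) - (if k = j then 1 else 0)"])
          (use ij same in \<open>auto simp: right_diff_distrib sum_subtractf sum_mult_delta simp del: sum.lessThan_Suc\<close>)
      then show False using \<open>i \<noteq> j\<close> by simp
    qed
  qed
  then have "bij_betw f {0..<?n} {0..<?n}"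
    using f(1) by (intro bij_betw_imageI endo_inj_surj) auto
  define p where "p j = (if j < ?n then f j else j)" for j
  have "bij_betw p {0..<?n} {0..<?n}"
    using \<open>bij_betw f _ _\<close> by (rule bij_betw_cong[THEN iffD1, rotated]) (auto simp: p_def)
  then have p: "p permutes {0..<?n}"
    by (rule bij_imp_permutes) (auto simp: p_def)
  have "P $$ (i, j) = R $$ (i, p j)" if "i < d" "j < ?n" for i j
    using f(2)[OF that(2)] f(1)[OF that(2)] P R that unfolding p_def by (metis carrier_matD index_col)
  then have "P = mat d ?n (\<lambda>(i, j). R $$ (i, p j))"
    using P by (intro eq_matI) auto
  then show ?thesis using norm_vol_permute_cols[OF R p] by simp
qed

lemma norm_vol_mult:
  assumes U: "U \<in> carrier_mat d d" and P: "P \<in> carrier_mat d (Suc d)"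
  shows "norm_vol (U * P) = \<bar>det U\<bar> * norm_vol P"
proof -
  have "mat d d (\<lambda>(i, j). (U * P) $$ (i, j + 1) - (U * P) $$ (i, 0)) =
      U * mat d d (\<lambda>(i, j). P $$ (i, j + 1) - P $$ (i, 0))" (is "_ = _ * ?E")
  proof (rule eq_matI)
    fix i j assume ij: "i < dim_row (U * ?E)" "j < dim_col (U * ?E)"
    then have "i < d" "j < d" using U by auto
    then show "mat d d (\<lambda>(i, j). (U * P) $$ (i, j + 1) - (U * P) $$ (i, 0)) $$ (i, j) = (U * ?E) $$ (i, j)"
      using mult_mat_index[OF U P, of i] mult_mat_index[OF U, of ?E d i j]
      by (simp add: sum_subtractf right_diff_distrib)
  qed (use U in auto)
  then show ?thesis
    unfolding norm_vol_def using U P by (simp add: det_mult[of _ d] abs_mult)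
qed

lemma image_conv_cols:
  assumes U: "U \<in> carrier_mat d d" and P: "P \<in> carrier_mat d n"
  shows "(\<lambda>x. U *\<^sub>v x) ` conv_cols P = conv_cols (U * P)"
proof -
  have eq: "U * P *\<^sub>v l = U *\<^sub>v (P *\<^sub>v l)" if "dim_vec l = n" for l
    by (rule assoc_mult_mat_vec[OF U P]) (rule carrier_vecI[OF that])
  have dims: "dim_col P = n" "dim_col (U * P) = n" using P by auto
  show ?thesis
  proof (intro equalityI subsetI)
    fix y assume "y \<in> (\<lambda>x. U *\<^sub>v x) ` conv_cols P"
    then obtain l where "y = U *\<^sub>v (P *\<^sub>v l)" "dim_vec l = n" "\<forall>j<n. l $ j \<ge> 0" "(\<Sum>j<n. l $ j) = 1"
      unfolding conv_cols_def dims by blast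
    then show "y \<in> conv_cols (U * P)"
      unfolding conv_cols_def dims by (intro CollectI exI[of _ l]) (simp add: eq)
  next
    fix y assume "y \<in> conv_cols (U * P)"
    then obtain l where "y = U * P *\<^sub>v l" "dim_vec l = n" "\<forall>j<n. l $ j \<ge> 0" "(\<Sum>j<n. l $ j) = 1"
      unfolding conv_cols_def dims by blast
    then show "y \<in> (\<lambda>x. U *\<^sub>v x) ` conv_cols P"
      unfolding conv_cols_def dims
      by (intro image_eqI[of _ _ "P *\<^sub>v l"] CollectI exI[of _ l]) (simp_all add: eq)
  qed
qed

lemma iso_imp_norm_vol_eq:
  assumes P: "is_simplex_mat d P" and Q: "Q \<in> carrier_mat d (Suc d)"
    and iso: "iso d (conv_cols P) (conv_cols Q)"
  shows "norm_vol P = norm_vol Q"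
proof -
  have P': "P \<in> carrier_mat d (Suc d)" "aff_indep_cols P"
    using P unfolding is_simplex_mat_def by auto
  obtain U :: "int mat" where U: "U \<in> carrier_mat d d" "det U = 1 \<or> det U = - 1"
    "(\<lambda>x. ratm U *\<^sub>v x) ` conv_cols P = conv_cols Q"
    using iso unfolding iso_def by auto
  have rU: "ratm U \<in> carrier_mat d d" using U unfolding ratm_def by simp
  have "\<bar>det (ratm U)\<bar> = 1" using U unfolding ratm_def by auto
  then have vol: "norm_vol (ratm U * P) = norm_vol P"
    using norm_vol_mult[OF rU P'(1)] by simp
  have UP: "ratm U * P \<in> carrier_mat d (Suc d)" using rU P' by simp
  have "aff_indep_cols (ratm U * P)"
    using vol P' UP by (simp add: aff_indep_cols_iff_det[of _ d] norm_vol_eq_det_aug[of _ d])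
  then have "norm_vol (ratm U * P) = norm_vol Q"
    using U(3) image_conv_cols[OF rU P'(1)] by (intro norm_vol_cong_conv_cols[OF UP Q]) auto
  then show ?thesis using vol by simp
qed

text \<open>Cramer's rule: \<beta> solves \<open>aug 1 P\<close> \<beta> = e_0, so \<beta>_d times
  the determinant is, up to sign, the minor without top row and last column. It makes volumes
  computable whenever the first d columns are triangular.\<close>

lemma norm_vol_times_weight:
  assumes P: "P \<in> carrier_mat d (Suc d)" and bary: "(\<Sum>j<Suc d. \<beta> j) = 1" "\<And>i. i < d \<Longrightarrow> (\<Sum>j<Suc d. P $$ (i, j) * \<beta> j) = 0"
  shows "norm_vol P * \<bar>\<beta> d\<bar> = \<bar>det (mat d d (\<lambda>(i, j). P $$ (i, j)))\<bar>"
proof -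
  let ?A = "aug 1 P" and ?b = "vec (Suc d) \<beta>"
  have A: "?A \<in> carrier_mat (Suc d) (Suc d)" by (rule aug_carrier[OF P])
  have b: "?b \<in> carrier_vec (Suc d)" by simp
  have adj: "adj_mat ?A \<in> carrier_mat (Suc d) (Suc d)" using adj_mat[OF A] by simp
  have Ab: "(?A *\<^sub>v ?b) $ i = (if i = 0 then 1 else 0)" if "i < Suc d" for i
    using aug_mult_vec_index[OF P, where v = ?b and c = 1] bary that by (cases i) auto
  have "det ?A \<cdot>\<^sub>v ?b = adj_mat ?A * ?A *\<^sub>v ?b"
  proof (rule eq_vecI)
    fix i assume "i < dim_vec (adj_mat ?A * ?A *\<^sub>v ?b)"
    then have i: "i < Suc d" using adj by simp
    have "(adj_mat ?A * ?A *\<^sub>v ?b) $ i = (\<Sum>j<Suc d. (det ?A \<cdot>\<^sub>m 1\<^sub>m (Suc d)) $$ (i, j) * ?b $ j)"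
      unfolding adj_mat(3)[OF A] using i by (intro mult_mat_vec_index) auto
    also have "\<dots> = (\<Sum>j<Suc d. det ?A * \<beta> j * (if j = i then 1 else 0))"
      using i by (intro sum.cong) auto
    also have "\<dots> = det ?A * \<beta> i" using i by (rule sum_mult_delta)
    finally show "(det ?A \<cdot>\<^sub>v ?b) $ i = (adj_mat ?A * ?A *\<^sub>v ?b) $ i" using i by simp
  qed (use adj in simp)
  also have "\<dots> = adj_mat ?A *\<^sub>v (?A *\<^sub>v ?b)" by (rule assoc_mult_mat_vec[OF adj A b])
  finally have eq: "det ?A \<cdot>\<^sub>v ?b = adj_mat ?A *\<^sub>v (?A *\<^sub>v ?b)" .
  have "det ?A * \<beta> d = (det ?A \<cdot>\<^sub>v ?b) $ d" by simp
  also have "\<dots> = (\<Sum>j<Suc d. adj_mat ?A $$ (d, j) * (?A *\<^sub>v ?b) $ j)"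
    unfolding eq using A by (intro mult_mat_vec_index[OF adj]) auto
  also have "\<dots> = (\<Sum>j<Suc d. adj_mat ?A $$ (d, j) * (if j = 0 then 1 else 0))"
    using Ab by (intro sum.cong) auto
  also have "\<dots> = adj_mat ?A $$ (d, 0)" by (rule sum_mult_delta) simp
  also have "\<dots> = cofactor ?A 0 d" unfolding adj_mat_def using A by simp
  also have "mat_delete ?A 0 d = mat d d (\<lambda>(i, j). P $$ (i, j))"
    using P by (intro eq_matI) (auto simp: mat_delete_def aug_def)
  then have "cofactor ?A 0 d = (- 1) ^ d * det (mat d d (\<lambda>(i, j). P $$ (i, j)))" unfolding cofactor_def by simp
  finally have "\<bar>det ?A * \<beta> d\<bar> = \<bar>det (mat d d (\<lambda>(i, j). P $$ (i, j)))\<bar>"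
    by (simp add: abs_mult power_abs)
  then show ?thesis unfolding norm_vol_eq_det_aug[OF P] by (simp add: abs_mult)
qed

section \<open>The dual simplex\<close>

text \<open>The columns of G are g times the vertices of the dual simplex, and \<open>g / a_j\<close> are the
  barycentric coordinates of the origin.\<close>

locale fano_dual_pair =
  fixes d g :: nat and P G :: "int mat" and a :: "nat \<Rightarrow> nat"
  assumes P: "P \<in> carrier_mat d (Suc d)" and G: "G \<in> carrier_mat d (Suc d)"
    and g: "0 < g" and a: "\<And>j. j < Suc d \<Longrightarrow> 0 < a j"
    and sum_inverse: "(\<Sum>j<Suc d. 1 / rat_of_nat (a j)) = 1 / rat_of_nat g"
    and bary_P: "\<And>i. i < d \<Longrightarrow> (\<Sum>j<Suc d. rat_of_int (P $$ (i, j)) / rat_of_nat (a j)) = 0"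
    and bary_G: "\<And>i. i < d \<Longrightarrow> (\<Sum>j<Suc d. rat_of_int (G $$ (i, j)) / rat_of_nat (a j)) = 0"
    and pairing: "\<And>j k. j < Suc d \<Longrightarrow> k < Suc d \<Longrightarrow>
      (\<Sum>i<d. G $$ (i, j) * P $$ (i, k)) = (if j = k then int (a j) else 0) - int g"
    and prim: "\<And>j. j < Suc d \<Longrightarrow> primitive (col P j)"

lemma inverse_matrix_obtain:
  fixes A :: "'a :: field mat"
  assumes A: "A \<in> carrier_mat n n" and det: "det A \<noteq> 0"
  obtains B where "B \<in> carrier_mat n n" "A * B = 1\<^sub>m n" "B * A = 1\<^sub>m n"
proof
  let ?B = "(1 / det A) \<cdot>\<^sub>m adj_mat A"
  note adj = adj_mat[OF A]
  show "?B \<in> carrier_mat n n" using adj(1) by simp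
  have "A * ?B = (1 / det A) \<cdot>\<^sub>m (A * adj_mat A)"
    by (rule mult_smult_distrib[OF A adj(1)])
  also have "\<dots> = 1\<^sub>m n"
    unfolding adj(2) using det by (intro eq_matI) auto
  finally show "A * ?B = 1\<^sub>m n" .
  have "?B * A = (1 / det A) \<cdot>\<^sub>m (adj_mat A * A)"
    by (rule mult_smult_assoc_mat[OF adj(1) A])
  also have "\<dots> = 1\<^sub>m n"
    unfolding adj(3) using det by (intro eq_matI) auto
  finally show "?B * A = 1\<^sub>m n" .
qed

text \<open>Read off the inverse of \<open>aug 1 R\<close>: its i-th row holds the coefficients of
  the affine function \<beta>_i + \<langle>w_i, x\<rangle> that gives the i-th barycentric
  coordinate of x.\<close>

lemma affine_coordinates_obtain:
  assumes R: "R \<in> carrier_mat d (Suc d)" and indep: "aff_indep_cols R"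
  obtains \<beta> :: "nat \<Rightarrow> rat" and w :: "nat \<Rightarrow> nat \<Rightarrow> rat" where
    "\<And>i j. i < Suc d \<Longrightarrow> j < Suc d \<Longrightarrow> \<beta> i + (\<Sum>k<d. w i k * R $$ (k, j)) = (if i = j then 1 else 0)"
    "(\<Sum>i<Suc d. \<beta> i) = 1"
    "\<And>k. k < d \<Longrightarrow> (\<Sum>i<Suc d. w i k) = 0"
    "\<And>r. r < d \<Longrightarrow> (\<Sum>i<Suc d. R $$ (r, i) * \<beta> i) = 0"
    "\<And>r k. r < d \<Longrightarrow> k < d \<Longrightarrow> (\<Sum>i<Suc d. R $$ (r, i) * w i k) = (if r = k then 1 else 0)"
proof -
  let ?A = "aug 1 R"
  have A: "?A \<in> carrier_mat (Suc d) (Suc d)" by (rule aug_carrier[OF R])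
  obtain B where B: "B \<in> carrier_mat (Suc d) (Suc d)" "?A * B = 1\<^sub>m (Suc d)" "B * ?A = 1\<^sub>m (Suc d)"
    using inverse_matrix_obtain[OF A] indep unfolding aff_indep_cols_iff_det[OF R] by metis
  have BA: "(\<Sum>l<Suc d. B $$ (i, l) * ?A $$ (l, j)) = (if i = j then 1 else 0)" if "i < Suc d" "j < Suc d" for i j
    using mult_mat_index[OF B(1) A that] that unfolding B(3) by simp
  have AB: "(\<Sum>l<Suc d. ?A $$ (i, l) * B $$ (l, j)) = (if i = j then 1 else 0)" if "i < Suc d" "j < Suc d" for i j
    using mult_mat_index[OF A B(1) that] that unfolding B(2) by simp
  have A0: "?A $$ (0, j) = 1" if "j < Suc d" for j by (rule aug_index(1)[OF R that])
  have AS: "?A $$ (Suc i, j) = R $$ (i, j)" if "i < d" "j < Suc d" for i j by (rule aug_index(2)[OF R that])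
  show thesis
  proof (rule that[of "\<lambda>i. B $$ (i, 0)" "\<lambda>i k. B $$ (i, Suc k)"])
    fix i j assume ij: "i < Suc d" "j < Suc d"
    have "(\<Sum>l<Suc d. B $$ (i, l) * ?A $$ (l, j)) = B $$ (i, 0) + (\<Sum>k<d. B $$ (i, Suc k) * R $$ (k, j))"
      unfolding sum.lessThan_Suc_shift using A0[OF ij(2)] AS[OF _ ij(2)] by simp
    then show "B $$ (i, 0) + (\<Sum>k<d. B $$ (i, Suc k) * R $$ (k, j)) = (if i = j then 1 else 0)"
      using BA[OF ij] by simp
  next
    have "(\<Sum>l<Suc d. ?A $$ (0, l) * B $$ (l, j)) = (\<Sum>i<Suc d. B $$ (i, j))" for j
      using A0 by (intro sum.cong) auto
    then show "(\<Sum>i<Suc d. B $$ (i, 0)) = 1" "k < d \<Longrightarrow> (\<Sum>i<Suc d. B $$ (i, Suc k)) = 0" for k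
      using AB[of 0 0] AB[of 0 "Suc k"] by auto
  next
    fix r assume r: "r < d"
    have *: "(\<Sum>l<Suc d. ?A $$ (Suc r, l) * B $$ (l, j)) = (\<Sum>i<Suc d. R $$ (r, i) * B $$ (i, j))" for j
      using AS[OF r] by (intro sum.cong) auto
    show "(\<Sum>i<Suc d. R $$ (r, i) * B $$ (i, 0)) = 0"
      using AB[of "Suc r" 0] r unfolding * by simp
    show "(\<Sum>i<Suc d. R $$ (r, i) * B $$ (i, Suc k)) = (if r = k then 1 else 0)" if "k < d" for k
      using AB[of "Suc r" "Suc k"] r that unfolding * by simp
  qed
qed

text \<open>A point -\<epsilon> v_i close to the origin lies in the simplex, and its i-th coordinate
  \<beta> - \<epsilon> (1 - \<beta>) is nonnegative, so \<beta> (1 + \<epsilon>) \<ge> \<epsilon> >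
  0.\<close>

lemma barycentric_pos_of_interior:
  assumes R: "R \<in> carrier_mat d n"
    and coord: "\<And>j. j < n \<Longrightarrow> \<beta> + (\<Sum>k<d. w k * R $$ (k, j)) = (if i = j then 1 else 0)"
    and int: "in_interior d (0\<^sub>v d) (conv_cols R)" and i: "i < n"
  shows "0 < \<beta>"
proof -
  obtain e where e: "0 < e" "\<And>y. dim_vec y = d \<Longrightarrow> (\<Sum>k<d. (y $ k - 0\<^sub>v d $ k)\<^sup>2) < e \<Longrightarrow> y \<in> conv_cols R"
    using int unfolding in_interior_def by blast
  define s where "s = (\<Sum>k<d. (R $$ (k, i))\<^sup>2)"
  have s: "0 \<le> s" unfolding s_def by (intro sum_nonneg) auto
  \<comment> \<open>Then \<epsilon>^2 \<le> \<epsilon> \<le> e / (s + 1), which keeps the squared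
    length \<epsilon>^2 s below e.\<close>
  define \<epsilon> where "\<epsilon> = min 1 (e / (s + 1))"
  have \<epsilon>: "0 < \<epsilon>" "\<epsilon> \<le> 1" "\<epsilon> \<le> e / (s + 1)" unfolding \<epsilon>_def using e s by auto
  let ?y = "vec d (\<lambda>k. - \<epsilon> * R $$ (k, i))"
  have "(\<Sum>k<d. (?y $ k - 0\<^sub>v d $ k)\<^sup>2) = \<epsilon> * \<epsilon> * s"
    unfolding s_def sum_distrib_left by (intro sum.cong) (auto simp: power2_eq_square)
  also have "\<dots> \<le> 1 * (e / (s + 1)) * s"
    using \<epsilon> s by (intro mult_right_mono mult_mono) auto
  also have "\<dots> < e" using e(1) s by (simp add: field_simps)
  finally have "?y \<in> conv_cols R" by (intro e(2)) auto
  then obtain m where m: "\<forall>j<n. 0 \<le> m j" "(\<Sum>j<n. m j) = 1"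
    "\<forall>r<d. - \<epsilon> * R $$ (r, i) = (\<Sum>j<n. R $$ (r, j) * m j)"
    unfolding conv_cols_iff[OF R] by auto
  have "m i = (\<Sum>j<n. m j * (if j = i then 1 else 0))" using sum_mult_delta[OF i, of m] by simp
  also have "\<dots> = (\<Sum>j<n. m j * (\<beta> + (\<Sum>k<d. w k * R $$ (k, j))))"
    using coord by (intro sum.cong) auto
  also have "\<dots> = \<beta> * (\<Sum>j<n. m j) + (\<Sum>j<n. \<Sum>k<d. w k * (R $$ (k, j) * m j))"
    by (simp add: sum.distrib sum_distrib_left sum_distrib_right algebra_simps)
  also have "(\<Sum>j<n. \<Sum>k<d. w k * (R $$ (k, j) * m j)) = (\<Sum>k<d. w k * (\<Sum>j<n. R $$ (k, j) * m j))"
    unfolding sum_distrib_left by (rule sum.swap)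
  also have "\<dots> = (\<Sum>k<d. w k * (- \<epsilon> * R $$ (k, i)))"
    using m(3) by (intro sum.cong) auto
  also have "\<dots> = - \<epsilon> * (\<Sum>k<d. w k * R $$ (k, i))"
    unfolding sum_distrib_left by (intro sum.cong) auto
  also have "(\<Sum>k<d. w k * R $$ (k, i)) = 1 - \<beta>" using coord[OF i] by simp
  finally have "m i + \<epsilon> = \<beta> * (1 + \<epsilon>)" using m(2) by (simp add: algebra_simps)
  moreover have "0 < m i + \<epsilon>" using m(1) i \<epsilon> by (simp add: add_nonneg_pos)
  ultimately have "0 < \<beta> * (1 + \<epsilon>)" by simp
  then show ?thesis using \<epsilon>(1) by (simp add: zero_less_mult_iff)
qed

section \<open>Denominators and lattice multiples\<close>

lemma common_denominator:
  assumes "finite S"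
  shows "\<exists>k::nat. 0 < k \<and> (\<forall>x\<in>S. rat_of_nat k * x \<in> \<int>)"
  using assms
proof (induction S)
  case (insert x S)
  then obtain k :: nat where k: "0 < k" "\<forall>x\<in>S. rat_of_nat k * x \<in> \<int>" by blast
  obtain p q where pq: "quotient_of x = (p, q)" by fastforce
  have x: "x = of_int p / of_int q" and q: "0 < q"
    using quotient_of_div[OF pq] quotient_of_denom_pos[OF pq] by auto
  have "rat_of_nat (k * nat q) = of_nat k * of_int q" using q by simp
  then have "rat_of_nat (k * nat q) * x = of_int (int k * p)" unfolding x using q by simp
  then have "rat_of_nat (k * nat q) * x \<in> \<int>" by (metis Ints_of_int)
  moreover have "rat_of_nat (k * nat q) * y \<in> \<int>" if "y \<in> S" for y
  proof -
    have "rat_of_nat (k * nat q) * y = of_int q * (of_nat k * y)" using q by simp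
    then show ?thesis using k(2) that by (metis Ints_mult Ints_of_int)
  qed
  ultimately show ?case using k q by (intro exI[of _ "k * nat q"]) auto
qed (auto intro: exI[of _ 1])

lemma ratm_of_Ints:
  assumes "M \<in> carrier_mat d n" and "\<And>i j. i < d \<Longrightarrow> j < n \<Longrightarrow> M $$ (i, j) \<in> \<int>"
  shows "\<exists>F \<in> carrier_mat d n. ratm F = M"
proof (intro bexI[of _ "mat d n (\<lambda>ij. \<lfloor>M $$ ij\<rfloor>)"])
  show "ratm (mat d n (\<lambda>ij. \<lfloor>M $$ ij\<rfloor>)) = M"
    unfolding ratm_def using assms by (intro eq_matI) auto
qed simp

lemma scale_set_conv_cols:
  assumes M: "M \<in> carrier_mat d n"
  shows "scale_set c (conv_cols M) = conv_cols (c \<cdot>\<^sub>m M)"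
proof (intro equalityI subsetI)
  have cM: "c \<cdot>\<^sub>m M \<in> carrier_mat d n" using M by simp
  fix y
  assume "y \<in> scale_set c (conv_cols M)"
  then obtain x where x: "x \<in> conv_cols M" "y = c \<cdot>\<^sub>v x" unfolding scale_set_def by blast
  then obtain l where l: "dim_vec x = d" "\<forall>j<n. 0 \<le> l j" "(\<Sum>j<n. l j) = 1"
    "\<forall>i<d. x $ i = (\<Sum>j<n. M $$ (i, j) * l j)" unfolding conv_cols_iff[OF M] by blast
  then show "y \<in> conv_cols (c \<cdot>\<^sub>m M)"
    unfolding conv_cols_iff[OF cM] x using M
    by (intro conjI exI[of _ l]) (auto simp: sum_distrib_left mult_ac)
next
  have cM: "c \<cdot>\<^sub>m M \<in> carrier_mat d n" using M by simp
  fix y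
  assume "y \<in> conv_cols (c \<cdot>\<^sub>m M)"
  then obtain l where l: "dim_vec y = d" "\<forall>j<n. 0 \<le> l j" "(\<Sum>j<n. l j) = 1"
    "\<forall>i<d. y $ i = (\<Sum>j<n. (c \<cdot>\<^sub>m M) $$ (i, j) * l j)" unfolding conv_cols_iff[OF cM] by blast
  let ?x = "vec d (\<lambda>i. \<Sum>j<n. M $$ (i, j) * l j)"
  have "?x \<in> conv_cols M" unfolding conv_cols_iff[OF M] using l by auto
  moreover have "y = c \<cdot>\<^sub>v ?x"
    using l M by (intro eq_vecI) (auto simp: sum_distrib_left mult_ac)
  ultimately show "y \<in> scale_set c (conv_cols M)" unfolding scale_set_def by blast
qed

lemma aff_indep_cols_smult:
  assumes M: "M \<in> carrier_mat d n" and indep: "aff_indep_cols M" and c: "c \<noteq> 0"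
  shows "aff_indep_cols (c \<cdot>\<^sub>m M)"
proof (rule aff_indep_colsI)
  show "c \<cdot>\<^sub>m M \<in> carrier_mat d n" using M by simp
  fix l j assume l: "(\<Sum>j<n. l j) = 0" "\<And>i. i < d \<Longrightarrow> (\<Sum>j<n. (c \<cdot>\<^sub>m M) $$ (i, j) * l j) = 0" and j: "j < n"
  show "l j = 0"
  proof (rule aff_indep_colsD[OF M indep l(1) _ j])
    fix i assume i: "i < d"
    have "(\<Sum>j<n. (c \<cdot>\<^sub>m M) $$ (i, j) * l j) = c * (\<Sum>j<n. M $$ (i, j) * l j)"
      unfolding sum_distrib_left using M i by (intro sum.cong) (auto simp: mult_ac)
    then show "(\<Sum>j<n. M $$ (i, j) * l j) = 0" using l(2)[OF i] c by simp
  qed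
qed

lemma gQ_lattice_simplex:
  assumes "\<exists>k>0. lattice_simplex d (scale_set (of_nat k) S)"
  shows "lattice_simplex d (scale_set (of_nat (gQ d S)) S)"
  using LeastI_ex[OF assms] unfolding gQ_def by blast

lemma gQ_eq_one:
  assumes S: "lattice_simplex d S"
  shows "gQ d S = 1"
proof -
  have "scale_set 1 S = S" unfolding scale_set_def by simp
  then show ?thesis
    unfolding gQ_def using S by (intro Least_equality) auto
qed

text \<open>A dual vector u has barycentric coordinates \<beta>_j (\<langle>u, v_j\<rangle> + 1)
  with respect to the columns of M, and the dual inequalities are their nonnegativity. Conversely,
  points with coordinates m and l pair to the sum of m_i l_i / \<beta>_i, minus 1.\<close>

lemma dual_conv_cols:
  assumes R: "R \<in> carrier_mat d (Suc d)" and M: "M \<in> carrier_mat d (Suc d)"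
    and \<beta>: "\<And>i. i < Suc d \<Longrightarrow> 0 < \<beta> i"
    and pair: "\<And>i j. i < Suc d \<Longrightarrow> j < Suc d \<Longrightarrow>
      (\<Sum>k<d. M $$ (k, i) * R $$ (k, j)) = (if i = j then 1 / \<beta> i else 0) - 1"
    and bary: "(\<Sum>i<Suc d. \<beta> i) = 1" "\<And>r. r < d \<Longrightarrow> (\<Sum>i<Suc d. R $$ (r, i) * \<beta> i) = 0"
    and baryM: "\<And>k. k < d \<Longrightarrow> (\<Sum>i<Suc d. M $$ (k, i) * \<beta> i) = 0"
    and inv: "\<And>r k. r < d \<Longrightarrow> k < d \<Longrightarrow> (\<Sum>i<Suc d. R $$ (r, i) * (M $$ (k, i) * \<beta> i)) = (if r = k then 1 else 0)"
  shows "dual d (conv_cols R) = conv_cols M" and "aff_indep_cols M"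
proof -
  let ?n = "Suc d"
  show "dual d (conv_cols R) = conv_cols M"
  proof (intro equalityI subsetI)
    fix u assume u: "u \<in> dual d (conv_cols R)"
    then have dim: "dim_vec u = d" and ge: "\<And>v. v \<in> conv_cols R \<Longrightarrow> - 1 \<le> u \<bullet> v"
      unfolding dual_def by auto
    define c where "c j = (\<Sum>k<d. u $ k * R $$ (k, j))" for j
    have c: "- 1 \<le> c j" if "j < ?n" for j
    proof -
      have "u \<bullet> col R j = c j"
        unfolding c_def scalar_prod_def lessThan_atLeast0 using R that by (intro sum.cong) auto
      then show ?thesis using ge[OF col_mem_conv_cols[OF R that]] by simp
    qed
    define m where "m j = \<beta> j * (c j + 1)" for j
    have m_nonneg: "\<forall>j<?n. 0 \<le> m j"
    proof (intro allI impI)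
      fix j assume j: "j < ?n"
      have "0 \<le> c j + 1" using c[OF j] by linarith
      then show "0 \<le> m j" unfolding m_def using \<beta>[OF j] by simp
    qed
    have "(\<Sum>j<?n. \<beta> j * c j) = (\<Sum>j<?n. \<Sum>k<d. u $ k * (R $$ (k, j) * \<beta> j))"
      unfolding c_def sum_distrib_left by (intro sum.cong) (auto simp: mult_ac)
    also have "\<dots> = (\<Sum>k<d. u $ k * (\<Sum>j<?n. R $$ (k, j) * \<beta> j))"
      unfolding sum_distrib_left by (rule sum.swap)
    also have "\<dots> = 0" using bary(2) by simp
    finally have m_sum: "(\<Sum>j<?n. m j) = 1"
      unfolding m_def using bary(1) by (simp add: distrib_left sum.distrib del: sum.lessThan_Suc)
    have "u $ k = (\<Sum>j<?n. M $$ (k, j) * m j)" if k: "k < d" for k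
    proof -
      have "(\<Sum>j<?n. M $$ (k, j) * m j) = (\<Sum>j<?n. (M $$ (k, j) * \<beta> j) * c j) + (\<Sum>j<?n. M $$ (k, j) * \<beta> j)"
        unfolding m_def sum.distrib[symmetric] by (intro sum.cong) (auto simp: algebra_simps)
      also have "(\<Sum>j<?n. (M $$ (k, j) * \<beta> j) * c j) = (\<Sum>j<?n. \<Sum>r<d. u $ r * (R $$ (r, j) * (M $$ (k, j) * \<beta> j)))"
        unfolding c_def sum_distrib_left by (intro sum.cong) (auto simp: mult_ac)
      also have "\<dots> = (\<Sum>r<d. u $ r * (\<Sum>j<?n. R $$ (r, j) * (M $$ (k, j) * \<beta> j)))"
        unfolding sum_distrib_left by (rule sum.swap)
      also have "\<dots> = (\<Sum>r<d. u $ r * (if r = k then 1 else 0))"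
        using inv k by (intro sum.cong) auto
      also have "\<dots> = u $ k" by (rule sum_mult_delta[OF k])
      finally show ?thesis using baryM[OF k] by simp
    qed
    then show "u \<in> conv_cols M"
      unfolding conv_cols_iff[OF M] using dim m_nonneg m_sum by blast
  next
    fix u assume "u \<in> conv_cols M"
    then obtain m where u: "dim_vec u = d" and m: "\<forall>j<?n. 0 \<le> m j" "(\<Sum>j<?n. m j) = 1"
      "\<forall>k<d. u $ k = (\<Sum>j<?n. M $$ (k, j) * m j)"
      unfolding conv_cols_iff[OF M] by blast
    have "- 1 \<le> u \<bullet> v" if v_mem: "v \<in> conv_cols R" for v
    proof -
      obtain l where v: "dim_vec v = d" and l: "\<forall>j<?n. 0 \<le> l j" "(\<Sum>j<?n. l j) = 1"
        "\<forall>k<d. v $ k = (\<Sum>j<?n. R $$ (k, j) * l j)"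
        using v_mem unfolding conv_cols_iff[OF R] by blast
      have "u \<bullet> v = (\<Sum>k<d. (\<Sum>i<?n. M $$ (k, i) * m i) * (\<Sum>j<?n. R $$ (k, j) * l j))"
        unfolding scalar_prod_def v lessThan_atLeast0[symmetric] using m(3) l(3) by (intro sum.cong) auto
      also have "\<dots> = (\<Sum>k<d. \<Sum>i<?n. \<Sum>j<?n. m i * l j * (M $$ (k, i) * R $$ (k, j)))"
        unfolding sum_product by (intro sum.cong refl) (simp add: mult_ac)
      also have "\<dots> = (\<Sum>i<?n. \<Sum>k<d. \<Sum>j<?n. m i * l j * (M $$ (k, i) * R $$ (k, j)))"
        by (rule sum.swap)
      also have "\<dots> = (\<Sum>i<?n. \<Sum>j<?n. m i * l j * (\<Sum>k<d. M $$ (k, i) * R $$ (k, j)))"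
        unfolding sum_distrib_left by (rule sum.cong[OF refl], rule sum.swap)
      also have "\<dots> = (\<Sum>i<?n. \<Sum>j<?n. m i * l j / \<beta> i * (if j = i then 1 else 0) - m i * l j)"
        using pair by (intro sum.cong refl) (auto simp: right_diff_distrib)
      also have "\<dots> = (\<Sum>i<?n. m i * l i / \<beta> i) - (\<Sum>i<?n. m i) * (\<Sum>j<?n. l j)"
        unfolding sum_subtractf sum_product
        by (intro arg_cong2[of _ _ _ _ "(-)"] sum.cong refl) (rule sum_mult_delta, simp)
      also have "\<dots> \<ge> - 1"
      proof -
        have "0 \<le> (\<Sum>i<?n. m i * l i / \<beta> i)"
          using m(1) l(1) \<beta> by (intro sum_nonneg) (auto simp: less_imp_le)
        then show ?thesis using m(2) l(2) by simp
      qed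
      finally show ?thesis .
    qed
    then show "u \<in> dual d (conv_cols R)" unfolding dual_def using u by auto
  qed
  show "aff_indep_cols M"
  proof (rule aff_indep_colsI[OF M])
    fix l j
    assume l: "(\<Sum>j<?n. l j) = 0" "\<And>k. k < d \<Longrightarrow> (\<Sum>j<?n. M $$ (k, j) * l j) = 0" and j: "j < ?n"
    have "0 = (\<Sum>k<d. R $$ (k, j) * (\<Sum>i<?n. M $$ (k, i) * l i))" using l(2) by simp
    also have "\<dots> = (\<Sum>k<d. \<Sum>i<?n. l i * (M $$ (k, i) * R $$ (k, j)))"
      unfolding sum_distrib_left by (intro sum.cong refl) (simp add: mult_ac)
    also have "\<dots> = (\<Sum>i<?n. l i * (\<Sum>k<d. M $$ (k, i) * R $$ (k, j)))"
      unfolding sum_distrib_left by (rule sum.swap)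
    also have "\<dots> = (\<Sum>i<?n. l i / \<beta> i * (if i = j then 1 else 0) - l i)"
      using pair j by (intro sum.cong refl) (auto simp: right_diff_distrib)
    also have "\<dots> = l j / \<beta> j"
      unfolding sum_subtractf l(1) sum_mult_delta[OF j] by simp
    finally show "l j = 0" using \<beta>[OF j] by simp
  qed
qed

lemma fano_simplex_dual_pair:
  assumes fano: "fano_simplex d P" and g: "gorenstein_index d (Delta P) = g" "0 < g"
  shows "\<exists>G a. fano_dual_pair d g P G a"
proof -
  let ?n = "Suc d"
  define R where "R = ratm P"
  have R: "R \<in> carrier_mat d ?n" and indep: "aff_indep_cols R" and int: "in_interior d (0\<^sub>v d) (conv_cols R)"
    and prim: "\<And>j. j < ?n \<Longrightarrow> primitive (col P j)"
    using fano unfolding fano_simplex_def is_simplex_mat_def Delta_def R_def by auto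
  have P: "P \<in> carrier_mat d ?n" using R unfolding R_def ratm_def by auto
  have RP: "R $$ (i, j) = of_int (P $$ (i, j))" if "i < d" "j < ?n" for i j
    unfolding R_def ratm_def using P that by simp
  obtain \<beta> w where co: "\<And>i j. i < ?n \<Longrightarrow> j < ?n \<Longrightarrow> \<beta> i + (\<Sum>k<d. w i k * R $$ (k, j)) = (if i = j then 1 else 0)"
    "(\<Sum>i<?n. \<beta> i) = 1"
    "\<And>k. k < d \<Longrightarrow> (\<Sum>i<?n. w i k) = 0"
    "\<And>r. r < d \<Longrightarrow> (\<Sum>i<?n. R $$ (r, i) * \<beta> i) = 0"
    "\<And>r k. r < d \<Longrightarrow> k < d \<Longrightarrow> (\<Sum>i<?n. R $$ (r, i) * w i k) = (if r = k then 1 else 0)"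
    by (rule affine_coordinates_obtain[OF R indep]) (rule that, assumption+)
  have \<beta>: "0 < \<beta> i" if "i < ?n" for i
    by (rule barycentric_pos_of_interior[OF R co(1)[OF that] int that])
  define M where "M = mat d ?n (\<lambda>(k, i). w i k / \<beta> i)"
  have M: "M \<in> carrier_mat d ?n" unfolding M_def by simp
  have M_index: "M $$ (k, i) = w i k / \<beta> i" if "k < d" "i < ?n" for k i
    unfolding M_def using that by simp
  have M\<beta>: "M $$ (k, i) * \<beta> i = w i k" if "k < d" "i < ?n" for k i
    using M_index[OF that] \<beta>[OF that(2)] by simp
  have pair: "(\<Sum>k<d. M $$ (k, i) * R $$ (k, j)) = (if i = j then 1 / \<beta> i else 0) - 1"
    if "i < ?n" "j < ?n" for i j
  proof -
    have "(\<Sum>k<d. M $$ (k, i) * R $$ (k, j)) = (\<Sum>k<d. w i k * R $$ (k, j)) / \<beta> i"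
      unfolding sum_divide_distrib using M_index that by (intro sum.cong) auto
    also have "(\<Sum>k<d. w i k * R $$ (k, j)) = (if i = j then 1 else 0) - \<beta> i"
      using co(1)[OF that] by (simp add: algebra_simps)
    finally show ?thesis using \<beta>[OF that(1)] by (auto simp: diff_divide_distrib)
  qed
  have baryM: "(\<Sum>i<?n. M $$ (k, i) * \<beta> i) = 0" if "k < d" for k
    using co(3)[OF that] M\<beta>[OF that] by (simp del: sum.lessThan_Suc)
  have inv: "(\<Sum>i<?n. R $$ (r, i) * (M $$ (k, i) * \<beta> i)) = (if r = k then 1 else 0)" if "r < d" "k < d" for r k
    using co(5)[OF that] M\<beta>[OF that(2)] by (simp del: sum.lessThan_Suc)
  note dual = dual_conv_cols[OF R M \<beta> pair co(2,4) baryM inv]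
  have "lattice_simplex d (Delta P)"
    unfolding lattice_simplex_def Delta_def using R indep R_def is_simplex_mat_def by auto
  then have "gQ d (dual d (Delta P)) = g"
    using g(1) gQ_eq_one unfolding gorenstein_index_def by simp
  moreover have "Delta P = conv_cols R" unfolding Delta_def R_def ..
  ultimately have gQ: "gQ d (conv_cols M) = g" using dual(1) by simp
  \<comment> \<open>\<open>gQ\<close> is a \<open>LEAST\<close>, which has its defining property
    only once some multiple is known to be a lattice simplex.\<close>
  have "\<exists>k>0. lattice_simplex d (scale_set (of_nat k) (conv_cols M))"
  proof -
    obtain k :: nat where k: "0 < k" "\<forall>x\<in>(\<lambda>(i, j). M $$ (i, j)) ` ({..<d} \<times> {..<?n}). rat_of_nat k * x \<in> \<int>"
      using common_denominator[of "(\<lambda>(i, j). M $$ (i, j)) ` ({..<d} \<times> {..<?n})"] by auto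
    have kM: "of_nat k \<cdot>\<^sub>m M \<in> carrier_mat d ?n" using M by simp
    obtain F where F: "F \<in> carrier_mat d ?n" "ratm F = of_nat k \<cdot>\<^sub>m M"
      using ratm_of_Ints[OF kM] k(2) M by fastforce
    then have "lattice_simplex d (scale_set (of_nat k) (conv_cols M))"
      unfolding lattice_simplex_def scale_set_conv_cols[OF M] is_simplex_mat_def
      using kM aff_indep_cols_smult[OF M dual(2), of "of_nat k"] k(1) by (intro exI[of _ F]) auto
    then show ?thesis using k(1) by blast
  qed
  then have "lattice_simplex d (scale_set (of_nat g) (conv_cols M))"
    using gQ_lattice_simplex[of d "conv_cols M"] gQ by simp
  then obtain F :: "int mat" where F: "is_simplex_mat d (ratm F)" "conv_cols (of_nat g \<cdot>\<^sub>m M) = conv_cols (ratm F)"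
    unfolding lattice_simplex_def scale_set_conv_cols[OF M] by blast
  have gM: "of_nat g \<cdot>\<^sub>m M \<in> carrier_mat d ?n" using M by simp
  have gM_indep: "aff_indep_cols (of_nat g \<cdot>\<^sub>m M)"
    using aff_indep_cols_smult[OF M dual(2), of "of_nat g"] g(2) by simp
  have F': "ratm F \<in> carrier_mat d ?n" using F(1) unfolding is_simplex_mat_def by simp
  \<comment> \<open>F is merely some integer matrix with the same hull; since the vertices are
    determined by the hull, the entries of g M are integers too.\<close>
  have "(of_nat g \<cdot>\<^sub>m M) $$ (k, i) \<in> \<int>" if ki: "k < d" "i < ?n" for k i
  proof -
    obtain j where "j < ?n" "col (of_nat g \<cdot>\<^sub>m M) i = col (ratm F) j"
      using vertex_mem_cols[OF gM F' gM_indep F(2) ki(2)] by blast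
    then have "(of_nat g \<cdot>\<^sub>m M) $$ (k, i) = ratm F $$ (k, j)"
      using gM F' ki by (metis carrier_matD index_col)
    also have "\<dots> = of_int (F $$ (k, j))"
      using F' ki \<open>j < ?n\<close> unfolding ratm_def by auto
    finally show ?thesis by simp
  qed
  then obtain G where G: "G \<in> carrier_mat d ?n" "ratm G = of_nat g \<cdot>\<^sub>m M"
    using ratm_of_Ints[OF gM] by blast
  have GM: "rat_of_int (G $$ (k, i)) = of_nat g * M $$ (k, i)" if "k < d" "i < ?n" for k i
  proof -
    have "rat_of_int (G $$ (k, i)) = ratm G $$ (k, i)" unfolding ratm_def using G that by simp
    then show ?thesis unfolding G(2) using M that by simp
  qed
  have pairG: "rat_of_int (\<Sum>k<d. G $$ (k, i) * P $$ (k, j)) = (if i = j then of_nat g / \<beta> i else 0) - of_nat g"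
    if "i < ?n" "j < ?n" for i j
  proof -
    have "rat_of_int (\<Sum>k<d. G $$ (k, i) * P $$ (k, j)) = of_nat g * (\<Sum>k<d. M $$ (k, i) * R $$ (k, j))"
      unfolding sum_distrib_left of_int_sum using GM RP that by (intro sum.cong) auto
    then show ?thesis unfolding pair[OF that] by (auto simp: right_diff_distrib)
  qed
  \<comment> \<open>The pairing of a dual vertex with its own vertex gives g / \<beta>_i - g, an
    integer because G and P are integral.\<close>
  define a where "a i = nat ((\<Sum>k<d. G $$ (k, i) * P $$ (k, i)) + int g)" for i
  have a: "rat_of_nat (a i) = of_nat g / \<beta> i" if "i < ?n" for i
  proof -
    have eq: "rat_of_int ((\<Sum>k<d. G $$ (k, i) * P $$ (k, i)) + int g) = of_nat g / \<beta> i"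
      using pairG[OF that that] by simp
    moreover have "0 < of_nat g / \<beta> i" using g(2) \<beta>[OF that] by simp
    ultimately have "0 < (\<Sum>k<d. G $$ (k, i) * P $$ (k, i)) + int g"
      by (metis of_int_0_less_iff)
    then show ?thesis using eq unfolding a_def by simp
  qed
  have inv_a: "1 / rat_of_nat (a i) = \<beta> i / of_nat g" if "i < ?n" for i
    unfolding a[OF that] by simp
  have div_a: "x / rat_of_nat (a i) = x * \<beta> i / of_nat g" if "i < ?n" for x i
    unfolding a[OF that] by simp
  have "fano_dual_pair d g P G a"
  proof
    show "0 < a j" if "j < ?n" for j
    proof -
      have "0 < rat_of_nat (a j)" unfolding a[OF that] using g(2) \<beta>[OF that] by simp
      then show ?thesis by simp
    qed
    show "(\<Sum>j<?n. 1 / rat_of_nat (a j)) = 1 / rat_of_nat g"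
      using inv_a co(2) by (simp add: sum_divide_distrib[symmetric] del: sum.lessThan_Suc)
    show "(\<Sum>j<?n. rat_of_int (P $$ (i, j)) / rat_of_nat (a j)) = 0" if "i < d" for i
    proof -
      have "(\<Sum>j<?n. rat_of_int (P $$ (i, j)) / rat_of_nat (a j)) = (\<Sum>j<?n. R $$ (i, j) * \<beta> j) / of_nat g"
        unfolding sum_divide_distrib using div_a RP[OF that] by (intro sum.cong) auto
      then show ?thesis using co(4)[OF that] by simp
    qed
    show "(\<Sum>j<?n. rat_of_int (G $$ (i, j)) / rat_of_nat (a j)) = 0" if "i < d" for i
    proof -
      have "(\<Sum>j<?n. rat_of_int (G $$ (i, j)) / rat_of_nat (a j)) = (\<Sum>j<?n. M $$ (i, j) * \<beta> j)"
        using div_a GM[OF that] g(2) by (intro sum.cong) auto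
      then show ?thesis using baryM[OF that] by simp
    qed
    show "(\<Sum>i<d. G $$ (i, j) * P $$ (i, k)) = (if j = k then int (a j) else 0) - int g" if "j < ?n" "k < ?n" for j k
    proof -
      have "rat_of_int (\<Sum>i<d. G $$ (i, j) * P $$ (i, k)) = rat_of_int ((if j = k then int (a j) else 0) - int g)"
        using pairG[OF that] a[OF that(1)] by auto
      then show ?thesis by (simp only: of_int_eq_iff)
    qed
  qed (use P G g prim in auto)
  then show ?thesis by blast
qed

section \<open>The volume bound\<close>

text \<open>The gcd of the entries is 1, and m divides the gcd of all v_k D, which is therefore the
  absolute value of D.\<close>

lemma primitive_dvd:
  assumes prim: "primitive v" and dvd: "\<And>k. k < dim_vec v \<Longrightarrow> m dvd v $ k * D"
  shows "m dvd D"
proof -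
  define S where "S = (\<lambda>k. v $ k) ` {..<dim_vec v}"
  define w where "w = vec (dim_vec v) (\<lambda>k. v $ k div Gcd S)"
  have "v = Gcd S \<cdot>\<^sub>v w"
  proof (rule eq_vecI)
    fix k assume "k < dim_vec (Gcd S \<cdot>\<^sub>v w)"
    then have k: "k < dim_vec v" unfolding w_def by simp
    then have "Gcd S dvd v $ k" unfolding S_def by (intro Gcd_dvd) auto
    then show "v $ k = (Gcd S \<cdot>\<^sub>v w) $ k" unfolding w_def using k by simp
  qed (simp add: w_def)
  moreover have "dim_vec w = dim_vec v" unfolding w_def by simp
  ultimately have "Gcd S = 1 \<or> Gcd S = - 1"
    using prim unfolding primitive_def by metis
  moreover have "0 \<le> Gcd S" by simp
  ultimately have one: "Gcd S = 1" by linarith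
  have "m dvd Gcd ((*) D ` S)"
    unfolding S_def using dvd by (intro Gcd_greatest) (auto simp: mult.commute)
  also have "Gcd ((*) D ` S) = \<bar>D\<bar>"
    unfolding Gcd_mult one by simp
  finally show ?thesis by simp
qed

lemma prod_lessThan_diag: "A \<in> carrier_mat n n \<Longrightarrow> prod_list (diag_mat A) = (\<Prod>i<n. A $$ (i, i))"
  by (simp add: prod_list_diag_prod lessThan_atLeast0)

lemma transpose_mult_index:
  "A \<in> carrier_mat k m \<Longrightarrow> B \<in> carrier_mat k n \<Longrightarrow> i < m \<Longrightarrow> j < n \<Longrightarrow>
    (A\<^sup>T * B) $$ (i, j) = (\<Sum>l<k. A $$ (l, i) * B $$ (l, j))"
  using mult_mat_index[of "A\<^sup>T" m k B n i j] by simp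

lemma aug_map_mat: "aug 1 (ratm P) = map_mat of_int (aug 1 P)"
  unfolding aug_def ratm_def by (intro eq_matI) auto

lemma norm_vol_ratm:
  assumes P: "P \<in> carrier_mat d (Suc d)"
  shows "norm_vol (ratm P) = of_int \<bar>det (aug 1 P)\<bar>"
proof -
  have R: "ratm P \<in> carrier_mat d (Suc d)" using P unfolding ratm_def by simp
  have "det (aug 1 (ratm P)) = of_int (det (aug 1 P))"
    unfolding aug_map_mat by (rule of_int_hom.hom_det)
  then show ?thesis unfolding norm_vol_eq_det_aug[OF R] by simp
qed

text \<open>Multiplying the row r B, which vanishes modulo m, by the adjugate of B yields r det
  B.\<close>

lemma dvd_coeff_times_det:
  fixes B :: "int mat"
  assumes B: "B \<in> carrier_mat n n" and dvd: "\<And>i. i < n \<Longrightarrow> m dvd (\<Sum>l<n. r l * B $$ (l, i))" and k: "k < n"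
  shows "m dvd r k * det B"
proof -
  note adj = adj_mat[OF B]
  have "r k * det B = (\<Sum>l<n. r l * det B * (if l = k then 1 else 0))"
    using sum_mult_delta[OF k, of "\<lambda>l. r l * det B"] by simp
  also have "\<dots> = (\<Sum>l<n. r l * (\<Sum>i<n. B $$ (l, i) * adj_mat B $$ (i, k)))"
  proof (intro sum.cong refl)
    fix l assume "l \<in> {..<n}"
    then have "(\<Sum>i<n. B $$ (l, i) * adj_mat B $$ (i, k)) = det B * (if l = k then 1 else 0)"
      using mult_mat_index[OF B adj(1), of l k] k unfolding adj(2) by simp
    then show "r l * det B * (if l = k then 1 else 0) = r l * (\<Sum>i<n. B $$ (l, i) * adj_mat B $$ (i, k))"
      by simp
  qed
  also have "\<dots> = (\<Sum>l<n. \<Sum>i<n. r l * B $$ (l, i) * adj_mat B $$ (i, k))"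
    unfolding sum_distrib_left by (simp add: mult.assoc)
  also have "\<dots> = (\<Sum>i<n. (\<Sum>l<n. r l * B $$ (l, i)) * adj_mat B $$ (i, k))"
    unfolding sum_distrib_right by (rule sum.swap)
  also have "m dvd \<dots>" using dvd by (intro dvd_sum) auto
  finally show ?thesis .
qed

context fano_dual_pair
begin

text \<open>The top rows g and 1 cancel the -g in the pairing, so the product of the two homogenized
  matrices is diagonal with entries a_j.\<close>

lemma det_aug_times_det_aug:
  "det (aug (int g) G) * det (aug 1 P) = int (\<Prod>j<Suc d. a j)"
proof -
  let ?H = "aug (int g) G" and ?A = "aug 1 P"
  have H: "?H \<in> carrier_mat (Suc d) (Suc d)" by (rule aug_carrier[OF G])
  have A: "?A \<in> carrier_mat (Suc d) (Suc d)" by (rule aug_carrier[OF P])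
  have HA: "?H\<^sup>T * ?A \<in> carrier_mat (Suc d) (Suc d)" using H A by simp
  have index: "(?H\<^sup>T * ?A) $$ (i, j) = (if i = j then int (a i) else 0)" if "i < Suc d" "j < Suc d" for i j
  proof -
    have "(?H\<^sup>T * ?A) $$ (i, j) = (\<Sum>l<Suc d. ?H $$ (l, i) * ?A $$ (l, j))"
      by (rule transpose_mult_index[OF H A that])
    also have "\<dots> = int g + (\<Sum>l<d. G $$ (l, i) * P $$ (l, j))"
      unfolding sum.lessThan_Suc_shift using that by (simp add: aug_index[OF G] aug_index[OF P])
    finally show ?thesis using pairing[OF that] by simp
  qed
  have "det ?H * det ?A = det (?H\<^sup>T * ?A)"
    using det_mult[of "?H\<^sup>T" "Suc d" ?A] det_transpose[OF H] H A by simp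
  also have "\<dots> = prod_list (diag_mat (?H\<^sup>T * ?A))"
    by (rule det_upper_triangular[OF _ HA]) (use index H A in auto)
  also have "\<dots> = (\<Prod>i<Suc d. int (a i))"
    unfolding prod_lessThan_diag[OF HA] using index by (intro prod.cong) auto
  finally show ?thesis by simp
qed

lemma det_aug_eq: "det (aug (int g) G) = int g * det (aug 1 G)"
proof -
  have "aug (int g) G = multrow 0 (int g) (aug 1 G)"
    using G unfolding aug_def by (intro eq_matI) auto
  then show ?thesis
    using det_multrow[of 0 "Suc d" "aug 1 G" "int g"] aug_carrier[OF G, of 1] by simp
qed

text \<open>The row (g, v_j) times \<open>aug 1 G\<close> has entries a_j or 0. By the adjugate
  argument a_j divides every coordinate of v_j times the determinant, and primitivity of v_j removes
  the coordinate.\<close>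

lemma a_dvd_det:
  assumes j: "j < Suc d"
  shows "int (a j) dvd det (aug 1 G)"
proof (rule primitive_dvd[OF prim[OF j]])
  fix k assume "k < dim_vec (col P j)"
  then have k: "k < d" using P by simp
  let ?r = "\<lambda>l. if l = 0 then int g else P $$ (l - 1, j)"
  have "int (a j) dvd ?r (Suc k) * det (aug 1 G)"
  proof (rule dvd_coeff_times_det[OF aug_carrier[OF G], where r = ?r and k = "Suc k"])
    fix i assume i: "i < Suc d"
    have "(\<Sum>l<Suc d. ?r l * aug 1 G $$ (l, i)) = int g + (\<Sum>l<d. G $$ (l, i) * P $$ (l, j))"
      unfolding sum.lessThan_Suc_shift using i by (simp add: aug_index[OF G] mult.commute)
    then show "int (a j) dvd (\<Sum>l<Suc d. ?r l * aug 1 G $$ (l, i))"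
      using pairing[OF i j] by auto
  qed (use k in simp)
  then show "int (a j) dvd col P j $ k * det (aug 1 G)"
    using P k j by simp
qed

lemma norm_vol_pos: "0 < norm_vol (ratm P)"
proof -
  have "(\<Prod>j<Suc d. a j) \<noteq> 0" using a by (auto simp del: prod.lessThan_Suc)
  then have "det (aug 1 P) \<noteq> 0" using det_aug_times_det_aug by (metis mult_zero_right of_nat_eq_0_iff)
  then show ?thesis unfolding norm_vol_ratm[OF P] by simp
qed

lemma norm_vol_le: "norm_vol (ratm P) * of_nat g \<le> of_nat (\<Prod>j<d. a j)"
proof -
  let ?D = "det (aug 1 G)" and ?V = "det (aug 1 P)"
  have eq: "int g * ?D * ?V = int (\<Prod>j<d. a j) * int (a d)"
    using det_aug_times_det_aug unfolding det_aug_eq by simp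
  have pos: "0 < int (\<Prod>j<d. a j) * int (a d)"
  proof (intro mult_pos_pos)
    show "0 < int (\<Prod>j<d. a j)" unfolding of_nat_0_less_iff using a by (intro prod_pos) auto
  qed (use a[of d] in simp)
  have "?D \<noteq> 0"
  proof
    assume "?D = 0"
    then have "int (\<Prod>j<d. a j) * int (a d) = 0" using eq by (simp only: mult_zero_left mult_zero_right)
    then show False using pos by linarith
  qed
  then have "int (a d) \<le> \<bar>?D\<bar>"
    using dvd_imp_le_int[OF _ a_dvd_det[of d]] by simp
  then have "int g * \<bar>?V\<bar> * int (a d) \<le> int g * \<bar>?V\<bar> * \<bar>?D\<bar>"
    by (intro mult_left_mono) auto
  also have "\<dots> = \<bar>int g * ?D * ?V\<bar>" by (simp add: abs_mult mult_ac)
  also have "\<dots> = int (\<Prod>j<d. a j) * int (a d)" using eq pos by linarith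
  finally have "int g * \<bar>?V\<bar> \<le> int (\<Prod>j<d. a j)" using a[of d] by simp
  then have "rat_of_int (int g * \<bar>?V\<bar>) \<le> rat_of_int (int (\<Prod>j<d. a j))" by (simp only: of_int_le_iff)
  then show ?thesis unfolding norm_vol_ratm[OF P] by (simp add: mult.commute)
qed

text \<open>Once volume and weights are known this is the exact determinant of the first d vertices,
  which is then examined modulo g or modulo 2.\<close>

lemma norm_vol_times_weight_eq:
  "norm_vol (ratm P) * (of_nat g / of_nat (a d)) = of_int \<bar>det (mat d d (\<lambda>(i, j). P $$ (i, j)))\<bar>"
proof -
  have R: "ratm P \<in> carrier_mat d (Suc d)" using P unfolding ratm_def by simp
  have "norm_vol (ratm P) * \<bar>of_nat g / of_nat (a d)\<bar> = \<bar>det (mat d d (\<lambda>(i, j). ratm P $$ (i, j)))\<bar>"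
  proof (rule norm_vol_times_weight[OF R, of "\<lambda>j. of_nat g / of_nat (a j)"])
    have "(\<Sum>j<Suc d. rat_of_nat g / of_nat (a j)) = of_nat g * (\<Sum>j<Suc d. 1 / of_nat (a j))"
      unfolding sum_distrib_left by simp
    then show "(\<Sum>j<Suc d. rat_of_nat g / of_nat (a j)) = 1" unfolding sum_inverse using g by simp
    fix i assume i: "i < d"
    have "(\<Sum>j<Suc d. ratm P $$ (i, j) * (of_nat g / of_nat (a j)))
      = of_nat g * (\<Sum>j<Suc d. rat_of_int (P $$ (i, j)) / of_nat (a j))"
      unfolding sum_distrib_left ratm_def using P i by (intro sum.cong) auto
    then show "(\<Sum>j<Suc d. ratm P $$ (i, j) * (of_nat g / of_nat (a j))) = 0"
      unfolding bary_P[OF i] by simp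
  qed
  also have "mat d d (\<lambda>(i, j). ratm P $$ (i, j)) = map_mat of_int (mat d d (\<lambda>(i, j). P $$ (i, j)))"
    using P unfolding ratm_def by (intro eq_matI) auto
  finally show ?thesis by simp
qed

lemma iso_of_integral:
  assumes Q: "Q \<in> carrier_mat d (Suc d)"
    and bary: "\<And>i. i < d \<Longrightarrow> (\<Sum>j<Suc d. Q $$ (i, j) / of_nat (a j)) = 0"
    and integral: "\<And>i k. i < d \<Longrightarrow> k < d \<Longrightarrow> (\<Sum>j<Suc d. Q $$ (i, j) * of_int (G $$ (k, j)) / of_nat (a j)) \<in> \<int>"
    and vol: "norm_vol Q = norm_vol (ratm P)"
  shows "iso d (Delta P) (conv_cols Q)"
proof -
  let ?U = "mat d d (\<lambda>(i, k). \<Sum>j<Suc d. Q $$ (i, j) * of_int (G $$ (k, j)) / of_nat (a j))"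
  have R: "ratm P \<in> carrier_mat d (Suc d)" using P unfolding ratm_def by simp
  have U: "?U \<in> carrier_mat d d" by simp
  obtain V where V: "V \<in> carrier_mat d d" "ratm V = ?U"
    using ratm_of_Ints[OF U] integral by auto
  have "?U * ratm P = Q"
  proof (rule eq_matI)
    fix i k assume "i < dim_row Q" "k < dim_col Q"
    then have ik: "i < d" "k < Suc d" using Q by auto
    have "(?U * ratm P) $$ (i, k) = (\<Sum>r<d. ?U $$ (i, r) * ratm P $$ (r, k))"
      by (rule mult_mat_index[OF U R ik])
    also have "\<dots> = (\<Sum>r<d. \<Sum>j<Suc d. Q $$ (i, j) / of_nat (a j) * of_int (G $$ (r, j) * P $$ (r, k)))"
      using ik P unfolding ratm_def by (intro sum.cong refl) (simp add: sum_distrib_right mult.assoc del: sum.lessThan_Suc)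
    also have "\<dots> = (\<Sum>j<Suc d. Q $$ (i, j) / of_nat (a j) * of_int (\<Sum>r<d. G $$ (r, j) * P $$ (r, k)))"
      unfolding of_int_sum sum_distrib_left by (rule sum.swap)
    \<comment> \<open>The pairing is diagonal up to -g; the -g part sums to zero because Q has the
      same barycentric weights.\<close>
    also have "\<dots> = (\<Sum>j<Suc d. Q $$ (i, j) * (if j = k then 1 else 0) - of_nat g * (Q $$ (i, j) / of_nat (a j)))"
      using pairing ik(2) a by (intro sum.cong refl) (auto simp: right_diff_distrib)
    also have "\<dots> = Q $$ (i, k)"
      unfolding sum_subtractf sum_mult_delta[OF ik(2)] sum_distrib_left[symmetric] bary[OF ik(1)] by simp
    finally show "(?U * ratm P) $$ (i, k) = Q $$ (i, k)" .
  qed (use Q R in auto)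
  then have UP: "ratm V * ratm P = Q" using V by simp
  have rV: "ratm V \<in> carrier_mat d d" using V unfolding ratm_def by simp
  have "\<bar>det (ratm V)\<bar> * norm_vol (ratm P) = norm_vol (ratm P)"
    using norm_vol_mult[OF rV R] vol unfolding UP by simp
  then have "\<bar>det (ratm V)\<bar> = 1" using norm_vol_pos by simp
  then have "rat_of_int \<bar>det V\<bar> = rat_of_int 1" unfolding ratm_def by simp
  then have "\<bar>det V\<bar> = 1" by (simp only: of_int_eq_iff)
  then have "det V = 1 \<or> det V = - 1" by linarith
  moreover have "(\<lambda>x. ratm V *\<^sub>v x) ` Delta P = conv_cols Q"
    unfolding Delta_def image_conv_cols[OF rV R] UP ..
  ultimately show ?thesis unfolding iso_def using V by blast
qed

lemma permute:
  assumes p: "p permutes {0..<Suc d}"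
  shows "fano_dual_pair d g (mat d (Suc d) (\<lambda>(i, j). P $$ (i, p j))) (mat d (Suc d) (\<lambda>(i, j). G $$ (i, p j))) (a \<circ> p)"
proof -
  have pj: "p j < Suc d" if "j < Suc d" for j using permutes_in_image[OF p, of j] that by simp
  have p_eq: "p j = p k \<longleftrightarrow> j = k" for j k using permutes_inj[OF p] by (auto dest: injD)
  have sum: "(\<Sum>j<Suc d. f (p j)) = (\<Sum>j<Suc d. f j)" for f :: "nat \<Rightarrow> rat"
    using sum.permute[OF p, of f] by (simp only: lessThan_atLeast0 comp_def)
  show ?thesis
  proof
    show "(\<Sum>j<Suc d. 1 / rat_of_nat ((a \<circ> p) j)) = 1 / rat_of_nat g"
      using sum[of "\<lambda>j. 1 / rat_of_nat (a j)"] sum_inverse by (simp del: sum.lessThan_Suc)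
    show "(\<Sum>j<Suc d. rat_of_int (mat d (Suc d) (\<lambda>(i, j). P $$ (i, p j)) $$ (i, j)) / rat_of_nat ((a \<circ> p) j)) = 0"
      if "i < d" for i
      using sum[of "\<lambda>j. rat_of_int (P $$ (i, j)) / rat_of_nat (a j)"] bary_P[OF that] that
      by (simp del: sum.lessThan_Suc)
    show "(\<Sum>j<Suc d. rat_of_int (mat d (Suc d) (\<lambda>(i, j). G $$ (i, p j)) $$ (i, j)) / rat_of_nat ((a \<circ> p) j)) = 0"
      if "i < d" for i
      using sum[of "\<lambda>j. rat_of_int (G $$ (i, j)) / rat_of_nat (a j)"] bary_G[OF that] that
      by (simp del: sum.lessThan_Suc)
    show "primitive (col (mat d (Suc d) (\<lambda>(i, j). P $$ (i, p j))) j)" if "j < Suc d" for j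
    proof -
      have "col (mat d (Suc d) (\<lambda>(i, j). P $$ (i, p j))) j = col P (p j)"
        using P that pj[OF that] by (intro eq_vecI) auto
      then show ?thesis using prim[OF pj[OF that]] by simp
    qed
    show "0 < (a \<circ> p) j" if "j < Suc d" for j using a[OF pj[OF that]] by simp
    show "(\<Sum>i<d. mat d (Suc d) (\<lambda>(i, j). G $$ (i, p j)) $$ (i, j) * mat d (Suc d) (\<lambda>(i, j). P $$ (i, p j)) $$ (i, k))
      = (if j = k then int ((a \<circ> p) j) else 0) - int g" if "j < Suc d" "k < Suc d" for j k
      using pairing[OF pj[OF that(1)] pj[OF that(2)]] that p_eq by simp
  qed (use g in simp_all)
qed

end

section \<open>Reordering the vertices\<close>

lemma conv_cols_permute:
  assumes P: "P \<in> carrier_mat d n" and p: "p permutes {0..<n}"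
  shows "conv_cols (mat d n (\<lambda>(i, j). P $$ (i, p j))) = conv_cols P"
proof -
  have sub: "conv_cols (mat d n (\<lambda>(i, j). P $$ (i, p j))) \<subseteq> conv_cols P"
    if P: "P \<in> carrier_mat d n" and p: "p permutes {0..<n}" for P p
  proof
    let ?P = "mat d n (\<lambda>(i, j). P $$ (i, p j))"
    have P': "?P \<in> carrier_mat d n" by simp
    fix x assume "x \<in> conv_cols ?P"
    then obtain l where x: "dim_vec x = d" and l: "\<forall>j<n. 0 \<le> l j" "(\<Sum>j<n. l j) = 1"
      "\<forall>i<d. x $ i = (\<Sum>j<n. ?P $$ (i, j) * l j)" unfolding conv_cols_iff[OF P'] by blast
    have sum: "(\<Sum>j<n. f (inv_into UNIV p j)) = (\<Sum>j<n. f j)" for f :: "nat \<Rightarrow> rat"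
      using sum.permute[OF permutes_inv[OF p], of f] by (simp only: lessThan_atLeast0 comp_def)
    have inv: "inv_into UNIV p j < n" if "j < n" for j using permutes_in_image[OF permutes_inv[OF p], of j] that by simp
    have "x $ i = (\<Sum>j<n. P $$ (i, j) * l (inv_into UNIV p j))" if "i < d" for i
    proof -
      have "x $ i = (\<Sum>j<n. P $$ (i, p j) * l j)" using l(3) that by simp
      also have "\<dots> = (\<Sum>j<n. P $$ (i, p (inv_into UNIV p j)) * l (inv_into UNIV p j))" by (rule sum[symmetric])
      finally show ?thesis unfolding permutes_inverses(1)[OF p] .
    qed
    then show "x \<in> conv_cols P"
      unfolding conv_cols_iff[OF P] using x l(1,2) sum[of l] inv
      by (intro conjI exI[of _ "\<lambda>j. l (inv_into UNIV p j)"]) auto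
  qed
  let ?P = "mat d n (\<lambda>(i, j). P $$ (i, p j))"
  have "mat d n (\<lambda>(i, j). ?P $$ (i, inv_into UNIV p j)) = P"
    using P permutes_in_image[OF permutes_inv[OF p]] permutes_inverses(1)[OF p] by (intro eq_matI) auto
  then show ?thesis
    using sub[OF P p] sub[of ?P "inv_into UNIV p"] permutes_inv[OF p] by auto
qed

lemma sorting_permutation:
  fixes a :: "nat \<Rightarrow> nat"
  shows "\<exists>p. p permutes {0..<n} \<and> (\<forall>i. Suc i < n \<longrightarrow> a (p i) \<le> a (p (Suc i)))"
proof -
  define xs where "xs = sort_key a [0..<n]"
  have xs: "distinct xs" "set xs = {0..<n}" "length xs = n" "sorted (map a xs)"
    unfolding xs_def by auto
  define p where "p i = (if i < n then xs ! i else i)" for i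
  have "bij_betw (\<lambda>i. xs ! i) {0..<n} {0..<n}"
    by (rule bij_betw_nth[OF xs(1)]) (simp_all only: xs lessThan_atLeast0)
  then have "bij_betw p {0..<n} {0..<n}"
    by (rule bij_betw_cong[THEN iffD1, rotated]) (auto simp: p_def)
  then have "p permutes {0..<n}" by (rule bij_imp_permutes) (auto simp: p_def)
  moreover have "a (p i) \<le> a (p (Suc i))" if "Suc i < n" for i
    using sorted_nth_mono[OF xs(4), of i "Suc i"] xs(3) that unfolding p_def by simp
  ultimately show ?thesis by blast
qed

section \<open>The extremal simplices\<close>

lemma sylv_Suc: "sylv g (Suc k) = tsylv g (Suc k) + 1"
proof -
  have "0 < sylv g (Suc k)" by (cases k) auto
  then show ?thesis unfolding tsylv_def by simp
qed

lemma tsylv_one: "tsylv g (Suc 0) = g"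
  by (simp add: tsylv_def)

lemma tsylv_Suc: "tsylv g (Suc (Suc k)) = tsylv g (Suc k) * sylv g (Suc k)"
  by (simp add: tsylv_def mult.commute)

lemma tsylv_eq_sylv_iter: "real (tsylv g (Suc k)) = sylv_iter (real g) k"
  by (induction k) (simp_all only: tsylv_one tsylv_Suc sylv_Suc sylv_iter.simps of_nat_mult of_nat_add of_nat_1)

lemma tsylv_eq_prod: "tsylv g (Suc n) = g * (\<Prod>i<n. sylv g (Suc i))"
  by (induction n) (simp_all only: tsylv_one tsylv_Suc prod.lessThan_Suc mult.assoc, simp)

lemma tsylv_pos: "0 < g \<Longrightarrow> 0 < tsylv g (Suc n)"
  by (induction n) (simp_all only: tsylv_one tsylv_Suc sylv_Suc, simp)

lemma sum_inverse_sylv: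
  "0 < g \<Longrightarrow> (\<Sum>i<n. 1 / rat_of_nat (sylv g (Suc i))) = 1 / of_nat g - 1 / of_nat (tsylv g (Suc n))"
proof (induction n)
  case 0
  then show ?case by (simp add: tsylv_one)
next
  case (Suc n)
  have "rat_of_nat (tsylv g (Suc n)) \<noteq> 0" using tsylv_pos[OF Suc.prems, of n] by simp
  moreover have "rat_of_nat (tsylv g (Suc n)) + 1 \<noteq> 0" by (metis of_nat_1 of_nat_add of_nat_eq_0_iff add_is_0 one_neq_zero)
  ultimately have "1 / rat_of_nat (sylv g (Suc n)) = 1 / of_nat (tsylv g (Suc n)) - 1 / of_nat (tsylv g (Suc (Suc n)))"
    unfolding tsylv_Suc sylv_Suc of_nat_mult of_nat_add of_nat_1 by (simp add: divide_simps)
  then show ?case using Suc by simp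
qed

text \<open>Write s for s_(i+1). The cofactor starts as t_(i+1) = s - 1, and each step multiplies it
  by s E + 1, which is 1 modulo s; so it stays -1 modulo s.\<close>

lemma tsylv_cofactor:
  assumes "i < n"
  shows "\<exists>E. tsylv g (Suc n) = sylv g (Suc i) * E \<and> sylv g (Suc i) dvd E + 1 \<and> g dvd E"
  using assms
proof (induction n)
  case (Suc n)
  show ?case
  proof (cases "i = n")
    case True
    have "tsylv g (Suc (Suc i)) = sylv g (Suc i) * tsylv g (Suc i)"
      by (simp only: tsylv_Suc mult.commute)
    moreover have "sylv g (Suc i) dvd tsylv g (Suc i) + 1" unfolding sylv_Suc by (rule dvd_refl)
    moreover have "g dvd tsylv g (Suc i)" unfolding tsylv_eq_prod by simp
    ultimately show ?thesis using True by blast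
  next
    case False
    then obtain E where E: "tsylv g (Suc n) = sylv g (Suc i) * E" "sylv g (Suc i) dvd E + 1" "g dvd E"
      using Suc by auto
    have "E * sylv g (Suc n) + 1 = sylv g (Suc i) * (E * E) + (E + 1)"
      unfolding sylv_Suc[of g n] E(1) by (simp add: algebra_simps)
    then have "sylv g (Suc i) dvd E * sylv g (Suc n) + 1"
      using E(2) by (metis dvd_add dvd_triv_left)
    then show ?thesis
      using E by (intro exI[of _ "E * sylv g (Suc n)"]) (simp add: tsylv_Suc)
  qed
qed simp

text \<open>Here and in the next lemma: s_j = t_j + 1, and t_j is divisible by g and by every
  earlier s_i.\<close>

lemma coprime_sylv_index: "coprime g (sylv g (Suc i))"
proof (rule coprimeI)
  fix c assume c: "c dvd g" "c dvd sylv g (Suc i)"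
  then have "c dvd tsylv g (Suc i)" unfolding tsylv_eq_prod by simp
  then show "is_unit c" using c(2) unfolding sylv_Suc by (metis dvd_add_right_iff)
qed

lemma coprime_sylv: "i < j \<Longrightarrow> coprime (sylv g (Suc i)) (sylv g (Suc j))"
proof (rule coprimeI)
  fix c assume ij: "i < j" and c: "c dvd sylv g (Suc i)" "c dvd sylv g (Suc j)"
  have "c dvd tsylv g (Suc j)" using tsylv_cofactor[OF ij, of g] c(1) by (metis dvd_mult2)
  then show "is_unit c" using c(2) unfolding sylv_Suc[of g j] by (metis dvd_add_right_iff)
qed

text \<open>The values a_j belonging to \<open>P_gen\<close> in dimension d = n + 1; the last two
  coincide.\<close>

definition sylv_weight :: "nat \<Rightarrow> nat \<Rightarrow> nat \<Rightarrow> nat" where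
  "sylv_weight n g j = (if j < n then sylv g (Suc j) else 2 * tsylv g (Suc n))"

lemma sum_sylv_weight:
  assumes g: "0 < g"
  shows "(\<Sum>j<Suc (Suc n). 1 / rat_of_nat (sylv_weight n g j)) = 1 / of_nat g"
proof -
  have "(\<Sum>j<n. 1 / rat_of_nat (sylv_weight n g j)) = (\<Sum>j<n. 1 / rat_of_nat (sylv g (Suc j)))"
    by (intro sum.cong) (auto simp: sylv_weight_def)
  then show ?thesis
    using sum_inverse_sylv[OF g, of n] tsylv_pos[OF g, of n] by (simp add: sylv_weight_def)
qed

lemma P_gen_carrier: "P_gen d g \<in> carrier_mat d (Suc d)"
  unfolding P_gen_def by simp

text \<open>One evaluation for two uses: c = 1 gives the barycentric condition, and c a row of G
  gives an entry of the matrix that maps P to \<open>P_gen\<close>.\<close>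

lemma P_gen_weighted_sum:
  assumes g: "0 < g" and i: "i < Suc n"
  shows "(\<Sum>j<Suc (Suc n). P_gen (Suc n) g $$ (i, j) * c j / rat_of_nat (sylv_weight n g j)) =
    (if i < n then c i / of_nat (sylv g (Suc i)) - (c n + c (Suc n)) / (2 * of_nat (sylv g (Suc i))) else 0)
    + (c n - c (Suc n)) / (2 * of_nat g)"
proof -
  define t where "t = rat_of_nat (tsylv g (Suc n))"
  define s where "s = rat_of_nat (sylv g (Suc i))"
  have t: "t \<noteq> 0" unfolding t_def using tsylv_pos[OF g, of n] by simp
  have s: "s \<noteq> 0" unfolding s_def sylv_Suc by (simp del: of_nat_Suc of_nat_add)
  have g0: "rat_of_nat g \<noteq> 0" using g by simp
  have w: "rat_of_nat (sylv_weight n g n) = 2 * t" "rat_of_nat (sylv_weight n g (Suc n)) = 2 * t"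
    unfolding sylv_weight_def t_def by auto
  have first: "(\<Sum>j<n. P_gen (Suc n) g $$ (i, j) * c j / rat_of_nat (sylv_weight n g j)) = (if i < n then c i / s else 0)"
  proof -
    have "(\<Sum>j<n. P_gen (Suc n) g $$ (i, j) * c j / rat_of_nat (sylv_weight n g j))
      = (\<Sum>j<n. c j / rat_of_nat (sylv_weight n g j) * (if j = i then 1 else 0))"
      using i unfolding P_gen_def by (intro sum.cong refl) simp
    also have "\<dots> = (if i < n then c i / s else 0)"
    proof (cases "i < n")
      case True
      then show ?thesis using sum_mult_delta[OF True, of "\<lambda>j. c j / rat_of_nat (sylv_weight n g j)"]
        by (simp add: sylv_weight_def s_def)
    next
      case False
      then show ?thesis by (auto intro!: sum.neutral)
    qed
    finally show ?thesis .
  qed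
  have col_n: "P_gen (Suc n) g $$ (i, n) = (if i < n then (s - of_nat g) / s * (t / of_nat g) else t / of_nat g)"
    using i unfolding P_gen_def s_def t_def by (simp add: Let_def)
  have col_Suc: "P_gen (Suc n) g $$ (i, Suc n) = (if i < n then - ((s + of_nat g) / s * (t / of_nat g)) else - (t / of_nat g))"
    using i unfolding P_gen_def s_def t_def by (simp add: Let_def)
  have "(\<Sum>j<Suc (Suc n). P_gen (Suc n) g $$ (i, j) * c j / rat_of_nat (sylv_weight n g j)) =
    (if i < n then c i / s else 0) + P_gen (Suc n) g $$ (i, n) * c n / (2 * t) + P_gen (Suc n) g $$ (i, Suc n) * c (Suc n) / (2 * t)"
    unfolding sum.lessThan_Suc first w ..
  also have "\<dots> = (if i < n then c i / s - (c n + c (Suc n)) / (2 * s) else 0) + (c n - c (Suc n)) / (2 * of_nat g)"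
    unfolding col_n col_Suc using t s g0 by (auto simp: field_simps)
  finally show ?thesis unfolding s_def .
qed

lemma P_gen_bary:
  assumes g: "0 < g" and i: "i < Suc n"
  shows "(\<Sum>j<Suc (Suc n). P_gen (Suc n) g $$ (i, j) / rat_of_nat (sylv_weight n g j)) = 0"
  using P_gen_weighted_sum[OF g i, of "\<lambda>_. 1"] by simp

text \<open>The first d columns are triangular with diagonal 1, ..., 1, t/g, and the last
  barycentric coordinate of the origin is g / (2 t).\<close>

lemma norm_vol_P_gen:
  assumes g: "0 < g"
  shows "norm_vol (P_gen (Suc n) g) = 2 * (of_nat (tsylv g (Suc n)))\<^sup>2 / (of_nat g)\<^sup>2"
proof -
  let ?t = "rat_of_nat (tsylv g (Suc n))"
  let ?M = "mat (Suc n) (Suc n) (\<lambda>(i, j). P_gen (Suc n) g $$ (i, j))"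
  have t: "0 < ?t" using tsylv_pos[OF g, of n] by simp
  have "norm_vol (P_gen (Suc n) g) * \<bar>of_nat g / of_nat (sylv_weight n g (Suc n))\<bar> = \<bar>det ?M\<bar>"
  proof (rule norm_vol_times_weight[OF P_gen_carrier, of "\<lambda>j. of_nat g / of_nat (sylv_weight n g j)"])
    have "(\<Sum>j<Suc (Suc n). rat_of_nat g / of_nat (sylv_weight n g j)) = of_nat g * (\<Sum>j<Suc (Suc n). 1 / of_nat (sylv_weight n g j))"
      unfolding sum_distrib_left by simp
    then show "(\<Sum>j<Suc (Suc n). rat_of_nat g / of_nat (sylv_weight n g j)) = 1"
      unfolding sum_sylv_weight[OF g] using g by simp
    fix i assume i: "i < Suc n"
    have "(\<Sum>j<Suc (Suc n). P_gen (Suc n) g $$ (i, j) * (of_nat g / of_nat (sylv_weight n g j)))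
      = of_nat g * (\<Sum>j<Suc (Suc n). P_gen (Suc n) g $$ (i, j) / of_nat (sylv_weight n g j))"
      unfolding sum_distrib_left by (intro sum.cong) auto
    then show "(\<Sum>j<Suc (Suc n). P_gen (Suc n) g $$ (i, j) * (of_nat g / of_nat (sylv_weight n g j))) = 0"
      unfolding P_gen_bary[OF g i] by simp
  qed
  also have "det ?M = prod_list (diag_mat ?M)"
    by (rule det_upper_triangular[of _ "Suc n"]) (auto simp: P_gen_def)
  also have "\<dots> = (\<Prod>i<Suc n. ?M $$ (i, i))"
    by (rule prod_lessThan_diag) simp
  also have "\<dots> = ?t / of_nat g"
    by (simp add: P_gen_def Let_def)
  finally have "norm_vol (P_gen (Suc n) g) * (of_nat g / (2 * ?t)) = ?t / of_nat g"
    using t g by (simp add: sylv_weight_def)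
  then show ?thesis using t g by (simp add: field_simps power2_eq_square)
qed

section \<open>Volumes of the two exceptional simplices\<close>

lemma ratm_exceptional_carrier:
  "ratm P_two \<in> carrier_mat 2 (Suc 2)" "ratm P_one \<in> carrier_mat 3 (Suc 3)"
  by (intro carrier_matI; simp add: ratm_def P_two_def P_one_def mat_of_rows_list_def)+

lemma norm_vol_P_two: "norm_vol (ratm P_two) = 9"
proof -
  let ?M = "mat 2 2 (\<lambda>(i, j). ratm P_two $$ (i, j))"
  have "norm_vol (ratm P_two) * \<bar>1 / 3\<bar> = \<bar>det ?M\<bar>"
    by (rule norm_vol_times_weight[OF ratm_exceptional_carrier(1), of "\<lambda>_. 1 / 3"])
      (auto simp: ratm_def P_two_def mat_of_rows_list_def less_Suc_eq numeral_2_eq_2)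
  also have "det ?M = prod_list (diag_mat ?M)"
    by (rule det_upper_triangular[of _ 2])
      (auto simp: ratm_def P_two_def mat_of_rows_list_def less_Suc_eq numeral_2_eq_2)
  also have "\<dots> = 3"
    by (simp add: prod_lessThan_diag[of _ 2] ratm_def P_two_def mat_of_rows_list_def numeral_2_eq_2)
  finally show ?thesis by simp
qed

lemma norm_vol_P_one: "norm_vol (ratm P_one) = 72"
proof -
  let ?M = "mat 3 3 (\<lambda>(i, j). ratm P_one $$ (i, j))"
  \<comment> \<open>The \<open>if\<close> is the weight function 1/2, 1/6, 1/6, 1/6 at the last
    index 3.\<close>
  have "norm_vol (ratm P_one) * \<bar>if (3::nat) = 0 then 1 / 2 else 1 / 6\<bar> = \<bar>det ?M\<bar>"
    by (rule norm_vol_times_weight[OF ratm_exceptional_carrier(2), of "\<lambda>j. if j = 0 then 1 / 2 else 1 / 6"])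
      (auto simp: ratm_def P_one_def mat_of_rows_list_def less_Suc_eq numeral_2_eq_2 numeral_3_eq_3)
  also have "det ?M = prod_list (diag_mat ?M)"
    by (rule det_upper_triangular[of _ 3])
      (auto simp: ratm_def P_one_def mat_of_rows_list_def less_Suc_eq numeral_2_eq_2 numeral_3_eq_3 upper_triangular_def)
  also have "\<dots> = 12"
    by (simp add: prod_lessThan_diag[of _ 3] ratm_def P_one_def mat_of_rows_list_def numeral_2_eq_2 numeral_3_eq_3)
  finally show ?thesis by simp
qed

context fano_dual_pair
begin

text \<open>All pairings of the n-th column of G with the first d vertices are divisible by g, so g
  divides each of its entries times the determinant of these vertices; coprimality cancels the
  determinant.\<close>

lemma dvd_G_of_coprime:
  assumes n: "n < d" and dvd: "g dvd a n"
    and D: "\<bar>det (mat d d (\<lambda>(i, j). P $$ (i, j)))\<bar> = int D" and coprime: "coprime g D" and k: "k < d"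
  shows "int g dvd G $$ (k, n)"
proof -
  let ?B = "mat d d (\<lambda>(i, j). P $$ (i, j))"
  have "int g dvd G $$ (k, n) * det ?B"
  proof (rule dvd_coeff_times_det[OF _ _ k, where r = "\<lambda>l. G $$ (l, n)"])
    fix i assume i: "i < d"
    have "(\<Sum>l<d. G $$ (l, n) * ?B $$ (l, i)) = (if n = i then int (a n) else 0) - int g"
      using pairing[of n i] i n by simp
    then show "int g dvd (\<Sum>l<d. G $$ (l, n) * ?B $$ (l, i))" using dvd by auto
  qed simp
  then have "int g dvd G $$ (k, n) * \<bar>det ?B\<bar>" by (simp add: abs_if)
  then show ?thesis
    unfolding D using coprime by (simp add: coprime_dvd_mult_left_iff)
qed

text \<open>For a row M of G the entries to be shown integral are (M_n - K) / g, plus (M_i - K) /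
  s_(i+1) if i < n, where 2 K = M_n + M_(n+1). The barycentric relation expresses K through the
  cofactors C_j = t / s_(j+1), whose residues modulo g and the Sylvester numbers are known.\<close>

lemma iso_P_gen:
  assumes d: "d = Suc n" and a_eq: "\<And>j. j < Suc d \<Longrightarrow> a j = sylv_weight n g j" and n: "0 < n"
    and vol: "norm_vol (ratm P) = 2 * (of_nat (tsylv g d))\<^sup>2 / (of_nat g)\<^sup>2"
  shows "iso d (Delta P) (conv_cols (P_gen d g))"
proof (rule iso_of_integral[OF P_gen_carrier])
  let ?t = "tsylv g (Suc n)"
  let ?S = "\<lambda>i. sylv g (Suc i)"
  have t: "0 < ?t" by (rule tsylv_pos[OF g])
  have a_last: "a n = 2 * ?t" "a d = 2 * ?t" using a_eq[of n] a_eq[of d] unfolding d sylv_weight_def by auto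
  show "(\<Sum>j<Suc d. P_gen d g $$ (i, j) / of_nat (a j)) = 0" if "i < d" for i
    using P_gen_bary[OF g, of i n] that a_eq unfolding d by simp
  show "norm_vol (P_gen d g) = norm_vol (ratm P)"
    unfolding vol unfolding d by (rule norm_vol_P_gen[OF g])
  fix i k assume i: "i < d" and k: "k < d"
  define M where "M j = G $$ (k, j)" for j
  have gM: "int g dvd M n"
    unfolding M_def
  proof (rule dvd_G_of_coprime[OF _ _ _ _ k])
    \<comment> \<open>Here the extremal volume enters: it makes this determinant t/g, a product of
      Sylvester numbers and thus coprime to g.\<close>
    have "rat_of_int \<bar>det (mat d d (\<lambda>(i, j). P $$ (i, j)))\<bar> = norm_vol (ratm P) * (of_nat g / of_nat (a d))"
      by (rule norm_vol_times_weight_eq[symmetric])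
    also have "\<dots> = of_nat ?t / of_nat g"
      unfolding vol a_last(2) unfolding d using t g by (simp add: field_simps power2_eq_square)
    also have "\<dots> = of_int (int (\<Prod>i<n. ?S i))"
      unfolding tsylv_eq_prod using g by simp
    finally show "\<bar>det (mat d d (\<lambda>(i, j). P $$ (i, j)))\<bar> = int (\<Prod>i<n. ?S i)"
      by (simp only: of_int_eq_iff)
    show "coprime g (\<Prod>i<n. ?S i)"
      by (intro prod_coprime_right coprime_sylv_index)
    show "g dvd a n" unfolding a_last tsylv_eq_prod by simp
  qed (simp add: d)
  define C where "C j = ?t div ?S j" for j
  have S0: "0 < ?S j" for j unfolding sylv_Suc by simp
  have C: "?t = ?S j * C j" "?S j dvd C j + 1" "g dvd C j" if "j < n" for j
    using tsylv_cofactor[OF that, of g] S0[of j] unfolding C_def by auto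
  \<comment> \<open>Half of M_n + M_(n+1), obtained by multiplying the barycentric relation of the
    row by 2 t.\<close>
  define K where "K = - (\<Sum>j<n. M j * int (C j))"
  have K: "M n + M (Suc n) = 2 * K"
  proof -
    have "0 = rat_of_nat (2 * ?t) * (\<Sum>j<Suc (Suc n). rat_of_int (M j) / of_nat (a j))"
      using bary_G[OF k] unfolding M_def d by simp
    also have "\<dots> = rat_of_nat (2 * ?t) * (\<Sum>j<n. rat_of_int (M j) / of_nat (a j)) + of_int (M n) + of_int (M (Suc n))"
      using t a_last unfolding d by (simp add: field_simps)
    also have "rat_of_nat (2 * ?t) * (\<Sum>j<n. rat_of_int (M j) / of_nat (a j)) = (\<Sum>j<n. of_int (2 * (M j * int (C j))))"
      unfolding sum_distrib_left
    proof (intro sum.cong refl)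
      fix j assume "j \<in> {..<n}"
      then have j: "j < n" by simp
      have "a j = ?S j" using a_eq[of j] j unfolding d sylv_weight_def by simp
      then show "rat_of_nat (2 * ?t) * (rat_of_int (M j) / of_nat (a j)) = of_int (2 * (M j * int (C j)))"
        unfolding C(1)[OF j] using S0[of j] by simp
    qed
    also have "(\<Sum>j<n. rat_of_int (2 * (M j * int (C j)))) = of_int (- 2 * K)"
      unfolding K_def by (simp add: sum_distrib_left sum_negf)
    finally have "rat_of_int (M n + M (Suc n)) = of_int (2 * K)" by simp
    then show ?thesis by (simp only: of_int_eq_iff)
  qed
  have gK: "int g dvd K"
    unfolding K_def using C(3) by (auto intro!: dvd_sum)
  obtain q where q: "M n - K = int g * q" using dvd_diff[OF gM gK] by (elim dvdE)
  have "M n - M (Suc n) = 2 * (M n - K)" using K by simp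
  then have diff: "(rat_of_int (M n) - of_int (M (Suc n))) / (2 * of_nat g) = of_int q"
    using g unfolding q of_int_diff[symmetric] by simp
  have sum: "rat_of_int (M n) + of_int (M (Suc n)) = 2 * of_int K"
    using K unfolding of_int_add[symmetric] by simp
  have "(\<Sum>j<Suc d. P_gen d g $$ (i, j) * of_int (G $$ (k, j)) / of_nat (a j))
    = (\<Sum>j<Suc (Suc n). P_gen (Suc n) g $$ (i, j) * of_int (M j) / of_nat (sylv_weight n g j))"
    using a_eq unfolding d M_def by simp
  also have "\<dots> = (if i < n then of_int (M i) / of_nat (?S i) - (of_int (M n) + of_int (M (Suc n))) / (2 * of_nat (?S i)) else 0)
    + (of_int (M n) - of_int (M (Suc n))) / (2 * of_nat g)"
    by (rule P_gen_weighted_sum[OF g]) (use i d in simp)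
  also have "\<dots> = (if i < n then of_int (M i - K) / of_nat (?S i) else 0) + of_int q"
    unfolding diff sum by (simp add: diff_divide_distrib)
  also have "\<dots> \<in> \<int>"
  proof (cases "i < n")
    case True
    \<comment> \<open>For j distinct from i, \<open>?S i\<close> divides t =
      \<open>?S j * C j\<close> and is coprime to \<open>?S j\<close>. The remaining term of M_i - K
      is M_i (C_i + 1), covered by C_i = -1 modulo \<open>?S i\<close>.\<close>
    have rest: "int (?S i) dvd (\<Sum>j\<in>{..<n} - {i}. M j * int (C j))"
    proof (intro dvd_sum dvd_mult)
      fix j assume "j \<in> {..<n} - {i}"
      then have j: "j < n" "j \<noteq> i" by auto
      have "coprime (?S i) (?S j)"
        using coprime_sylv[of i j g] coprime_sylv[of j i g] j(2) by (cases "i < j") (auto simp: coprime_commute)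
      moreover have "?S i dvd ?S j * C j" unfolding C(1)[OF j(1), symmetric] C(1)[OF True] by simp
      ultimately show "int (?S i) dvd int (C j)" by (simp add: coprime_dvd_mult_right_iff)
    qed
    have "M i - K = M i * int (C i + 1) + (\<Sum>j\<in>{..<n} - {i}. M j * int (C j))"
      unfolding K_def using True by (subst sum.remove[of _ i]) (auto simp: algebra_simps)
    moreover have "int (?S i) dvd M i * int (C i + 1)"
      using C(2)[OF True] by (intro dvd_mult) (simp only: int_dvd_int_iff)
    ultimately have "int (?S i) dvd M i - K" using rest by simp
    then obtain r where "M i - K = int (?S i) * r" by (elim dvdE)
    then have "rat_of_int (M i - K) / of_nat (?S i) = of_int r" using S0[of i] by simp
    then show ?thesis using True by simp
  qed simp
  finally show "(\<Sum>j<Suc d. P_gen d g $$ (i, j) * of_int (G $$ (k, j)) / of_nat (a j)) \<in> \<int>" .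
qed

end

section \<open>The exceptional weights\<close>

lemma det_two: "A \<in> carrier_mat 2 2 \<Longrightarrow> det A = A $$ (0, 0) * A $$ (1, 1) - A $$ (0, 1) * A $$ (1, 0)"
  for A :: "int mat"
proof -
  assume A: "A \<in> carrier_mat 2 2"
  have "mat_delete A 0 j \<in> carrier_mat 1 1" for j using A by (auto simp: mat_delete_def)
  then have "det A = (\<Sum>j<2. A $$ (0, j) * ((- 1) ^ j * mat_delete A 0 j $$ (0, 0)))"
    using laplace_expansion_row[OF A, of 0] by (simp add: cofactor_def det_single)
  then show ?thesis
    using A by (simp add: numeral_2_eq_2 mat_delete_def)
qed

context fano_dual_pair
begin

text \<open>As g = 1, the barycentric relation 3 m_0 + m_1 + m_2 + m_3 = 0 of a row of G already
  makes all entries integral; \<open>iso_P_two\<close> uses m_0 + m_1 + m_2 = 0 in the same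
  way.\<close>

lemma iso_P_one:
  assumes d: "d = 3" and a_eq: "a 0 = 2" "a 1 = 6" "a 2 = 6" "a 3 = 6"
    and vol: "norm_vol (ratm P) = 72"
  shows "iso d (Delta P) (Delta P_one)"
  unfolding Delta_def[of P_one]
proof (rule iso_of_integral)
  show "ratm P_one \<in> carrier_mat d (Suc d)" unfolding d by (rule ratm_exceptional_carrier)
  show "norm_vol (ratm P_one) = norm_vol (ratm P)" unfolding vol by (rule norm_vol_P_one)
  note eval = ratm_def P_one_def mat_of_rows_list_def numeral_2_eq_2 numeral_3_eq_3 less_Suc_eq
  have a': "a (Suc 0) = 6" "a (Suc (Suc 0)) = 6" "a (Suc (Suc (Suc 0))) = 6"
    using a_eq by (simp_all add: numeral_2_eq_2 numeral_3_eq_3)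
  show "(\<Sum>j<Suc d. ratm P_one $$ (i, j) / of_nat (a j)) = 0" if "i < d" for i
    using that a_eq(1) a' unfolding d by (auto simp: eval)
  fix i k assume i: "i < d" and k: "k < d"
  define m0 m1 m2 m3 where "m0 = G $$ (k, 0)" and "m1 = G $$ (k, Suc 0)"
    and "m2 = G $$ (k, Suc (Suc 0))" and "m3 = G $$ (k, Suc (Suc (Suc 0)))"
  have "rat_of_int m0 / 2 + of_int m1 / 6 + of_int m2 / 6 + of_int m3 / 6 = 0"
    using bary_G[OF k] a_eq(1) a' unfolding d m0_def m1_def m2_def m3_def by (simp add: numeral_3_eq_3)
  then have "rat_of_int (3 * m0 + m1 + m2 + m3) = of_int 0" by simp
  then have m1: "m1 = - 3 * m0 - m2 - m3" unfolding of_int_eq_iff by simp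
  have eq: "(\<Sum>j<Suc d. ratm P_one $$ (i, j) * of_int (G $$ (k, j)) / of_nat (a j)) =
    of_int (if i = 0 then - m3 else if i = 1 then - m0 - m3 else m2 - m3)"
    using i a_eq(1) a' unfolding d
    by (auto simp: eval m0_def[symmetric] m1_def[symmetric] m2_def[symmetric] m3_def[symmetric])
      (simp_all add: m1 field_simps)
  show "(\<Sum>j<Suc d. ratm P_one $$ (i, j) * of_int (G $$ (k, j)) / of_nat (a j)) \<in> \<int>"
    unfolding eq by (rule Ints_of_int)
qed

lemma iso_P_two:
  assumes d: "d = 2" and a_eq: "a 0 = 3" "a 1 = 3" "a 2 = 3"
    and vol: "norm_vol (ratm P) = 9"
  shows "iso d (Delta P) (Delta P_two)"
  unfolding Delta_def[of P_two]
proof (rule iso_of_integral)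
  show "ratm P_two \<in> carrier_mat d (Suc d)" unfolding d by (rule ratm_exceptional_carrier)
  show "norm_vol (ratm P_two) = norm_vol (ratm P)" unfolding vol by (rule norm_vol_P_two)
  note eval = ratm_def P_two_def mat_of_rows_list_def numeral_2_eq_2 less_Suc_eq
  have a': "a (Suc 0) = 3" "a (Suc (Suc 0)) = 3"
    using a_eq by (simp_all add: numeral_2_eq_2)
  show "(\<Sum>j<Suc d. ratm P_two $$ (i, j) / of_nat (a j)) = 0" if "i < d" for i
    using that a_eq(1) a' unfolding d by (auto simp: eval)
  fix i k assume i: "i < d" and k: "k < d"
  define m0 m1 m2 where "m0 = G $$ (k, 0)" and "m1 = G $$ (k, Suc 0)" and "m2 = G $$ (k, Suc (Suc 0))"
  have "rat_of_int m0 / 3 + of_int m1 / 3 + of_int m2 / 3 = 0"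
    using bary_G[OF k] a_eq(1) a' unfolding d m0_def m1_def m2_def by (simp add: numeral_2_eq_2)
  then have "rat_of_int (m0 + m1 + m2) = of_int 0" by simp
  then have m0: "m0 = - m1 - m2" unfolding of_int_eq_iff by simp
  have eq: "(\<Sum>j<Suc d. ratm P_two $$ (i, j) * of_int (G $$ (k, j)) / of_nat (a j)) =
    of_int (if i = 0 then - m2 else m1 - m2)"
    using i a_eq(1) a' unfolding d
    by (auto simp: eval m0_def[symmetric] m1_def[symmetric] m2_def[symmetric])
      (simp_all add: m0 field_simps)
  show "(\<Sum>j<Suc d. ratm P_two $$ (i, j) * of_int (G $$ (k, j)) / of_nat (a j)) \<in> \<int>"
    unfolding eq by (rule Ints_of_int)
qed

text \<open>Modulo 2 the three vertices are nonzero vectors of a plane with sum zero, hence pairwise distinct,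
  so any two of them span an odd determinant.\<close>

lemma norm_vol_neq_eighteen:
  assumes d: "d = 2" and g2: "g = 2" and a_eq: "a 0 = 6" "a 1 = 6" "a 2 = 6"
  shows "norm_vol (ratm P) \<noteq> 18"
proof
  assume vol: "norm_vol (ratm P) = 18"
  let ?B = "mat d d (\<lambda>(i, j). P $$ (i, j))"
  have "rat_of_int \<bar>det ?B\<bar> = of_int 6"
    using norm_vol_times_weight_eq unfolding vol a_eq d g2 by simp
  then have "\<bar>det ?B\<bar> = 6" by (simp only: of_int_eq_iff)
  moreover have "det ?B = P $$ (0, 0) * P $$ (1, 1) - P $$ (0, 1) * P $$ (1, 0)"
    using det_two[of ?B] d by simp
  ultimately have even: "even (P $$ (0, 0) * P $$ (1, 1) - P $$ (0, 1) * P $$ (1, 0))"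
    by (metis dvd_abs_iff even_numeral)
  have a': "a (Suc 0) = 6" "a (Suc (Suc 0)) = 6" using a_eq by (simp_all add: numeral_2_eq_2)
  have sum: "P $$ (i, 0) + P $$ (i, 1) + P $$ (i, 2) = 0" if "i < 2" for i
  proof -
    have "rat_of_int (P $$ (i, 0)) / 6 + of_int (P $$ (i, 1)) / 6 + of_int (P $$ (i, 2)) / 6 = 0"
      using bary_P[of i] that a_eq(1) a' unfolding d by (simp add: numeral_2_eq_2)
    then have "rat_of_int (P $$ (i, 0) + P $$ (i, 1) + P $$ (i, 2)) = of_int 0" by simp
    then show ?thesis by (simp only: of_int_eq_iff)
  qed
  have odd: "odd (P $$ (0, j)) \<or> odd (P $$ (1, j))" if j: "j < 3" for j
  proof (rule ccontr)
    assume "\<not> ?thesis"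
    then have ev: "even (P $$ (i, j))" if "i < 2" for i using that by (auto simp: less_2_cases_iff)
    let ?w = "vec 2 (\<lambda>i. P $$ (i, j) div 2)"
    have "col P j = 2 \<cdot>\<^sub>v ?w"
      using P d j ev by (intro eq_vecI) auto
    moreover have "primitive (col P j)" using prim[of j] j d by simp
    moreover have "dim_vec ?w = dim_vec (col P j)" using P d by simp
    ultimately have "(2::int) = 1 \<or> (2::int) = - 1" unfolding primitive_def by blast
    then show False by simp
  qed
  have par: "odd (P $$ (i, 2)) \<longleftrightarrow> odd (P $$ (i, 0)) \<noteq> odd (P $$ (i, 1))" if "i < 2" for i
    using sum[OF that] by presburger
  show False
    using even odd[of 0] odd[of 1] odd[of 2] par[of 0] par[of 1] by auto
qed

text \<open>Assuming the reverse inequality settles the bound and its equality case together: it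
  forces extremal weights, for these the product estimate is exactly the claimed volume, and the
  isomorphism follows from weights and volume.\<close>

lemma norm_vol_eq_of_ge:
  assumes d: "2 \<le> d" and dg: "(d, g) \<noteq> (2, 1)" and incr: "\<And>i. i < d \<Longrightarrow> a i \<le> a (Suc i)"
    and ge: "2 * (of_nat (tsylv g d))\<^sup>2 / (of_nat g)\<^sup>2 \<le> norm_vol (ratm P)"
  shows "norm_vol (ratm P) = 2 * (of_nat (tsylv g d))\<^sup>2 / (of_nat g)\<^sup>2 \<and>
    ((d, g) = (3, 1) \<and> iso d (Delta P) (Delta P_one) \<or> iso d (Delta P) (conv_cols (P_gen d g)))"
proof -
  obtain n where n: "d = Suc n" "0 < n" using d by (cases d) auto
  let ?t = "tsylv g d"
  let ?A = "\<Prod>j<d. a j"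
  have g0: "rat_of_nat g \<noteq> 0" using g by simp
  have t: "real ?t = sylv_iter (real g) (d - 1)" unfolding n(1) by (simp add: tsylv_eq_sylv_iter)
  have "rat_of_nat (2 * ?t\<^sup>2) = 2 * (of_nat ?t)\<^sup>2 / (of_nat g)\<^sup>2 * of_nat g * of_nat g"
    using g0 by (simp add: power2_eq_square)
  also have "\<dots> \<le> norm_vol (ratm P) * of_nat g * of_nat g"
    using ge by (intro mult_right_mono) auto
  also have "\<dots> \<le> of_nat ?A * of_nat g"
    using norm_vol_le by (intro mult_right_mono) auto
  also have "\<dots> = rat_of_nat (?A * g)" by simp
  finally have nat_le: "2 * ?t\<^sup>2 \<le> ?A * g" by (simp only: of_nat_le_iff)
  then have "real (2 * ?t\<^sup>2) \<le> real (?A * g)" by (simp only: of_nat_le_iff)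
  then have large: "2 * sylv_iter (real g) (d - 1) ^ 2 / real g \<le> real ?A"
    unfolding t[symmetric] using g by (simp add: divide_le_eq)
  have sum: "(\<Sum>i\<le>d. 1 / real (a i)) = 1 / real g"
  proof -
    have "real_of_rat (\<Sum>j<Suc d. 1 / rat_of_nat (a j)) = real_of_rat (1 / rat_of_nat g)"
      unfolding sum_inverse ..
    then show ?thesis
      by (simp add: of_rat_sum of_rat_add of_rat_divide lessThan_Suc_atMost[symmetric])
  qed
  have vol_eq: "norm_vol (ratm P) = 2 * (of_nat ?t)\<^sup>2 / (of_nat g)\<^sup>2" if "?A * g = 2 * ?t\<^sup>2"
  proof (rule antisym[OF _ ge])
    have "norm_vol (ratm P) * of_nat g * of_nat g \<le> of_nat ?A * of_nat g"
      using norm_vol_le by (intro mult_right_mono) auto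
    also have "\<dots> = rat_of_nat (2 * ?t\<^sup>2)" unfolding that[symmetric] by simp
    finally show "norm_vol (ratm P) \<le> 2 * (of_nat ?t)\<^sup>2 / (of_nat g)\<^sup>2"
      using g by (simp add: pos_le_divide_eq power2_eq_square mult.assoc)
  qed
  have "1 \<le> g" using g by simp
  from extremal_unit_fraction_partition[OF this d dg a incr sum large]
  consider (general) "\<forall>i<d - 1. real (a i) = sylv_iter (real g) i + 1" "real (a (d - 1)) = 2 * sylv_iter (real g) (d - 1)"
      "a d = a (d - 1)"
    | (three) "d = 3" "g = 1" "a 0 = 2" "a 1 = 6" "a 2 = 6" "a 3 = 6"
    | (two) "d = 2" "g = 2" "a 0 = 6" "a 1 = 6" "a 2 = 6"
    by (auto simp: less_Suc_eq_le)
  then show ?thesis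
  proof cases
    case general
    have a_lt: "a i = sylv g (Suc i)" if "i < n" for i
    proof -
      have "real (a i) = real (sylv g (Suc i))"
        using general(1) that unfolding n(1) sylv_Suc of_nat_add tsylv_eq_sylv_iter by simp
      then show ?thesis by (simp only: of_nat_eq_iff)
    qed
    have "real (a n) = real (2 * tsylv g (Suc n))"
      using general(2) unfolding n(1) of_nat_mult tsylv_eq_sylv_iter by simp
    then have a_n: "a n = 2 * tsylv g (Suc n)" by (simp only: of_nat_eq_iff)
    have a_eq: "a j = sylv_weight n g j" if "j < Suc d" for j
      using a_lt[of j] a_n general(3) that unfolding sylv_weight_def n(1) by (auto simp: less_Suc_eq)
    have "(\<Prod>j<n. a j) = (\<Prod>j<n. sylv g (Suc j))" using a_lt by (intro prod.cong) auto
    then have "?A * g = 2 * ?t\<^sup>2"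
      using a_n unfolding n(1) by (simp add: tsylv_eq_prod power2_eq_square)
    then have vol: "norm_vol (ratm P) = 2 * (of_nat ?t)\<^sup>2 / (of_nat g)\<^sup>2" by (rule vol_eq)
    then show ?thesis using iso_P_gen[OF n(1) a_eq n(2) vol] by blast
  next
    case three
    have t6: "?t = 6" using three by (simp add: tsylv_def numeral_3_eq_3)
    have "?A = 72" using three by (simp add: numeral_3_eq_3 numeral_2_eq_2)
    then have vol: "norm_vol (ratm P) = 2 * (of_nat ?t)\<^sup>2 / (of_nat g)\<^sup>2"
      using t6 three by (intro vol_eq) simp
    moreover have "norm_vol (ratm P) = 72" unfolding vol t6 by (simp add: three(2))
    ultimately show ?thesis using iso_P_one[OF three(1,3-6)] three by simp
  next
    case two
    have t6: "?t = 6" using two by (simp add: tsylv_def numeral_2_eq_2)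
    have "?A = 36" using two by (simp add: numeral_2_eq_2)
    then have vol: "norm_vol (ratm P) = 2 * (of_nat ?t)\<^sup>2 / (of_nat g)\<^sup>2"
      using t6 two by (intro vol_eq) simp
    have "norm_vol (ratm P) = 18" unfolding vol t6 by (simp add: two(2))
    \<comment> \<open>The weights 6, 6, 6 attain the product but not the volume.\<close>
    then show ?thesis using norm_vol_neq_eighteen[OF two] by simp
  qed
qed

text \<open>The case where the extremal partition loses to equal parts, solved directly: the least
  weight is 2 or 3.\<close>

lemma norm_vol_reflexive_plane:
  assumes d: "d = 2" and g1: "g = 1" and incr: "\<And>i. i < d \<Longrightarrow> a i \<le> a (Suc i)"
    and ge: "9 \<le> norm_vol (ratm P)"
  shows "norm_vol (ratm P) = 9 \<and> iso d (Delta P) (Delta P_two)"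
proof -
  define x y z where "x = int (a 0)" and "y = int (a 1)" and "z = int (a 2)"
  have pos: "0 < x" "0 < y" "0 < z" using a d unfolding x_def y_def z_def by auto
  have xy: "x \<le> y" and yz: "y \<le> z" using incr[of 0] incr[of 1] d
    unfolding x_def y_def z_def by (auto simp: numeral_2_eq_2)
  have prod: "(\<Prod>j<d. a j) = a 0 * a 1" unfolding d by (simp add: numeral_2_eq_2)
  have le: "norm_vol (ratm P) \<le> of_nat (a 0 * a 1)"
    using norm_vol_le unfolding prod g1 by simp
  then have "rat_of_nat 9 \<le> of_nat (a 0 * a 1)" using ge by simp
  then have "9 \<le> a 0 * a 1" by (simp only: of_nat_le_iff)
  then have "int 9 \<le> int (a 0 * a 1)" by (simp only: of_nat_le_iff)
  then have nine: "9 \<le> x * y" unfolding x_def y_def by simp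
  have "1 / rat_of_nat (a 0) + 1 / rat_of_nat (a 1) + 1 / rat_of_nat (a 2) = 1"
    using sum_inverse unfolding d g1 by (simp add: numeral_2_eq_2)
  then have "1 / rat_of_int x + 1 / rat_of_int y + 1 / rat_of_int z = 1"
    unfolding x_def y_def z_def by simp
  then have "rat_of_int (y * z + x * z + x * y) = of_int (x * y * z)"
    using pos by (simp add: field_simps)
  then have eq: "y * z + x * z + x * y = x * y * z" by (simp only: of_int_eq_iff)
  have "x * z \<le> y * z" "x * y \<le> y * z"
    using xy yz pos by (auto intro!: mult_mono simp: mult.commute)
  then have "x * (y * z) \<le> 3 * (y * z)" using eq by (simp add: mult.assoc)
  then have "x \<le> 3" using pos by (simp add: mult_le_cancel_right)
  moreover have "x \<noteq> 1" using eq pos by auto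
  ultimately have "x = 2 \<or> x = 3" using pos by auto
  then have "x = 3 \<and> y = 3 \<and> z = 3"
  proof
    assume x: "x = 2"
    then have "2 * (y + z) = y * z" using eq by (simp add: algebra_simps)
    \<comment> \<open>From 9 \<le> 2 y; combined with 2 (y + z) = y z it gives 3 z \<le> 2 y,
      impossible for y \<le> z.\<close>
    moreover have "y * z \<ge> 5 * z" using nine x pos by (intro mult_right_mono) auto
    ultimately have "5 * z \<le> 2 * (y + z)" by simp
    then have False using yz pos by arith
    then show ?thesis ..
  next
    assume x: "x = 3"
    then have e: "3 * y + 3 * z = 2 * (y * z)" using eq by (simp add: algebra_simps)
    have "3 * z \<le> y * z" using x xy pos by (intro mult_right_mono) auto
    then have "z \<le> y" using e by linarith
    then have "y = z" using yz by simp
    then have "y = 3" using e pos by simp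
    then show ?thesis using x \<open>y = z\<close> by simp
  qed
  then have a_eq: "a 0 = 3" "a 1 = 3" "a 2 = 3" unfolding x_def y_def z_def by auto
  then have "norm_vol (ratm P) = 9" using le ge by simp
  then show ?thesis using iso_P_two[OF d a_eq] by simp
qed

end

text \<open>The volume estimate omits the last weight, and the partition results want it to be the
  largest; reordering the columns changes neither hull nor volume.\<close>

lemma sorted_dual_pair:
  assumes "fano_simplex d P" and "gorenstein_index d (Delta P) = g" and "0 < g"
  obtains P' G a where "fano_dual_pair d g P' G a" "\<And>i. i < d \<Longrightarrow> a i \<le> a (Suc i)"
    "norm_vol (ratm P') = norm_vol (ratm P)" "Delta P' = Delta P"
proof -
  obtain G a where "fano_dual_pair d g P G a" using fano_simplex_dual_pair[OF assms] by blast
  then interpret fano_dual_pair d g P G a .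
  obtain p where p: "p permutes {0..<Suc d}" "\<And>i. Suc i < Suc d \<Longrightarrow> a (p i) \<le> a (p (Suc i))"
    using sorting_permutation[of "Suc d" a] by blast
  let ?P = "mat d (Suc d) (\<lambda>(i, j). P $$ (i, p j))"
  have R: "ratm P \<in> carrier_mat d (Suc d)" using P unfolding ratm_def by simp
  have eq: "ratm ?P = mat d (Suc d) (\<lambda>(i, j). ratm P $$ (i, p j))"
    using P permutes_in_image[OF p(1)] unfolding ratm_def by (intro eq_matI) auto
  show thesis
  proof (rule that[OF permute[OF p(1)]])
    show "norm_vol (ratm ?P) = norm_vol (ratm P)" unfolding eq by (rule norm_vol_permute_cols[OF R p(1)])
    show "Delta ?P = Delta P" unfolding Delta_def eq by (rule conv_cols_permute[OF R p(1)])
  qed (use p(2) in simp)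
qed

theorem theorem1p1:
  fixes d g :: nat and P :: "int mat"
  assumes "d \<ge> 2" and "g \<ge> 1"
    and "fano_simplex d P"
    and "gorenstein_index d (Delta P) = g"
  shows "((d, g) = (2, 1) \<longrightarrow>
            norm_vol (ratm P) \<le> 9 \<and>
            (norm_vol (ratm P) = 9 \<longleftrightarrow> iso d (Delta P) (Delta P_two)))
       \<and> ((d, g) \<noteq> (2, 1) \<longrightarrow>
            norm_vol (ratm P) \<le> 2 * (of_nat (tsylv g d))^2 / (of_nat g)^2 \<and>
            (norm_vol (ratm P) = 2 * (of_nat (tsylv g d))^2 / (of_nat g)^2 \<longleftrightarrow>
               ((d, g) = (3, 1) \<and> iso d (Delta P) (Delta P_one))
               \<or> iso d (Delta P) (conv_cols (P_gen d g))))"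
proof -
  have g: "0 < g" using assms(2) by simp
  obtain P' G a where pair: "fano_dual_pair d g P' G a" and incr: "\<And>i. i < d \<Longrightarrow> a i \<le> a (Suc i)"
    and P': "norm_vol (ratm P') = norm_vol (ratm P)" "Delta P' = Delta P"
    by (rule sorted_dual_pair[OF assms(3,4) g]) (rule that, assumption+)
  have simplex: "is_simplex_mat d (ratm P)" using assms(3) unfolding fano_simplex_def by simp
  have invariant: "norm_vol (ratm P) = norm_vol Q" if "iso d (Delta P) (conv_cols Q)" "Q \<in> carrier_mat d (Suc d)" for Q
    using iso_imp_norm_vol_eq[OF simplex that(2)] that(1) unfolding Delta_def by simp
  show ?thesis
  proof (intro conjI impI)
    assume "(d, g) = (2, 1)"
    then have dg: "d = 2" "g = 1" by auto
    \<comment> \<open>In a linear order this one implication yields the bound and one direction of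
      the equivalence; the other is invariance of the volume.\<close>
    have ge: "norm_vol (ratm P) = 9 \<and> iso d (Delta P) (Delta P_two)" if "9 \<le> norm_vol (ratm P)"
      using fano_dual_pair.norm_vol_reflexive_plane[OF pair dg incr] that unfolding P' by simp
    then show "norm_vol (ratm P) \<le> 9" by (metis linear order_refl)
    have "norm_vol (ratm P) = 9" if "iso d (Delta P) (Delta P_two)"
      using invariant[of "ratm P_two"] that ratm_exceptional_carrier(1) norm_vol_P_two
      unfolding dg Delta_def by simp
    then show "norm_vol (ratm P) = 9 \<longleftrightarrow> iso d (Delta P) (Delta P_two)" using ge by auto
  next
    assume dg: "(d, g) \<noteq> (2, 1)"
    let ?B = "2 * (of_nat (tsylv g d))^2 / (of_nat g)^2 :: rat"
    have ge: "norm_vol (ratm P) = ?B \<and>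
      ((d, g) = (3, 1) \<and> iso d (Delta P) (Delta P_one) \<or> iso d (Delta P) (conv_cols (P_gen d g)))"
      if "?B \<le> norm_vol (ratm P)"
      using fano_dual_pair.norm_vol_eq_of_ge[OF pair assms(1) dg incr] that unfolding P' by simp
    then show "norm_vol (ratm P) \<le> ?B" by (metis linear order_refl)
    have "norm_vol (ratm P) = ?B" if "(d, g) = (3, 1)" "iso d (Delta P) (Delta P_one)"
    proof -
      have dg: "d = 3" "g = 1" using that by auto
      have "tsylv g d = 6" unfolding dg by (simp add: tsylv_def numeral_3_eq_3)
      moreover have "norm_vol (ratm P) = 72"
        using invariant[of "ratm P_one"] that ratm_exceptional_carrier(2) norm_vol_P_one
        unfolding dg Delta_def by simp
      ultimately show ?thesis unfolding dg by simp
    qed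
    moreover have "norm_vol (ratm P) = ?B" if "iso d (Delta P) (conv_cols (P_gen d g))"
    proof -
      obtain n where "d = Suc n" using assms(1) by (cases d) auto
      then show ?thesis using invariant[OF that P_gen_carrier] norm_vol_P_gen[OF g, of n] by simp
    qed
    ultimately show "norm_vol (ratm P) = ?B \<longleftrightarrow>
      ((d, g) = (3, 1) \<and> iso d (Delta P) (Delta P_one)) \<or> iso d (Delta P) (conv_cols (P_gen d g))"
      using ge by auto
  qed
qed

end
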